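(* The Airy line ensemble $\mathcal{A}$ satisfies the strong mixing condition: if $\mathbb{P}$ denotes the law of $\mathcal{A}$ on $(X,\mathcal{C})$, then for all $A,B\in\mathcal{C}$, $$\lim_{T\to\infty}\mathbb{P}[\theta_TA\cap B]=\mathbb{P}[A]\,\mathbb{P}[B].$$
   Context: Let $\mathbb{N}=\{1,2,\dots\}$. Let $X$ be the set of continuous functions $f:\mathbb{N}\times\mathbb{R}\to\mathbb{R}$ with the topology of uniform convergence on compact subsets of $\mathbb{N}\times\mathbb{R}$, and let $\mathcal{C}$ be its Borel $\sigma$-field. An $\mathbb{N}\times\mathbb{R}$-indexed line ensemble is a random variable $\mathcal{L}$ with values in $(X,\mathcal{C})$; write $\mathcal{L}_i(x)=\mathcal{L}(i,x)$. Airy line ensemble: it is the (unique in law, known to exist) $\mathbb{N}\times\mathbb{R}$-indexed line ensemble $\mathcal{A}$, with lines ordered $\mathcal{A}_1(t)>\mathcal{A}_2(t)>\cdots$, such that for every $n\ge 1$ and every finite set $I=\{t_1,\dots,t_n\}\subset\mathbb{R}$, the point process $\{(t,\mathcal{A}_i(t)): i\in\mathbb{N},\,t\in I\}$ on $I\times\mathbb{R}$ is determinantal (with respect to counting measure times Lebesgue measure) with correlation kernel the extended Airy$_2$ kernel $$K^{\rm ext}_2(s,x;t,y)=\begin{cases}\int_0^\infty e^{-\lambda(s-t)}\,\mathrm{Ai}(x+\lambda)\mathrm{Ai}(y+\lambda)\,d\lambda & \text{if } s\ge t,\\[2pt] -\int_{-\infty}^0 e^{-\lambda(s-t)}\,\mathrm{Ai}(x+\lambda)\mathrm{Ai}(y+\lambda)\,d\lambda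 & \text{if } s<t,\end{cases}$$ where $\mathrm{Ai}$ is the Airy function. Horizontal shifts: for $s\in\mathbb{R}$, $\theta_s:X\to X$ is $(\theta_sf)(i,x)=f(i,x+s)$, and $\theta_sA=\{\theta_s\omega:\omega\in A\}$ for $A\in\mathcal{C}$. The law of $\mathcal{A}$ is invariant under every $\theta_s$ (immediate from the kernel). *)

theory Defs
  imports "HOL-Probability.Probability" "Jordan_Normal_Form.Determinant"
begin

text \<open>Lines are indexed by \<open>1, 2, \<dots>\<close>; members of \<open>line_space\<close> are made
  \<^const>\<open>extensional\<close>, so that equality in \<open>line_space\<close> is equality on \<open>line_domain\<close>.\<close>

definition line_domain :: "(nat \<times> real) set" where
  "line_domain = {1..} \<times> UNIV"

definition line_space :: "(nat \<times> real \<Rightarrow> real) set" where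
  "line_space = {f \<in> extensional line_domain. continuous_on line_domain f}"

definition compact_nbhd ::
  "(nat \<times> real \<Rightarrow> real) \<Rightarrow> (nat \<times> real) set \<Rightarrow> real \<Rightarrow> (nat \<times> real \<Rightarrow> real) set" where
  "compact_nbhd f K \<epsilon> = {g \<in> line_space. \<forall>p\<in>K. dist (g p) (f p) < \<epsilon>}"

text \<open>Uniform convergence on compact sets. As \<open>K\<close> is compact and the functions are continuous,
  for nonempty \<open>K\<close> the set \<open>compact_nbhd f K \<epsilon>\<close> is the open \<open>\<epsilon>\<close>-ball around \<open>f\<close> for the
  supremum over \<open>K\<close>.\<close>

definition line_topology :: "(nat \<times> real \<Rightarrow> real) topology" where
  "line_topology = topology_generated_by
     {compact_nbhd f K \<epsilon> | f K \<epsilon>. f \<in> line_space \<and> compact K \<and> K \<subseteq> line_domain \<and> 0 < \<epsilon>}"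

lemma topspace_line_topology [simp]: "topspace line_topology = line_space"
proof -
  let ?N = "{compact_nbhd f K \<epsilon> | f K \<epsilon>.
    f \<in> line_space \<and> compact K \<and> K \<subseteq> line_domain \<and> 0 < \<epsilon>}"
  have "\<Union>?N = line_space"
  proof
    show "\<Union>?N \<subseteq> line_space"
      by (auto simp: compact_nbhd_def)
    show "line_space \<subseteq> \<Union>?N"
    proof
      fix f assume f: "f \<in> line_space"
      have "compact_nbhd f {} 1 \<in> ?N"
        by (rule CollectI, intro exI[of _ f] exI[of _ "{}"] exI[of _ 1]) (simp add: f)
      moreover have "f \<in> compact_nbhd f {} 1"
        using f by (simp add: compact_nbhd_def)
      ultimately show "f \<in> \<Union>?N"
        by (rule UnionI)
    qed
  qed
  then show ?thesis
    by (simp only: line_topology_def topology_generated_by_topspace)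
qed

definition line_borel :: "(nat \<times> real \<Rightarrow> real) measure" where
  "line_borel = sigma line_space {U. openin line_topology U}"

lemma space_line_borel [simp]: "space line_borel = line_space"
  by (simp add: line_borel_def space_measure_of_conv)

lemma sets_line_borel: "sets line_borel = sigma_sets line_space {U. openin line_topology U}"
proof -
  have "{U. openin line_topology U} \<subseteq> Pow line_space"
    by (metis Pow_iff mem_Collect_eq openin_subset subsetI topspace_line_topology)
  then show ?thesis
    by (simp only: line_borel_def sets_measure_of)
qed

definition line_ensemble :: "'w measure \<Rightarrow> ('w \<Rightarrow> nat \<times> real \<Rightarrow> real) \<Rightarrow> bool" where
  "line_ensemble M L \<longleftrightarrow> prob_space M \<and> L \<in> measurable M line_borel"

definition horizontal_shift :: "real \<Rightarrow> (nat \<times> real \<Rightarrow> real) \<Rightarrow> nat \<times> real \<Rightarrow> real" where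
  "horizontal_shift s f = (\<lambda>(i, x). f (i, x + s))"

text \<open>No restriction to \<open>line_domain\<close> is needed: \<open>horizontal_shift\<close> preserves \<open>extensional line_domain\<close>.\<close>

lemma horizontal_shift_in_line_space: "horizontal_shift s f \<in> line_space" if f: "f \<in> line_space"
proof -
  have "continuous_on line_domain (\<lambda>p. f (fst p, snd p + s))"
  proof (rule continuous_on_compose2[where f = "\<lambda>p. (fst p, snd p + s)"])
    show "continuous_on line_domain f"
      using f by (simp add: line_space_def)
    show "continuous_on line_domain (\<lambda>p. (fst p, snd p + s))"
      by (intro continuous_intros)
    show "(\<lambda>p. (fst p, snd p + s)) ` line_domain \<subseteq> line_domain"
      by (auto simp: line_domain_def)
  qed
  moreover have "horizontal_shift s f = (\<lambda>p. f (fst p, snd p + s))"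
    by (simp add: horizontal_shift_def fun_eq_iff)
  moreover have "horizontal_shift s f \<in> extensional line_domain"
    using f by (simp add: line_space_def line_domain_def horizontal_shift_def extensional_def)
  ultimately show ?thesis
    by (simp add: line_space_def)
qed

text \<open>The number of \<open>n\<close>-tuples of pairwise distinct points of the configuration \<open>S\<close> that lie in
  \<open>B\<close>; tuples are extensional functions on \<open>{..<n}\<close>, as in \<^const>\<open>PiM\<close>.\<close>

definition factorial_count :: "nat \<Rightarrow> 'p set \<Rightarrow> (nat \<Rightarrow> 'p) set \<Rightarrow> ennreal" where
  "factorial_count n S B =
     emeasure (count_space UNIV) {z \<in> B. z \<in> {..<n} \<rightarrow>\<^sub>E S \<and> inj_on z {..<n}}"

text \<open>The random set \<open>S\<close>, a simple point process on \<open>space \<mu>\<close>, has \<open>n\<close>-point correlation function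
  \<open>\<rho>\<close> with respect to \<open>\<mu>\<close>: its \<open>n\<close>-th factorial moment measure is \<open>\<rho> d\<mu>\<^sup>n\<close>.\<close>

definition correlation_function ::
  "'w measure \<Rightarrow> ('w \<Rightarrow> 'p set) \<Rightarrow> 'p measure \<Rightarrow> nat \<Rightarrow> ((nat \<Rightarrow> 'p) \<Rightarrow> real) \<Rightarrow> bool" where
  "correlation_function M S \<mu> n \<rho> \<longleftrightarrow>
     \<rho> \<in> borel_measurable (PiM {..<n} (\<lambda>_. \<mu>)) \<and>
     (AE z in PiM {..<n} (\<lambda>_. \<mu>). 0 \<le> \<rho> z) \<and>
     (\<forall>B\<in>sets (PiM {..<n} (\<lambda>_. \<mu>)).
        (\<integral>\<^sup>+\<omega>. factorial_count n (S \<omega>) B \<partial>M) =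
        (\<integral>\<^sup>+z\<in>B. ennreal (\<rho> z) \<partial>(PiM {..<n} (\<lambda>_. \<mu>))))"

definition determinantal ::
  "'w measure \<Rightarrow> ('w \<Rightarrow> 'p set) \<Rightarrow> 'p measure \<Rightarrow> ('p \<Rightarrow> 'p \<Rightarrow> real) \<Rightarrow> bool" where
  "determinantal M S \<mu> K \<longleftrightarrow>
     (\<forall>n\<ge>1. correlation_function M S \<mu> n
        (\<lambda>z. Determinant.det (Matrix.mat n n (\<lambda>(i, j). K (z i) (z j)))))"

text \<open>The integral \<open>\<integral>\<^sub>0\<^sup>\<infinity> cos (t\<^sup>3/3 + x t) dt\<close> converges only conditionally, hence
  the limit.\<close>

definition Airy_Ai :: "real \<Rightarrow> real" where
  "Airy_Ai x = (1 / pi) * Lim at_top (\<lambda>R. integral {0..R} (\<lambda>t. cos (t ^ 3 / 3 + x * t)))"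

definition ext_Airy_kernel :: "real \<times> real \<Rightarrow> real \<times> real \<Rightarrow> real" where
  "ext_Airy_kernel = (\<lambda>(s, x) (t, y).
     if s \<ge> t
     then (LBINT l:{0..}. exp (- l * (s - t)) * Airy_Ai (x + l) * Airy_Ai (y + l))
     else - (LBINT l:{..0}. exp (- l * (s - t)) * Airy_Ai (x + l) * Airy_Ai (y + l)))"

text \<open>The lines are almost surely strictly ordered, so the points of one realization at a given
  time are pairwise distinct and the configuration may be taken to be a set.\<close>

definition airy_line_ensemble :: "'w measure \<Rightarrow> ('w \<Rightarrow> nat \<times> real \<Rightarrow> real) \<Rightarrow> bool" where
  "airy_line_ensemble M L \<longleftrightarrow>
     line_ensemble M L \<and>
     (AE \<omega> in M. \<forall>t. \<forall>i\<ge>1. L \<omega> (i, t) > L \<omega> (i + 1, t)) \<and>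
     (\<forall>I. finite I \<and> I \<noteq> {} \<longrightarrow>
        determinantal M (\<lambda>\<omega>. {(t, L \<omega> (i, t)) | i t. 1 \<le> i \<and> t \<in> I})
          (count_space I \<Otimes>\<^sub>M lborel) ext_Airy_kernel)"

end

theory Submission
  imports Defs "HOL-Real_Asymp.Real_Asymp"
begin

text \<open>The proof rests on void probabilities. For a bounded set \<open>D\<close> of points \<open>(t, x)\<close> that involves only
  finitely many times, inclusion-exclusion over the points of the configuration in \<open>D\<close> writes the
  probability that no line passes through \<open>D\<close> as the Fredholm series
  \<open>\<Sum>n. (- 1)\<^sup>n / n! \<integral> det (K (z\<^sub>i, z\<^sub>j))\<close>, the integrals being over \<open>D\<^sup>n\<close> (\<open>void_probability_sums\<close>).
  Such void events suffice. They are closed under intersection, because avoiding \<open>D\<close> and \<open>E\<close> is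
  avoiding \<open>D \<union> E\<close>; and on strictly ordered families of lines they generate every Borel set
  (\<open>borel_from_void_events\<close>): line \<open>i + 1\<close> is above \<open>a\<close> at time \<open>t\<close> iff, for some rational \<open>r > a\<close>,
  line \<open>i\<close> is above \<open>r\<close> and some line passes through \<open>{t} \<times> {a<..r}\<close>. For a measure-preserving
  family of maps, the sets for which mixing holds against a fixed set form a \<open>\<lambda>\<close>-system, so mixing
  spreads from void events to all Borel sets (\<open>mixing_from_generator\<close>).

  For void events, stationarity is the invariance of the kernel under time shifts, applied term by term
  to the Fredholm series. For mixing, take two windows whose times are at least \<open>\<tau>\<close> apart. Since the
  Airy function is bounded by 3, the kernel between them is at most \<open>9 / \<tau>\<close>; hence each correlation
  determinant is close to the product of its two diagonal blocks, and each term of the series for the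
  union is close to the corresponding term of the Cauchy product of the two series
  (\<open>moment_integral_factorization\<close>). This has to be summed over \<open>n\<close> uniformly in the shift.
  Bounding a determinant by its \<open>n!\<close> products would only give convergence for small windows.
  Hadamard's inequality (\<open>hadamard_bound\<close>) gives \<open>C\<^sup>n n\<^bsup>n/2\<^esup>\<close> instead, which is summable after
  division by \<open>n!\<close>, with a constant \<open>C\<close> that does not depend on the shift
  (\<open>ext_Airy_kernel_bounded\<close>). Tannery's theorem then yields
  \<open>void_events_mixing\<close>.

  The Airy function enters only through \<open>\<bar>Ai x\<bar> \<le> 3\<close> for all \<open>x\<close> and \<open>\<bar>Ai x\<bar> \<le> 1 / x\<close> for \<open>x > 0\<close>, both
  obtained by integrating the oscillatory integral by parts. The second bound makes \<open>Ai\<^sup>2\<close> integrable at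
  \<open>+\<infinity>\<close>, so that the kernel at equal times is bounded on every half-line \<open>[- m, \<infinity>)\<close>.\<close>

section \<open>Bounds on the Airy function and the extended Airy kernel\<close>

definition airy_phase :: "real \<Rightarrow> real \<Rightarrow> real" where
  "airy_phase x t = t ^ 3 / 3 + x * t"

definition airy_partial :: "real \<Rightarrow> real \<Rightarrow> real" where
  "airy_partial R x = integral {0..R} (\<lambda>t. cos (airy_phase x t))"

lemma airy_phase_deriv [derivative_intros]:
  "(airy_phase x has_real_derivative t\<^sup>2 + x) (at t within S)"
  unfolding airy_phase_def by (auto intro!: derivative_eq_intros simp: power2_eq_square)

lemma continuous_on_airy_phase [continuous_intros]: "continuous_on S (airy_phase x)"
  unfolding airy_phase_def by (intro continuous_intros) auto

text \<open>Van der Corput's first-derivative estimate. Integration by parts writes the integral as the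
  boundary terms of \<open>sin \<phi> / \<phi>'\<close> plus \<open>\<integral> sin \<phi> \<phi>'' / \<phi>'\<^sup>2\<close>. The phase derivative
  \<open>\<phi>' t = t\<^sup>2 + x\<close> increases and keeps its sign, so the last integrand is dominated by the derivative of
  \<open>- 1 / \<phi>'\<close>; each of the three contributions is at most \<open>1 / m\<close>.\<close>

lemma oscillatory_bound:
  fixes a b m x :: real
  assumes ab: "0 \<le> a" "a \<le> b" and m: "0 < m"
    and deriv: "m \<le> a\<^sup>2 + x \<or> b\<^sup>2 + x \<le> - m"
  shows "\<bar>integral {a..b} (\<lambda>t. cos (airy_phase x t))\<bar> \<le> 3 / m"
proof -
  define q where "q t = t\<^sup>2 + x" for t :: real
  have q_abs: "m \<le> \<bar>q t\<bar>" if "t \<in> {a..b}" for t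
  proof -
    have "a\<^sup>2 \<le> t\<^sup>2" "t\<^sup>2 \<le> b\<^sup>2" using that ab by (auto intro: power_mono)
    then show ?thesis using deriv m unfolding q_def by auto
  qed
  have q0: "q t \<noteq> 0" if "t \<in> {a..b}" for t using q_abs[OF that] m by auto
  define F where "F t = sin (airy_phase x t) / q t" for t
  define h where "h t = 2 * t / (q t)\<^sup>2" for t
  have dq: "(q has_real_derivative 2 * t) (at t within S)" for t S
    unfolding q_def by (auto intro!: derivative_eq_intros)
  have dF: "(F has_real_derivative cos (airy_phase x t) - sin (airy_phase x t) * h t) (at t within {a..b})"
    if "t \<in> {a..b}" for t
    unfolding F_def h_def using q0[OF that]
    by (auto intro!: derivative_eq_intros dq simp: field_simps power2_eq_square)
       (simp add: q_def power2_eq_square algebra_simps)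
  have dG: "((\<lambda>t. - 1 / q t) has_real_derivative h t) (at t within {a..b})" if "t \<in> {a..b}" for t
    unfolding h_def using q0[OF that]
    by (auto intro!: derivative_eq_intros dq simp: field_simps power2_eq_square)
  have iF: "((\<lambda>t. cos (airy_phase x t) - sin (airy_phase x t) * h t) has_integral F b - F a) {a..b}"
    using ab dF by (intro fundamental_theorem_of_calculus)
      (auto simp flip: has_real_derivative_iff_has_vector_derivative)
  have iG: "(h has_integral (- 1 / q b) - (- 1 / q a)) {a..b}"
    using ab dG by (intro fundamental_theorem_of_calculus)
      (auto simp flip: has_real_derivative_iff_has_vector_derivative)
  have cq: "continuous_on {a..b} q" unfolding q_def by (intro continuous_intros)
  have ch: "continuous_on {a..b} h" unfolding h_def using q0
    by (intro continuous_intros cq) auto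
  have csh: "(\<lambda>t. sin (airy_phase x t) * h t) integrable_on {a..b}"
    by (intro integrable_continuous_real continuous_intros ch)
  have h0: "0 \<le> h t" if "t \<in> {a..b}" for t using that ab unfolding h_def by auto
  have eq: "integral {a..b} (\<lambda>t. cos (airy_phase x t))
      = F b - F a + integral {a..b} (\<lambda>t. sin (airy_phase x t) * h t)"
    using has_integral_add[OF iF integrable_integral[OF csh]] by (auto intro: integral_unique)
  have "norm (integral {a..b} (\<lambda>t. sin (airy_phase x t) * h t)) \<le> integral {a..b} h"
  proof (rule integral_norm_bound_integral[OF csh])
    show "h integrable_on {a..b}" using iG by blast
    show "norm (sin (airy_phase x t) * h t) \<le> h t" if "t \<in> {a..b}" for t
      using h0[OF that] abs_sin_le_one[of "airy_phase x t"]
      by (simp add: abs_mult mult_left_le_one_le)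
  qed
  also have "integral {a..b} h = 1 / q a - 1 / q b" using iG by (simp add: integral_unique)
  also have "\<dots> \<le> 1 / m"
  proof (cases "m \<le> a\<^sup>2 + x")
    case True
    have "a\<^sup>2 \<le> b\<^sup>2" using ab by (intro power_mono) auto
    then have "0 < q b" "m \<le> q a" using True m by (auto simp: q_def)
    then have "1 / q a \<le> 1 / m" "0 \<le> 1 / q b" using m by (auto simp: frac_le)
    then show ?thesis by linarith
  next
    case False
    have "a\<^sup>2 \<le> b\<^sup>2" using ab by (intro power_mono) auto
    then have "q a \<le> -m" "q b \<le> - m" using False deriv by (auto simp: q_def)
    then have "1 / q a \<le> 0" "- (1 / q b) \<le> 1 / m" using m by (auto simp: divide_simps)
    then show ?thesis by linarith
  qed
  finally have 1: "\<bar>integral {a..b} (\<lambda>t. sin (airy_phase x t) * h t)\<bar> \<le> 1 / m" by simp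
  have 2: "\<bar>F t\<bar> \<le> 1 / m" if "t \<in> {a..b}" for t
    unfolding F_def abs_divide using q_abs[OF that] m by (intro frac_le) auto
  have "\<bar>integral {a..b} (\<lambda>t. cos (airy_phase x t))\<bar> \<le> 1/m + 1/m + 1/m"
    unfolding eq using 1 2[of a] 2[of b] ab by auto
  then show ?thesis by simp
qed

lemma airy_partial_split:
  assumes "0 \<le> a" "a \<le> b"
  shows "airy_partial b x = airy_partial a x + integral {a..b} (\<lambda>t. cos (airy_phase x t))"
  unfolding airy_partial_def
  by (rule Henstock_Kurzweil_Integration.integral_combine[symmetric])
     (use assms in \<open>auto intro!: integrable_continuous_real continuous_intros\<close>)

lemma airy_phase_trivial_bound:
  assumes "a \<le> b"
  shows "\<bar>integral {a..b} (\<lambda>t. cos (airy_phase x t))\<bar> \<le> b - a"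
proof -
  have "norm (integral {a..b} (\<lambda>t. cos (airy_phase x t))) \<le> 1 * (b - a)"
    by (rule integral_bound) (use assms in \<open>auto intro!: continuous_intros\<close>)
  then show ?thesis by simp
qed

lemma airy_partial_tail:
  assumes "0 \<le> a" "a \<le> b" "0 < a\<^sup>2 + x"
  shows "\<bar>airy_partial b x - airy_partial a x\<bar> \<le> 3 / (a\<^sup>2 + x)"
  using airy_partial_split[OF assms(1,2), of x] oscillatory_bound[of a b "a\<^sup>2 + x" x] assms by simp

text \<open>The phase is stationary at \<open>c = \<surd>(- x)\<close> when \<open>x < 0\<close>. On the interval of length 2 around \<open>c\<close>
  the integrand is bounded by 1, and at distance at least 1 from \<open>c\<close> on the positive axis the phase
  derivative has modulus at least 1. With \<open>c = 0\<close> for \<open>x \<ge> 0\<close> the same splitting applies. The total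
  is at most \<open>3 + 2 + 3\<close>, whence a bound that is uniform in \<open>x\<close>.\<close>

lemma airy_partial_bounded:
  assumes R: "0 \<le> R"
  shows "\<bar>airy_partial R x\<bar> \<le> 8"
proof -
  define c where "c = sqrt (max 0 (- x))"
  have c0: "0 \<le> c" and c2: "c\<^sup>2 = max 0 (- x)" by (auto simp: c_def)
  have left: "\<bar>airy_partial r x\<bar> \<le> 3" if r: "0 \<le> r" "r \<le> c - 1" for r
  proof -
    have "r\<^sup>2 \<le> (c - 1)\<^sup>2" using r by (intro power_mono) auto
    moreover have "(c - 1)\<^sup>2 = c\<^sup>2 - 2 * c + 1" by (simp add: power2_eq_square algebra_simps)
    moreover have "c\<^sup>2 = - x" using c2 r c0 by (auto simp: max_def split: if_splits)
    ultimately have "r\<^sup>2 + x \<le> - 1" using r by linarith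
    then show ?thesis using oscillatory_bound[of 0 r 1 x] r unfolding airy_partial_def by simp
  qed
  have mid: "\<bar>airy_partial r x\<bar> \<le> 5" if r: "0 \<le> r" "r \<le> c + 1" for r
  proof (cases "r \<le> c - 1")
    case True then show ?thesis using left r by force
  next
    case False
    define s where "s = max 0 (c - 1)"
    have s: "0 \<le> s" "s \<le> r" "r - s \<le> 2" using False r c0 by (auto simp: s_def)
    have "\<bar>airy_partial s x\<bar> \<le> 3"
    proof (cases "c \<le> 1")
      case True then show ?thesis by (simp add: s_def airy_partial_def)
    next
      case False then show ?thesis using left[of "c - 1"] by (simp add: s_def)
    qed
    then show ?thesis
      using airy_partial_split[OF s(1,2), of x] airy_phase_trivial_bound[OF s(2), of x] s(3) by linarith
  qed
  show ?thesis
  proof (cases "R \<le> c + 1")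
    case True then show ?thesis using mid[OF R] by simp
  next
    case False
    have "(c + 1)\<^sup>2 = c\<^sup>2 + 2 * c + 1" by (simp add: power2_eq_square algebra_simps)
    moreover have "0 \<le> c\<^sup>2 + x" using c2 by auto
    ultimately have q: "1 \<le> (c + 1)\<^sup>2 + x" using c0 by linarith
    have "\<bar>airy_partial R x - airy_partial (c + 1) x\<bar> \<le> 3 / ((c + 1)\<^sup>2 + x)"
      using False c0 q by (intro airy_partial_tail) auto
    also have "\<dots> \<le> 3" using q by (simp add: divide_simps)
    finally show ?thesis using mid[of "c + 1"] c0 by force
  qed
qed

text \<open>The tail estimate makes the partial integrals Cauchy, so the limit in the definition of \<open>Airy_Ai\<close>
  exists and estimates for the partial integrals pass to \<open>Airy_Ai\<close>.\<close>

lemma airy_partial_tendsto: "((\<lambda>R. airy_partial R x) \<longlongrightarrow> pi * Airy_Ai x) at_top"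
proof -
  have tail0: "((\<lambda>a. 3 / (a\<^sup>2 + x)) \<longlongrightarrow> 0) at_top"
    by real_asymp
  have tailn: "(\<lambda>n. 3 / ((real n)\<^sup>2 + x)) \<longlonglongrightarrow> 0"
    by real_asymp
  have posn: "\<forall>\<^sub>F a in at_top. 0 < a\<^sup>2 + x"
    by real_asymp
  have "Cauchy (\<lambda>n. airy_partial (real n) x)"
  proof (rule CauchyI')
    fix e :: real assume e: "0 < e"
    have "\<forall>\<^sub>F n in sequentially. 3 / ((real n)\<^sup>2 + x) < e"
      using order_tendstoD(2)[OF tailn e] .
    moreover have "\<forall>\<^sub>F n in sequentially. 0 < (real n)\<^sup>2 + x"
      by real_asymp
    ultimately have "\<forall>\<^sub>F n in sequentially. 3 / ((real n)\<^sup>2 + x) < e \<and> 0 < (real n)\<^sup>2 + x"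
      by (rule eventually_conj)
    then obtain N where N: "\<And>n. n \<ge> N \<Longrightarrow> 3 / ((real n)\<^sup>2 + x) < e \<and> 0 < (real n)\<^sup>2 + x"
      by (auto simp: eventually_sequentially)
    show "\<exists>M. \<forall>m\<ge>M. \<forall>n>m. dist (airy_partial (real m) x) (airy_partial (real n) x) < e"
    proof (intro exI[of _ N] allI impI)
      fix m n assume "N \<le> m" "m < n"
      then show "dist (airy_partial (real m) x) (airy_partial (real n) x) < e"
        using airy_partial_tail[of "real m" "real n" x] N[of m] by (auto simp: dist_real_def)
    qed
  qed
  then obtain l where l: "(\<lambda>n. airy_partial (real n) x) \<longlonglongrightarrow> l"
    using Cauchy_convergent_iff convergent_def by blast
  have bound: "\<bar>airy_partial a x - l\<bar> \<le> 3 / (a\<^sup>2 + x)" if a: "0 \<le> a" "0 < a\<^sup>2 + x" for a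
  proof (rule tendsto_upperbound)
    show "(\<lambda>n. \<bar>airy_partial a x - airy_partial (real n) x\<bar>) \<longlonglongrightarrow> \<bar>airy_partial a x - l\<bar>"
      by (intro tendsto_intros l)
    show "\<forall>\<^sub>F n in sequentially. \<bar>airy_partial a x - airy_partial (real n) x\<bar> \<le> 3 / (a\<^sup>2 + x)"
      using eventually_ge_at_top[of "nat \<lceil>a\<rceil>"]
    proof eventually_elim
      case (elim n)
      then have "a \<le> real n" by linarith
      then show ?case using airy_partial_tail[OF a(1) _ a(2), of "real n"] by (simp add: abs_minus_commute)
    qed
  qed simp
  have lim: "((\<lambda>R. airy_partial R x) \<longlongrightarrow> l) at_top"
  proof (rule LIM_zero_cancel, rule Lim_null_comparison[OF _ tail0])
    show "\<forall>\<^sub>F a in at_top. norm (airy_partial a x - l) \<le> 3 / (a\<^sup>2 + x)"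
      using posn eventually_ge_at_top[of 0] by eventually_elim (use bound in auto)
  qed
  then have "Lim at_top (\<lambda>R. airy_partial R x) = l"
    by (intro tendsto_Lim) auto
  then have "pi * Airy_Ai x = l"
    by (simp add: Airy_Ai_def airy_partial_def airy_phase_def)
  then show ?thesis using lim by simp
qed

lemma abs_Airy_Ai_le: "\<bar>Airy_Ai x\<bar> \<le> 3"
proof -
  have "\<bar>pi * Airy_Ai x\<bar> \<le> 8"
  proof (rule tendsto_upperbound[OF tendsto_rabs[OF airy_partial_tendsto]])
    show "\<forall>\<^sub>F R in at_top. \<bar>airy_partial R x\<bar> \<le> 8"
      using eventually_ge_at_top[of 0] by eventually_elim (rule airy_partial_bounded)
  qed simp
  moreover have "3 * \<bar>Airy_Ai x\<bar> \<le> pi * \<bar>Airy_Ai x\<bar>"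
    using pi_gt3 by (intro mult_right_mono) auto
  ultimately show ?thesis by (simp add: abs_mult)
qed

text \<open>For \<open>x > 0\<close> the phase derivative is at least \<open>x\<close> on the whole half-line, so a single
  application of \<open>oscillatory_bound\<close> suffices.\<close>

lemma abs_Airy_Ai_le_inverse: "\<bar>Airy_Ai x\<bar> \<le> 1 / x" if x: "0 < x"
proof -
  have "\<bar>pi * Airy_Ai x\<bar> \<le> 3 / x"
  proof (rule tendsto_upperbound[OF tendsto_rabs[OF airy_partial_tendsto]])
    show "\<forall>\<^sub>F R in at_top. \<bar>airy_partial R x\<bar> \<le> 3 / x"
      using eventually_ge_at_top[of 0]
      by eventually_elim (use x oscillatory_bound[of 0 _ x x] in \<open>simp add: airy_partial_def\<close>)
  qed simp
  moreover have "3 * \<bar>Airy_Ai x\<bar> \<le> pi * \<bar>Airy_Ai x\<bar>"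
    using pi_gt3 by (intro mult_right_mono) auto
  ultimately have "3 * \<bar>Airy_Ai x\<bar> \<le> 3 * (1 / x)" by (simp add: abs_mult)
  then show ?thesis by linarith
qed

text \<open>Domination by a function with an explicit primitive. The bound also holds when \<open>f\<close> is not
  integrable, for then its integral is \<open>0\<close> by convention.\<close>

lemma abs_set_integral_le_atLeast:
  fixes f g G :: "real \<Rightarrow> real"
  assumes le: "\<And>l. 0 \<le> l \<Longrightarrow> \<bar>f l\<bar> \<le> g l"
    and g: "g \<in> borel_measurable borel"
    and deriv: "\<And>l. 0 \<le> l \<Longrightarrow> (G has_real_derivative g l) (at l)"
    and lim: "(G \<longlongrightarrow> 0) at_top"
  shows "\<bar>LBINT l:{0..}. f l\<bar> \<le> - G 0"
proof -
  have g0: "0 \<le> g l" if "0 \<le> l" for l using le[OF that] by linarith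
  have nn: "(\<integral>\<^sup>+l. ennreal (g l) * indicator {0..} l \<partial>lborel) = ennreal (0 - G 0)"
    by (rule nn_integral_FTC_atLeast[OF g deriv g0 lim]) auto
  have g_eq: "ennreal (g l * indicator {0..} l) = ennreal (g l) * indicator {0..} l" for l
    by (auto simp: indicator_def)
  have gi: "integrable lborel (\<lambda>l. g l * indicator {0..} l)"
  proof (rule integrableI_nonneg)
    show "(\<lambda>l. g l * indicator {0..} l) \<in> borel_measurable lborel"
      using g by measurable
    show "AE l in lborel. 0 \<le> g l * indicator {0..} l"
      using g0 by (auto simp: indicator_def)
    show "(\<integral>\<^sup>+l. ennreal (g l * indicator {0..} l) \<partial>lborel) < \<infinity>"
      by (simp only: g_eq nn) simp
  qed
  have G0: "G 0 \<le> 0"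
  proof (rule tendsto_lowerbound[OF lim])
    show "\<forall>\<^sub>F x in at_top. G 0 \<le> G x"
      using eventually_ge_at_top[of 0]
    proof eventually_elim
      case (elim x)
      show ?case
      proof (rule DERIV_nonneg_imp_nondecreasing[OF elim])
        fix z :: real assume "0 \<le> z"
        then show "\<exists>D. (G has_real_derivative D) (at z) \<and> 0 \<le> D"
          using deriv g0 by (intro exI[of _ "g z"]) simp
      qed
    qed
  qed simp
  have "\<bar>LBINT l:{0..}. f l\<bar> \<le> (\<integral>l. \<bar>indicator {0..} l *\<^sub>R f l\<bar> \<partial>lborel)"
    unfolding set_lebesgue_integral_def using integral_norm_bound[of lborel "\<lambda>l. indicator {0..} l *\<^sub>R f l"]
    by simp
  also have "\<dots> \<le> (\<integral>l. g l * indicator {0..} l \<partial>lborel)"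
    by (rule integral_mono'[OF gi]) (use le g0 in \<open>auto simp: indicator_def\<close>)
  also have "\<dots> = enn2real (\<integral>\<^sup>+l. ennreal (g l) * indicator {0..} l \<partial>lborel)"
    unfolding g_eq[symmetric]
    by (rule integral_eq_nn_integral) (use g g0 in \<open>auto simp: indicator_def\<close>)
  also have "\<dots> = - G 0" using G0 by (simp add: nn)
  finally show ?thesis .
qed

text \<open>For \<open>z \<ge> - m\<close> the two bounds on the Airy function combine into
  \<open>\<bar>Ai (z + l)\<bar> \<le> 3 (m + 2) / (1 + l)\<close>, whose square has integral \<open>9 (m + 2)\<^sup>2\<close> over the half-line.\<close>

lemma ext_Airy_kernel_same_time_bound:
  assumes m: "0 \<le> m" and x: "- m \<le> x" and y: "- m \<le> y"
  shows "\<bar>ext_Airy_kernel (t, x) (t, y)\<bar> \<le> 9 * (m + 2)\<^sup>2"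
proof -
  let ?C = "3 * (m + 2)"
  have Ai: "\<bar>Airy_Ai (z + l)\<bar> \<le> ?C / (1 + l)" if z: "- m \<le> z" and l: "0 \<le> l" for z l
  proof (cases "l \<le> m + 1")
    case True
    then have "3 * (1 + l) \<le> ?C" using l by simp
    then have "3 \<le> ?C / (1 + l)" using l by (simp add: pos_le_divide_eq)
    then show ?thesis using abs_Airy_Ai_le[of "z + l"] by linarith
  next
    case False
    then have p: "1 < l - m" "l - m \<le> z + l" using z by auto
    have "\<bar>Airy_Ai (z + l)\<bar> \<le> 1 / (z + l)" using p by (intro abs_Airy_Ai_le_inverse) auto
    also have "\<dots> \<le> 1 / (l - m)" using p by (intro frac_le) auto
    also have "\<dots> \<le> ?C / (1 + l)"
    proof -
      have "(m + 2) * 1 \<le> (m + 2) * (l - m)" "0 \<le> m * (l - m - 1)" using p m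
          by (auto intro!: mult_nonneg_nonneg)
      then have "1 + l \<le> ?C * (l - m)" using p m by (simp add: algebra_simps)
      then show ?thesis using p l by (simp add: divide_simps mult.commute)
    qed
    finally show ?thesis .
  qed
  have "\<bar>LBINT l:{0..}. exp (- l * (t - t)) * Airy_Ai (x + l) * Airy_Ai (y + l)\<bar> \<le> - (- (?C\<^sup>2 / (1 + 0)))"
  proof (rule abs_set_integral_le_atLeast[where g = "\<lambda>l. ?C\<^sup>2 / (1 + l)\<^sup>2" and G = "\<lambda>l. - (?C\<^sup>2 / (1 + l))"])
    show "((\<lambda>l. - (?C\<^sup>2 / (1 + l))) \<longlongrightarrow> 0) at_top"
      by real_asymp
  next
    fix l :: real assume l: "0 \<le> l"
    have "\<bar>Airy_Ai (x + l)\<bar> * \<bar>Airy_Ai (y + l)\<bar> \<le> (?C / (1 + l)) * (?C / (1 + l))"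
      using Ai[OF x l] Ai[OF y l] m l by (intro mult_mono) auto
    then show "\<bar>exp (- l * (t - t)) * Airy_Ai (x + l) * Airy_Ai (y + l)\<bar> \<le> ?C\<^sup>2 / (1 + l)\<^sup>2"
      by (simp add: abs_mult power2_eq_square)
    show "((\<lambda>l. - (?C\<^sup>2 / (1 + l))) has_real_derivative ?C\<^sup>2 / (1 + l)\<^sup>2) (at l)"
      using l by (auto intro!: derivative_eq_intros simp: power2_eq_square)
  qed simp
  then have "\<bar>ext_Airy_kernel (t, x) (t, y)\<bar> \<le> ?C\<^sup>2" by (simp add: ext_Airy_kernel_def)
  then show ?thesis by (simp only: power_mult_distrib) simp
qed

text \<open>At different times the exponential factor decays on the half-line of integration at the rate
  \<open>\<bar>s - t\<bar>\<close>, and \<open>\<bar>Ai\<bar> \<le> 3\<close>. This decay in the time difference is the source of mixing.\<close>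

lemma ext_Airy_kernel_different_times_bound:
  assumes "s \<noteq> t"
  shows "\<bar>ext_Airy_kernel (s, x) (t, y)\<bar> \<le> 9 / \<bar>s - t\<bar>"
proof -
  have bound: "\<bar>LBINT l:{0..}. f l\<bar> \<le> 9 / d"
    if d: "0 < d" and f: "\<And>l. f l = exp (- l * d) * Airy_Ai (u l) * Airy_Ai (v l)"
    for d f u v
  proof -
    have "\<bar>LBINT l:{0..}. f l\<bar> \<le> - (- (9 / d * exp (- 0 * d)))"
    proof (rule abs_set_integral_le_atLeast[where g = "\<lambda>l. 9 * exp (- l * d)" and G = "\<lambda>l.
        - (9 / d * exp (- l * d))"])
      show "((\<lambda>l. - (9 / d * exp (- l * d))) \<longlongrightarrow> 0) at_top"
        using d by real_asymp
    next
      fix l :: real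
      have "\<bar>Airy_Ai (u l)\<bar> * \<bar>Airy_Ai (v l)\<bar> \<le> 3 * 3"
        by (intro mult_mono abs_Airy_Ai_le) auto
      then show "\<bar>f l\<bar> \<le> 9 * exp (- l * d)"
        by (simp add: f abs_mult mult.commute mult.left_commute)
      show "((\<lambda>l. - (9 / d * exp (- l * d))) has_real_derivative 9 * exp (- l * d)) (at l)"
        using d by (auto intro!: derivative_eq_intros)
    qed simp
    then show ?thesis by simp
  qed
  show ?thesis
  proof (cases "s > t")
    case True
    have "\<bar>LBINT l:{0..}. exp (- l * (s - t)) * Airy_Ai (x + l) * Airy_Ai (y + l)\<bar> \<le> 9 / (s - t)"
      by (rule bound[where u = "\<lambda>l. x + l" and v = "\<lambda>l. y + l"]) (use True in auto)
    then show ?thesis using True by (simp add: ext_Airy_kernel_def)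
  next
    case False
    have refl: "{l::real. - l \<in> {..0}} = {0..}" by auto
    have "(LBINT l:{..0}. exp (- l * (s - t)) * Airy_Ai (x + l) * Airy_Ai (y + l))
        = (LBINT l:{0..}. exp (- (- l) * (s - t)) * Airy_Ai (x + - l) * Airy_Ai (y + - l))"
      by (subst set_integral_reflect) (simp only: refl)
    moreover have "\<bar>LBINT l:{0..}. exp (- (- l) * (s - t)) * Airy_Ai (x + - l) * Airy_Ai (y + - l)\<bar>
        \<le> 9 / (t - s)"
    proof (rule bound[where u = "\<lambda>l. x + - l" and v = "\<lambda>l. y + - l"])
      show "exp (- (- l) * (s - t)) * Airy_Ai (x + - l) * Airy_Ai (y + - l)
        = exp (- l * (t - s)) * Airy_Ai (x + - l) * Airy_Ai (y + - l)" for l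
        by (simp add: algebra_simps)
    qed (use False assms in auto)
    ultimately show ?thesis
      using False assms by (simp add: ext_Airy_kernel_def)
  qed
qed

lemma ext_Airy_kernel_shift: "ext_Airy_kernel (s + T, x) (t + T, y) = ext_Airy_kernel (s, x) (t, y)"
  by (simp add: ext_Airy_kernel_def)

section \<open>Determinants with bounded entries\<close>

text \<open>One step of block Gaussian elimination: the matrix is the product of a block upper triangular
  matrix, with the Schur complement in its corner, and a unipotent lower triangular one.\<close>

lemma det_schur_complement:
  fixes g :: "nat \<Rightarrow> nat \<Rightarrow> real"
  assumes a: "g n n \<noteq> 0"
  shows "Determinant.det (Matrix.mat (Suc n) (Suc n) (\<lambda>(i, j). g i j))
    = g n n * Determinant.det (Matrix.mat n n (\<lambda>(i, j). g i j - g i n * g n j / g n n))"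
proof -
  let ?H = "Matrix.mat n n (\<lambda>(i, j). g i j - g i n * g n j / g n n)"
  let ?A = "four_block_mat ?H (Matrix.mat n 1 (\<lambda>(i, j). g i n)) (0\<^sub>m 1 n) (Matrix.mat 1 1 (\<lambda>_. g n n))"
  let ?B = "four_block_mat (1\<^sub>m n) (0\<^sub>m n 1) (Matrix.mat 1 n (\<lambda>(i, j). g n j / g n n)) (1\<^sub>m 1)"
  have "Matrix.mat (Suc n) (Suc n) (\<lambda>(i, j). g i j) = ?A * ?B"
    by (subst mult_four_block_mat[where ?nr1.0 = n and ?n1.0 = n and ?nr2.0 = 1 and ?n2.0 = 1 and ?nc1.0
        = n and ?nc2.0 = 1])
       (auto simp: scalar_prod_def less_Suc_eq a intro!: eq_matI)
  moreover have "Determinant.det (?A * ?B) = Determinant.det ?A * Determinant.det ?B"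
    by (rule det_mult[where n = "n + 1"]) (auto intro!: four_block_carrier_mat)
  moreover have "Determinant.det ?A = Determinant.det ?H * g n n"
    by (subst det_four_block_mat_lower_left_zero) (auto simp: det_single)
  moreover have "Determinant.det ?B = 1"
    by (subst det_four_block_mat_upper_right_zero) auto
  ultimately show ?thesis by simp
qed

lemma quadratic_form_unit_vector:
  fixes g :: "nat \<Rightarrow> nat \<Rightarrow> real"
  assumes i: "i < n"
  shows "(\<Sum>k<n. \<Sum>j<n. (if k = i then 1 else 0) * (if j = i then 1 else 0) * g k j) = g i i"
proof -
  have "(\<Sum>j<n. (if k = i then 1 else 0) * (if j = i then 1 else 0) * g k j) =
      (if k = i then g i i else 0)" for k
  proof -
    have "(\<Sum>j<n. (if k = i then 1 else 0) * (if j = i then 1 else 0) * g k j)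
      = (\<Sum>j<n. if j = i then (if k = i then g i i else 0) else 0)"
      by (intro sum.cong refl) auto
    then show ?thesis using i by (simp add: sum.delta)
  qed
  then show ?thesis using i by (simp add: sum.delta)
qed

text \<open>Hadamard's inequality for positive semidefinite matrices, by induction on the size: when the last
    diagonal entry is
  positive, passing to the Schur complement keeps the form positive semidefinite and can only decrease
  the other diagonal entries.\<close>

lemma hadamard_psd:
  fixes g :: "nat \<Rightarrow> nat \<Rightarrow> real"
  assumes sym: "\<And>i j. g i j = g j i"
    and psd: "\<And>c :: nat \<Rightarrow> real. 0 \<le> (\<Sum>i<n. \<Sum>j<n. c i * c j * g i j)"
  shows "0 \<le> Determinant.det (Matrix.mat n n (\<lambda>(i, j). g i j)) \<and>
    Determinant.det (Matrix.mat n n (\<lambda>(i, j). g i j)) \<le> (\<Prod>i<n. g i i)"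
  using assms
proof (induction n arbitrary: g)
  case 0
  then show ?case by (simp add: det_dim_zero)
next
  case (Suc n)
  note sym = Suc.prems(1) and psd = Suc.prems(2)
  let ?d = "Determinant.det (Matrix.mat (Suc n) (Suc n) (\<lambda>(i, j). g i j))"
  have quad: "(\<Sum>i<Suc n. \<Sum>j<Suc n. c i * c j * g i j)
      = (\<Sum>i<n. \<Sum>j<n. c i * c j * g i j) + 2 * c n * (\<Sum>i<n. c i * g i n) + (c n)\<^sup>2 * g n n" for c
  proof -
    have "(\<Sum>j<n. c n * c j * g n j) = c n * (\<Sum>i<n. c i * g i n)"
      unfolding sum_distrib_left by (intro sum.cong refl, subst sym) simp
    moreover have "(\<Sum>i<n. c i * c n * g i n) = c n * (\<Sum>i<n. c i * g i n)"
      unfolding sum_distrib_left by (intro sum.cong refl) simp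
    ultimately show ?thesis by (simp add: sum.distrib power2_eq_square)
  qed
  have diag: "0 \<le> g i i" if "i < Suc n" for i
    using psd[of "\<lambda>k. if k = i then 1 else 0"]
    unfolding quadratic_form_unit_vector[OF that] .
  show ?case
  proof (cases "g n n = 0")
    case True
    have "g n i = 0" if i: "i < n" for i
    proof (rule ccontr)
      assume nz: "g n i \<noteq> 0"
      (* With g n n = 0 the form is linear in the last coordinate, and this vector gives it the value -1. *)
      define c where "c k = (if k = i then 1 else if k = n then - (g i i + 1) / (2 * g n i) else 0)" for k
      have "(\<Sum>k<n. c k * g k n) = (\<Sum>k<n. if k = i then g n i else 0)"
        using sym[of i n] by (intro sum.cong) (auto simp: c_def)
      also have "\<dots> = g n i" using i by (simp add: sum.delta)
      finally have s1: "(\<Sum>k<n. c k * g k n) = g n i" .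
      have "(\<Sum>k<n. \<Sum>j<n. c k * c j * g k j) = (\<Sum>k<n. if k = i then g i i else 0)"
      proof (intro sum.cong refl)
        fix k assume k: "k \<in> {..<n}"
        have "(\<Sum>j<n. c k * c j * g k j) = (\<Sum>j<n. if j = i then c k * g k i else 0)"
          using k by (intro sum.cong) (auto simp: c_def)
        then show "(\<Sum>j<n. c k * c j * g k j) = (if k = i then g i i else 0)"
          using i k by (auto simp: sum.delta c_def)
      qed
      also have "\<dots> = g i i" using i by (simp add: sum.delta)
      finally have s2: "(\<Sum>k<n. \<Sum>j<n. c k * c j * g k j) = g i i" .
      have "0 \<le> g i i + 2 * c n * g n i"
        using psd[of c] unfolding quad s1 s2 True by simp
      also have "2 * c n * g n i = - (g i i + 1)" using i nz by (simp add: c_def)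
      finally show False by simp
    qed
    then have row: "g n i = 0" if "i < Suc n" for i using that True by (cases "i = n") auto
    have "?d = 0"
    proof (subst det_def'[of _ "Suc n"])
      show "(\<Sum>p | p permutes {0..<Suc n}. signof p
          * (\<Prod>i = 0..<Suc n. Matrix.mat (Suc n) (Suc n) (\<lambda>(i, j). g i j) $$ (i, p i))) = 0"
      proof (intro sum.neutral ballI)
        fix p assume "p \<in> {p. p permutes {0..<Suc n}}"
        then have "p n < Suc n" using permutes_in_image[of p "{0..<Suc n}" n] by auto
        then have "(\<Prod>i = 0..<Suc n. Matrix.mat (Suc n) (Suc n) (\<lambda>(i, j). g i j) $$ (i, p i)) = 0"
          by (intro prod_zero bexI[of _ n]) (auto simp: row)
        then show "signof p * (\<Prod>i = 0..<Suc n. Matrix.mat (Suc n) (Suc n) (\<lambda>(i, j). g i j) $$ (i, p i)) = 0"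
          by simp
      qed
    qed auto
    then show ?thesis using True by simp
  next
    case False
    then have a: "0 < g n n" using diag[of n] by simp
    define h where "h i j = g i j - g i n * g n j / g n n" for i j
    have hsym: "h i j = h j i" for i j
      using sym[of i j] sym[of i n] sym[of n j] by (simp add: h_def)
    have hpsd: "0 \<le> (\<Sum>i<n. \<Sum>j<n. c i * c j * h i j)" for c :: "nat \<Rightarrow> real"
    proof -
      (* Minimizing the form over the last coordinate leaves the form of the Schur complement. *)
      define s where "s = (\<Sum>i<n. c i * g i n)"
      define c' where "c' = c(n := - s / g n n)"
      have e1: "(\<Sum>i<n. \<Sum>j<n. c' i * c' j * g i j) = (\<Sum>i<n. \<Sum>j<n. c i * c j * g i j)"
        by (intro sum.cong) (auto simp: c'_def)
      have e2: "(\<Sum>i<n. c' i * g i n) = s"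
        unfolding s_def by (intro sum.cong) (auto simp: c'_def)
      have "0 \<le> (\<Sum>i<n. \<Sum>j<n. c i * c j * g i j) + 2 * c' n * s + (c' n)\<^sup>2 * g n n"
        using psd[of c'] unfolding quad e1 e2 .
      moreover have "2 * c' n * s + (c' n)\<^sup>2 * g n n = - (s * s / g n n)"
        using a by (simp add: c'_def power2_eq_square field_simps)
      moreover have "s * s = (\<Sum>i<n. \<Sum>j<n. c i * c j * (g i n * g n j))"
        unfolding s_def sum_product by (intro sum.cong refl, subst (2) sym) simp
      moreover have "(\<Sum>i<n. \<Sum>j<n. c i * c j * h i j) = (\<Sum>i<n. \<Sum>j<n. c i * c j * g i j)
          - (\<Sum>i<n. \<Sum>j<n. c i * c j * (g i n * g n j)) / g n n"
        by (simp add: h_def right_diff_distrib sum_subtractf sum_divide_distrib)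
      ultimately show ?thesis by simp
    qed
    have IH: "0 \<le> Determinant.det (Matrix.mat n n (\<lambda>(i, j). h i j))"
      "Determinant.det (Matrix.mat n n (\<lambda>(i, j). h i j)) \<le> (\<Prod>i<n. h i i)"
      using Suc.IH[of h, OF hsym hpsd] by auto
    have hdiag: "0 \<le> h i i" if i: "i < n" for i
      using hpsd[of "\<lambda>k. if k = i then 1 else 0"]
      unfolding quadratic_form_unit_vector[OF i] .
    have hle: "h i i \<le> g i i" for i
      using a sym[of n i] by (simp add: h_def)
    have "(\<Prod>i<n. h i i) \<le> (\<Prod>i<n. g i i)"
      using hdiag hle by (intro prod_mono) auto
    moreover have "?d = g n n * Determinant.det (Matrix.mat n n (\<lambda>(i, j). h i j))"
      unfolding h_def by (rule det_schur_complement[where g = g and n = n, OF False])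
    ultimately show ?thesis
      using IH a by (auto simp: mult.commute[of _ "g n n"] intro!: mult_left_mono)
  qed
qed

text \<open>The square of the determinant is the determinant of the Gram matrix of the rows, whose diagonal
  entries are at most \<open>n C\<^sup>2\<close>.\<close>

lemma hadamard_bound:
  fixes f :: "nat \<Rightarrow> nat \<Rightarrow> real"
  assumes C: "\<And>i j. i < n \<Longrightarrow> j < n \<Longrightarrow> \<bar>f i j\<bar> \<le> C"
  shows "\<bar>Determinant.det (Matrix.mat n n (\<lambda>(i, j). f i j))\<bar> \<le> sqrt ((real n * C\<^sup>2) ^ n)"
proof -
  let ?A = "Matrix.mat n n (\<lambda>(i, j). f i j)"
  define g where "g i j = (\<Sum>k<n. f i k * f j k)" for i j
  have gram: "?A * transpose_mat ?A = Matrix.mat n n (\<lambda>(i, j). g i j)"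
    by (rule eq_matI) (auto simp: g_def scalar_prod_def atLeast0LessThan)
  have sq: "(Determinant.det ?A)\<^sup>2 = Determinant.det (Matrix.mat n n (\<lambda>(i, j). g i j))"
    unfolding gram[symmetric]
    by (subst det_mult[where n = n]) (auto simp: det_transpose[of _ n] power2_eq_square)
  have "Determinant.det (Matrix.mat n n (\<lambda>(i, j). g i j)) \<le> (\<Prod>i<n. g i i)"
  proof (rule hadamard_psd[THEN conjunct2])
    show "g i j = g j i" for i j by (simp add: g_def mult.commute)
    fix c :: "nat \<Rightarrow> real"
    have "(\<Sum>i<n. \<Sum>j<n. c i * c j * g i j) = (\<Sum>k<n. (\<Sum>i<n. c i * f i k)\<^sup>2)"
    proof -
      have "(\<Sum>k<n. (\<Sum>i<n. c i * f i k)\<^sup>2) = (\<Sum>k<n. \<Sum>i<n. \<Sum>j<n. c i * f i k * (c j * f j k))"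
        by (simp add: power2_eq_square sum_product)
      also have "\<dots> = (\<Sum>i<n. \<Sum>k<n. \<Sum>j<n. c i * f i k * (c j * f j k))"
        by (rule sum.swap)
      also have "\<dots> = (\<Sum>i<n. \<Sum>j<n. \<Sum>k<n. c i * f i k * (c j * f j k))"
        by (intro sum.cong refl sum.swap)
      finally show ?thesis by (simp add: g_def sum_distrib_left mult.assoc mult.left_commute[of "f _ _"])
    qed
    then show "0 \<le> (\<Sum>i<n. \<Sum>j<n. c i * c j * g i j)" by (simp add: sum_nonneg)
  qed
  also have "(\<Prod>i<n. g i i) \<le> (\<Prod>i<n. real n * C\<^sup>2)"
  proof (rule prod_mono, safe)
    fix i assume i: "i < n"
    show "0 \<le> g i i" by (auto simp: g_def intro!: sum_nonneg)
    have "f i k * f i k \<le> C\<^sup>2" if "k < n" for k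
      using C[OF i that] abs_le_square_iff[of "f i k" C] by (simp add: power2_eq_square)
    then show "g i i \<le> real n * C\<^sup>2"
      using sum_bounded_above[of "{..<n}" "\<lambda>k. f i k * f i k" "C\<^sup>2"] by (simp add: g_def)
  qed
  finally have "(Determinant.det ?A)\<^sup>2 \<le> (real n * C\<^sup>2) ^ n" by (simp add: sq)
  then show ?thesis by (rule real_le_rsqrt[of "\<bar>_\<bar>", simplified])
qed

text \<open>Replacing the upper right block by zeros changes only those terms of the Leibniz expansion
  whose permutation sends some \<open>i < k\<close> to some \<open>j \<ge> k\<close>; each of these contains a factor at most \<open>\<delta>\<close>.
  The modified determinant is the product of the two diagonal blocks.\<close>

lemma det_block_factorization:
  fixes f :: "nat \<Rightarrow> nat \<Rightarrow> real"
  assumes C: "1 \<le> C" "\<And>i j. i < k + l \<Longrightarrow> j < k + l \<Longrightarrow> \<bar>f i j\<bar> \<le> C"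
    and \<delta>0: "0 \<le> \<delta>" and \<delta>: "\<And>i j. i < k \<Longrightarrow> k \<le> j \<Longrightarrow> j < k + l \<Longrightarrow> \<bar>f i j\<bar> \<le> \<delta>"
  shows "\<bar>Determinant.det (Matrix.mat (k + l) (k + l) (\<lambda>(i, j). f i j))
      - Determinant.det (Matrix.mat k k (\<lambda>(i, j). f i j))
        * Determinant.det (Matrix.mat l l (\<lambda>(i, j). f (i + k) (j + k)))\<bar>
    \<le> fact (k + l) * (C ^ (k + l) * \<delta>)"
proof -
  let ?n = "k + l"
  define f0 where "f0 i j = (if i < k \<and> k \<le> j then 0 else f i j)" for i j
  have "Matrix.mat ?n ?n (\<lambda>(i, j). f0 i j) = four_block_mat
     (Matrix.mat k k (\<lambda>(i, j). f i j)) (0\<^sub>m k l)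
     (Matrix.mat l k (\<lambda>(i, j). f (i + k) j)) (Matrix.mat l l (\<lambda>(i, j). f (i + k) (j + k)))"
    by (rule eq_matI) (auto simp: f0_def)
  then have block: "Determinant.det (Matrix.mat ?n ?n (\<lambda>(i, j). f0 i j))
     = Determinant.det (Matrix.mat k k (\<lambda>(i, j). f i j))
        * Determinant.det (Matrix.mat l l (\<lambda>(i, j). f (i + k) (j + k)))"
    by (simp only:) (rule det_four_block_mat_upper_right_zero, auto)
  let ?P = "{p. p permutes {0..<?n}}"
  have leibniz: "Determinant.det (Matrix.mat ?n ?n (\<lambda>(i, j). h i j))
      = (\<Sum>p\<in>?P. signof p * (\<Prod>i = 0..<?n. h i (p i)))" for h :: "nat \<Rightarrow> nat \<Rightarrow> real"
  proof (subst det_def'[of _ ?n])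
    show "(\<Sum>p\<in>?P. signof p * (\<Prod>i = 0..<?n. Matrix.mat ?n ?n (\<lambda>(i, j). h i j) $$ (i, p i)))
      = (\<Sum>p\<in>?P. signof p * (\<Prod>i = 0..<?n. h i (p i)))"
    proof (intro sum.cong refl arg_cong2[where f = "(*)"] prod.cong)
      fix p i assume "p \<in> ?P" "i \<in> {0..<?n}"
      then have "p i \<in> {0..<?n}" "i \<in> {0..<?n}" by (auto simp: permutes_in_image)
      then show "Matrix.mat ?n ?n (\<lambda>(i, j). h i j) $$ (i, p i) = h i (p i)" by simp
    qed
  qed auto
  have term_bound: "\<bar>signof p * (\<Prod>i = 0..<?n. f i (p i)) - signof p * (\<Prod>i = 0..<?n. f0 i (p i))\<bar>
      \<le> C ^ ?n * \<delta>" if p: "p \<in> ?P" and kl: "?n \<noteq> 0 \<and> 0 \<le> \<delta>" for p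
  proof (cases "\<exists>i<k. k \<le> p i")
    case False
    then have "(\<Prod>i = 0..<?n. f i (p i)) = (\<Prod>i = 0..<?n. f0 i (p i))"
      by (intro prod.cong) (auto simp: f0_def)
    then show ?thesis using C kl by simp
  next
    case True
    then obtain i where i: "i < k" "k \<le> p i" by auto
    have pin: "p j < ?n" if "j < ?n" for j using that p permutes_in_image[of p "{0..<?n}" j] by auto
    have z: "(\<Prod>i = 0..<?n. f0 i (p i)) = 0"
      using i by (intro prod_zero bexI[of _ i]) (auto simp: f0_def)
    have "\<bar>signof p * (\<Prod>i = 0..<?n. f i (p i)) - signof p * (\<Prod>i = 0..<?n. f0 i (p i))\<bar>
      = \<bar>\<Prod>i = 0..<?n. f i (p i)\<bar>"
      unfolding z by (simp add: abs_mult sign_def)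
    also have "\<dots> = (\<Prod>i = 0..<?n. \<bar>f i (p i)\<bar>)" by (simp add: abs_prod)
    also have "\<dots> = \<bar>f i (p i)\<bar> * (\<Prod>i\<in>{0..<?n} - {i}. \<bar>f i (p i)\<bar>)"
      using i by (intro prod.remove) auto
    also have "\<dots> \<le> \<delta> * (\<Prod>i\<in>{0..<?n} - {i}. C)"
      using i pin C kl by (intro mult_mono prod_mono \<delta> prod_nonneg) auto
    also have "\<dots> = \<delta> * C ^ (?n - 1)" using i by simp
    also have "\<dots> \<le> \<delta> * C ^ ?n" using C kl by (intro mult_left_mono power_increasing) auto
    finally show ?thesis by (simp add: mult.commute)
  qed
  show ?thesis
  proof (cases "k = 0 \<or> l = 0")
    case True
    have "f0 i j = f i j" if "i < ?n" "j < ?n" for i j using True that by (auto simp: f0_def)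
    then have "Matrix.mat ?n ?n (\<lambda>(i, j). f0 i j) = Matrix.mat ?n ?n (\<lambda>(i, j). f i j)"
      by (intro eq_matI) auto
    then have "Determinant.det (Matrix.mat (k + l) (k + l) (\<lambda>(i, j). f i j))
      - Determinant.det (Matrix.mat k k (\<lambda>(i, j). f i j))
        * Determinant.det (Matrix.mat l l (\<lambda>(i, j). f (i + k) (j + k))) = 0"
      unfolding block[symmetric] by simp
    then show ?thesis using C(1) \<delta>0 by simp
  next
    case False
    then have kl: "?n \<noteq> 0 \<and> 0 \<le> \<delta>" using \<delta>[of 0 k] by force
    have "\<bar>Determinant.det (Matrix.mat ?n ?n (\<lambda>(i, j). f i j))
        - Determinant.det (Matrix.mat ?n ?n (\<lambda>(i, j). f0 i j))\<bar>
      \<le> (\<Sum>p\<in>?P. \<bar>signof p * (\<Prod>i = 0..<?n. f i (p i)) - signof p * (\<Prod>i = 0..<?n. f0 i (p i))\<bar>)"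
      unfolding leibniz sum_subtractf[symmetric] by (rule sum_abs)
    also have "\<dots> \<le> (\<Sum>p\<in>?P. C ^ ?n * \<delta>)"
      using term_bound kl by (intro sum_mono) auto
    also have "\<dots> = fact ?n * (C ^ ?n * \<delta>)"
      by (simp add: card_permutations)
    finally show ?thesis unfolding block .
  qed
qed

section \<open>Counting tuples of distinct points, and concatenation of tuples\<close>

lemma card_injective_PiE:
  assumes "finite T"
  shows "card {z \<in> {..<n} \<rightarrow>\<^sub>E T. inj_on z {..<n}} = fact n * (card T choose n)"
  using assms
proof (induction n arbitrary: T)
  case 0
  have "{z \<in> {..<0::nat} \<rightarrow>\<^sub>E T. inj_on z {..<0}} = {\<lambda>_. undefined}"
    by (auto simp: PiE_def)
  then show ?case by simp
next
  case (Suc n)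
  let ?E = "\<lambda>T. {z \<in> {..<n} \<rightarrow>\<^sub>E T. inj_on z {..<n}}"
  have n: "n \<notin> {..<n}" by simp
  have fin: "finite (?E T')" if "finite T'" for T' :: "'a set"
    using that by (intro finite_subset[OF _ finite_PiE[of "{..<n}" "\<lambda>_. T'"]]) auto
  have "{z \<in> {..<Suc n} \<rightarrow>\<^sub>E T. inj_on z {..<Suc n}}
    = (\<lambda>(y, g). g(n := y)) ` {(y, g). y \<in> T \<and> g \<in> {..<n} \<rightarrow>\<^sub>E (T - {y}) \<and> inj_on g {..<n}}"
    using extensional_funcset_extend_domain_inj_on_eq[OF n, of T] by (simp add: lessThan_Suc)
  also have "card \<dots> = card {(y, g). y \<in> T \<and> g \<in> {..<n} \<rightarrow>\<^sub>E (T - {y}) \<and> inj_on g {..<n}}"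
    by (rule card_image[OF extensional_funcset_extend_domain_inj_onI[OF n]])
  also have "{(y, g). y \<in> T \<and> g \<in> {..<n} \<rightarrow>\<^sub>E (T - {y}) \<and> inj_on g {..<n}} = Sigma T (\<lambda>y. ?E (T - {y}))"
    by auto
  also have "card \<dots> = (\<Sum>y\<in>T. card (?E (T - {y})))"
    using Suc.prems fin by (intro card_SigmaI) auto
  also have "\<dots> = (\<Sum>y\<in>T. fact n * ((card T - 1) choose n))"
    using Suc.prems by (intro sum.cong refl) (simp add: Suc.IH)
  also have "\<dots> = fact (Suc n) * (card T choose Suc n)"
  proof (cases "card T")
    case 0
    then show ?thesis by simp
  next
    case (Suc c)
    then show ?thesis using Suc_times_binomial_eq[of c n] by (simp add: algebra_simps)
  qed
  finally show ?case .
qed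

definition concat_tuple :: "nat \<Rightarrow> nat \<Rightarrow> (nat \<Rightarrow> 'p) \<times> (nat \<Rightarrow> 'p) \<Rightarrow> nat \<Rightarrow> 'p" where
  "concat_tuple k l = (\<lambda>(u, v). \<lambda>i\<in>{..<k + l}. if i < k then u i else v (i - k))"

text \<open>The set \<open>D1\<^sup>k \<times> D2\<^sup>l\<close>, as a set of tuples of length \<open>k + l\<close>.\<close>

definition block_box :: "nat \<Rightarrow> nat \<Rightarrow> 'p set \<Rightarrow> 'p set \<Rightarrow> (nat \<Rightarrow> 'p) set" where
  "block_box k l D1 D2 = PiE {..<k + l} (\<lambda>i. if i < k then D1 else D2)"

text \<open>Since \<open>D1\<close> and \<open>D2\<close> are disjoint, a tuple of distinct points in \<open>D1\<^sup>k \<times> D2\<^sup>l\<close> is a pair of tuples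
  of distinct points. Joint factorial moments of two counts are therefore factorial moments of the
  configuration over a product box.\<close>

lemma factorial_count_block_box:
  assumes fin: "finite (S \<inter> D1)" "finite (S \<inter> D2)" and disj: "D1 \<inter> D2 = {}"
  shows "factorial_count (k + l) S (block_box k l D1 D2)
    = of_nat (fact k * (card (S \<inter> D1) choose k) * (fact l * (card (S \<inter> D2) choose l)))"
proof -
  let ?E = "\<lambda>n T. {z \<in> {..<n} \<rightarrow>\<^sub>E T. inj_on z {..<n}}"
  let ?Z = "{z \<in> block_box k l D1 D2. z \<in> {..<k + l} \<rightarrow>\<^sub>E S \<and> inj_on z {..<k + l}}"
  have bij: "bij_betw (concat_tuple k l) (?E k (S \<inter> D1) \<times> ?E l (S \<inter> D2)) ?Z"
  proof (rule bij_betw_byWitness[where f' = "\<lambda>z. (restrict z {..<k}, \<lambda>j\<in>{..<l}. z (j + k))"])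
    show "\<forall>p\<in>?E k (S \<inter> D1) \<times> ?E l (S \<inter> D2).
       (restrict (concat_tuple k l p) {..<k}, \<lambda>j\<in>{..<l}. concat_tuple k l p (j + k)) = p"
      by (auto simp: concat_tuple_def fun_eq_iff restrict_def PiE_def extensional_def)
    show "\<forall>z\<in>?Z. concat_tuple k l (restrict z {..<k}, \<lambda>j\<in>{..<l}. z (j + k)) = z"
      by (auto simp: concat_tuple_def fun_eq_iff restrict_def PiE_def extensional_def)
    show "concat_tuple k l ` (?E k (S \<inter> D1) \<times> ?E l (S \<inter> D2)) \<subseteq> ?Z"
    proof (rule image_subsetI)
      fix p assume "p \<in> ?E k (S \<inter> D1) \<times> ?E l (S \<inter> D2)"
      then obtain u v where p: "p = (u, v)" and u: "u \<in> {..<k} \<rightarrow>\<^sub>E S \<inter> D1" "inj_on u {..<k}"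
        and v: "v \<in> {..<l} \<rightarrow>\<^sub>E S \<inter> D2" "inj_on v {..<l}"
        by auto
      have uD: "u i \<in> S \<inter> D1" if "i < k" for i using u that by auto
      have vD: "v i \<in> S \<inter> D2" if "i < l" for i using v that by auto
      have memb: "concat_tuple k l (u, v) \<in> block_box k l D1 D2" "concat_tuple k l (u, v) \<in> {..<k + l} \<rightarrow>\<^sub>E S"
        using uD vD by (auto simp: concat_tuple_def block_box_def)
      have vD': "v (i - k) \<in> S \<inter> D2" if "i < k + l" "\<not> i < k" for i using vD that by auto
      moreover have "inj_on (concat_tuple k l (u, v)) {..<k + l}"
      proof (rule inj_onI)
        fix i j assume ij: "i \<in> {..<k + l}" "j \<in> {..<k + l}"
          "concat_tuple k l (u, v) i = concat_tuple k l (u, v) j"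
        then have eq: "(if i < k then u i else v (i - k)) = (if j < k then u j else v (j - k))"
          by (simp add: concat_tuple_def)
        consider "i < k" "j < k" | "i < k" "\<not> j < k" | "\<not> i < k" "j < k" | "\<not> i < k" "\<not> j < k" by blast
        then show "i = j"
        proof cases
          case 1 then show ?thesis using eq u(2) by (auto simp: inj_on_def)
        next
          case 2 then show ?thesis using eq uD[of i] vD'[of j] ij disj by auto
        next
          case 3 then show ?thesis using eq uD[of j] vD'[of i] ij disj by auto
        next
          case 4
          then have "i - k = j - k" using eq ij v(2) by (auto simp: inj_on_def)
          then show ?thesis using 4 by auto
        qed
      qed
      ultimately show "concat_tuple k l p \<in> ?Z" using memb by (simp add: p)
    qed
    show "(\<lambda>z. (restrict z {..<k}, \<lambda>j\<in>{..<l}. z (j + k))) ` ?Z \<subseteq> ?E k (S \<inter> D1) \<times> ?E l (S \<inter> D2)"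
    proof (rule image_subsetI)
      fix z assume "z \<in> ?Z"
      then have z: "z \<in> block_box k l D1 D2" "z \<in> {..<k + l} \<rightarrow>\<^sub>E S" and inj: "inj_on z {..<k + l}"
        by auto
      have zS: "z i \<in> S" "z i \<in> (if i < k then D1 else D2)" if "i < k + l" for i
        using z that by (auto simp: block_box_def PiE_def Pi_def split: if_splits)
      have "restrict z {..<k} \<in> {..<k} \<rightarrow>\<^sub>E S \<inter> D1"
      proof (rule PiE_I)
        fix i assume "i \<in> {..<k}"
        then show "restrict z {..<k} i \<in> S \<inter> D1" using zS[of i] by auto
      qed auto
      moreover have "(\<lambda>j\<in>{..<l}. z (j + k)) \<in> {..<l} \<rightarrow>\<^sub>E S \<inter> D2"
      proof (rule PiE_I)
        fix j assume "j \<in> {..<l}"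
        then show "(\<lambda>j\<in>{..<l}. z (j + k)) j \<in> S \<inter> D2" using zS[of "j + k"] by auto
      qed auto
      moreover have "inj_on (restrict z {..<k}) {..<k}" using inj by (auto simp: inj_on_def)
      moreover have "inj_on (\<lambda>j\<in>{..<l}. z (j + k)) {..<l}"
      proof (rule inj_onI)
        fix i j assume "i \<in> {..<l}" "j \<in> {..<l}" "(\<lambda>j\<in>{..<l}. z (j + k)) i = (\<lambda>j\<in>{..<l}. z (j + k)) j"
        then have "z (i + k) = z (j + k)" "i + k \<in> {..<k + l}" "j + k \<in> {..<k + l}" by auto
        then have "i + k = j + k" using inj by (metis inj_onD)
        then show "i = j" by simp
      qed
      ultimately show "(restrict z {..<k}, \<lambda>j\<in>{..<l}. z (j + k)) \<in> ?E k (S \<inter> D1) \<times> ?E l (S \<inter> D2)"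
        by simp
    qed
  qed
  have finE: "finite (?E n T)" if "finite T" for n :: nat and T :: "'a set"
    using that by (intro finite_subset[OF _ finite_PiE[of "{..<n}" "\<lambda>_. T"]]) auto
  have "finite ?Z" using bij_betw_finite[OF bij] finE fin by auto
  then have "factorial_count (k + l) S (block_box k l D1 D2) = of_nat (card ?Z)"
    unfolding factorial_count_def by (subst emeasure_count_space) auto
  also have "card ?Z = card (?E k (S \<inter> D1)) * card (?E l (S \<inter> D2))"
    using bij_betw_same_card[OF bij] by (simp add: card_cartesian_product)
  finally show ?thesis using fin by (simp add: card_injective_PiE)
qed

text \<open>Used to deduce that counts are almost surely finite from the finiteness of the first moment.\<close>

lemma factorial_count_one_infinite:
  assumes "infinite (S \<inter> D)"
  shows "factorial_count 1 S (PiE {..<1} (\<lambda>_. D)) = \<infinity>"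
proof -
  let ?Z = "{z \<in> PiE {..<1} (\<lambda>_. D). z \<in> {..<1} \<rightarrow>\<^sub>E S \<and> inj_on z {..<1::nat}}"
  have "S \<inter> D \<subseteq> (\<lambda>z. z 0) ` ?Z"
  proof
    fix x assume x: "x \<in> S \<inter> D"
    have "(\<lambda>i\<in>{..<1}. x) \<in> ?Z" using x by (auto simp: inj_on_def)
    moreover have "x = (\<lambda>i\<in>{..<1}. x) (0::nat)" by simp
    ultimately show "x \<in> (\<lambda>z. z 0) ` ?Z" by (intro image_eqI[where x = "\<lambda>i\<in>{..<1}. x"])
  qed
  then have "infinite ?Z" using assms finite_surj by blast
  then show ?thesis unfolding factorial_count_def by simp
qed

lemma measurable_concat_tuple [measurable]:
  "concat_tuple k l \<in> measurable (PiM {..<k} (\<lambda>_. \<mu>) \<Otimes>\<^sub>M PiM {..<l} (\<lambda>_. \<mu>)) (PiM {..<k + l} (\<lambda>_. \<mu>))"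
  unfolding concat_tuple_def case_prod_unfold
proof (rule measurable_restrict)
  fix i assume i: "i \<in> {..<k + l}"
  show "(\<lambda>p. if i < k then fst p i else snd p (i - k)) \<in> PiM {..<k} (\<lambda>_. \<mu>) \<Otimes>\<^sub>M PiM {..<l} (\<lambda>_. \<mu>) \<rightarrow>\<^sub>M \<mu>"
  proof (cases "i < k")
    case True
    have "(\<lambda>p. fst p i) \<in> PiM {..<k} (\<lambda>_. \<mu>) \<Otimes>\<^sub>M PiM {..<l} (\<lambda>_. \<mu>) \<rightarrow>\<^sub>M \<mu>"
      using True by (intro measurable_compose[OF measurable_fst measurable_component_singleton]) auto
    then show ?thesis using True by simp
  next
    case False
    have "(\<lambda>p. snd p (i - k)) \<in> PiM {..<k} (\<lambda>_. \<mu>) \<Otimes>\<^sub>M PiM {..<l} (\<lambda>_. \<mu>) \<rightarrow>\<^sub>M \<mu>"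
      using False i by (intro measurable_compose[OF measurable_snd measurable_component_singleton]) auto
    then show ?thesis using False by simp
  qed
qed

lemma concat_tuple_in_PiE_iff:
  assumes "u \<in> extensional {..<k}" "v \<in> extensional {..<l}"
  shows "concat_tuple k l (u, v) \<in> PiE {..<k + l} A
    \<longleftrightarrow> u \<in> PiE {..<k} A \<and> v \<in> PiE {..<l} (\<lambda>j. A (j + k))"
proof -
  have "(\<forall>i<k + l. (if i < k then u i else v (i - k)) \<in> A i)
    \<longleftrightarrow> (\<forall>i<k. u i \<in> A i) \<and> (\<forall>j<l. v j \<in> A (j + k))"
  proof safe
    fix j assume "\<forall>i<k + l. (if i < k then u i else v (i - k)) \<in> A i" "j < l"
    then show "v j \<in> A (j + k)" by (auto dest: spec[of _ "j + k"])
  next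
    fix i assume "\<forall>i<k. u i \<in> A i" "\<forall>j<l. v j \<in> A (j + k)" "i < k + l"
    then show "(if i < k then u i else v (i - k)) \<in> A i"
      by (auto dest: spec[of _ "i - k"])
  qed (auto split: if_splits)
  moreover have "concat_tuple k l (u, v) \<in> PiE {..<k + l} A
    \<longleftrightarrow> (\<forall>i<k + l. (if i < k then u i else v (i - k)) \<in> A i)"
    by (auto simp: concat_tuple_def PiE_iff)
  moreover have "u \<in> PiE {..<k} A \<and> v \<in> PiE {..<l} (\<lambda>j. A (j + k))
    \<longleftrightarrow> (\<forall>i<k. u i \<in> A i) \<and> (\<forall>j<l. v j \<in> A (j + k))"
    using assms by (auto simp: PiE_iff)
  ultimately show ?thesis by simp
qed

text \<open>Concatenation preserves the product measures, which allows Fubini's theorem to be applied to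
  integrals over tuples of length \<open>k + l\<close>.\<close>

lemma distr_concat_tuple:
  assumes "sigma_finite_measure \<mu>"
  shows "distr (PiM {..<k} (\<lambda>_. \<mu>) \<Otimes>\<^sub>M PiM {..<l} (\<lambda>_. \<mu>)) (PiM {..<k + l} (\<lambda>_. \<mu>)) (concat_tuple k l)
    = PiM {..<k + l} (\<lambda>_. \<mu>)"
proof -
  interpret product_sigma_finite "\<lambda>_::nat. \<mu>" by (simp add: product_sigma_finite_def assms)
  interpret P2: sigma_finite_measure "PiM {..<l} (\<lambda>_::nat. \<mu>)" by (rule sigma_finite) simp
  show ?thesis
  proof (rule PiM_eqI)
    fix A assume A: "\<And>i. i \<in> {..<k + l} \<Longrightarrow> A i \<in> sets \<mu>"
    let ?PQ = "PiM {..<k} (\<lambda>_. \<mu>) \<Otimes>\<^sub>M PiM {..<l} (\<lambda>_. \<mu>)"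
    have pre: "concat_tuple k l -` PiE {..<k + l} A \<inter> space ?PQ
      = PiE {..<k} A \<times> PiE {..<l} (\<lambda>j. A (j + k))"
    proof -
      have sub: "PiE {..<k} A \<subseteq> space (PiM {..<k} (\<lambda>_. \<mu>))"
        "PiE {..<l} (\<lambda>j. A (j + k)) \<subseteq> space (PiM {..<l} (\<lambda>_. \<mu>))"
        unfolding space_PiM using A[THEN sets.sets_into_space]
        by (intro PiE_mono; simp add: add.commute)+
      have ext: "u \<in> extensional J" if "u \<in> space (PiM J (\<lambda>_. \<mu>))" for u J
        using that by (auto simp: space_PiM PiE_iff)
      show ?thesis
      proof (rule Set.set_eqI)
        fix p :: "(nat \<Rightarrow> 'a) \<times> (nat \<Rightarrow> 'a)"
        obtain u v where p: "p = (u, v)" by (cases p)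
        show "p \<in> concat_tuple k l -` PiE {..<k + l} A \<inter> space ?PQ
          \<longleftrightarrow> p \<in> PiE {..<k} A \<times> PiE {..<l} (\<lambda>j. A (j + k))"
        proof (cases "p \<in> space ?PQ")
          case True
          then have "u \<in> extensional {..<k}" "v \<in> extensional {..<l}"
            using ext by (auto simp: p space_pair_measure)
          then show ?thesis using True by (simp add: p concat_tuple_in_PiE_iff)
        next
          case False
          then show ?thesis using sub by (auto simp: p space_pair_measure)
        qed
      qed
    qed
    have "emeasure (distr ?PQ (PiM {..<k + l} (\<lambda>_. \<mu>)) (concat_tuple k l)) (PiE {..<k + l} A)
        = emeasure ?PQ (PiE {..<k} A \<times> PiE {..<l} (\<lambda>j. A (j + k)))"
      using A by (subst emeasure_distr) (auto simp: pre)
    also have "\<dots> = emeasure (PiM {..<k} (\<lambda>_. \<mu>)) (PiE {..<k} A)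
        * emeasure (PiM {..<l} (\<lambda>_. \<mu>)) (PiE {..<l} (\<lambda>j. A (j + k)))"
      using A by (intro P2.emeasure_pair_measure_Times sets_PiM_I_finite) auto
    also have "\<dots> = (\<Prod>i<k. emeasure \<mu> (A i)) * (\<Prod>j<l. emeasure \<mu> (A (j + k)))"
      using A by (intro arg_cong2[where f = "(*)"] emeasure_PiM) auto
    also have "\<dots> = (\<Prod>i<k + l. emeasure \<mu> (A i))"
      using prod.atLeastLessThan_concat[of 0 k "k + l" "\<lambda>i. emeasure \<mu> (A i)"]
        prod.shift_bounds_nat_ivl[of "\<lambda>i. emeasure \<mu> (A i)" 0 k l]
      by (simp add: lessThan_atLeast0 add.commute)
    finally show "emeasure (distr ?PQ (PiM {..<k + l} (\<lambda>_. \<mu>)) (concat_tuple k l)) (PiE {..<k + l} A)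
        = (\<Prod>i\<in>{..<k + l}. emeasure \<mu> (A i))" by simp
  qed auto
qed

section \<open>Integrals of correlation determinants over boxes\<close>

definition correlation_det :: "('p \<Rightarrow> 'p \<Rightarrow> real) \<Rightarrow> nat \<Rightarrow> (nat \<Rightarrow> 'p) \<Rightarrow> real" where
  "correlation_det K n z = Determinant.det (Matrix.mat n n (\<lambda>(i, j). K (z i) (z j)))"

definition moment_integral ::
  "'p measure \<Rightarrow> ('p \<Rightarrow> 'p \<Rightarrow> real) \<Rightarrow> nat \<Rightarrow> (nat \<Rightarrow> 'p) set \<Rightarrow> real" where
  "moment_integral \<mu> K n B = (LINT z|PiM {..<n} (\<lambda>_. \<mu>). indicator B z * correlation_det K n z)"

text \<open>Hadamard's bound for the \<open>n\<close>-th term of a Fredholm series, for a kernel bounded by \<open>C\<close> on a set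
  of measure \<open>m\<close>.\<close>

definition hadamard_term :: "real \<Rightarrow> real \<Rightarrow> nat \<Rightarrow> real" where
  "hadamard_term C m n = sqrt ((real n * C\<^sup>2) ^ n) * m ^ n / fact n"

lemma block_box_right_empty: "block_box n 0 D D' = {..<n} \<rightarrow>\<^sub>E D"
  unfolding block_box_def add_0_right by (rule PiE_cong) auto

lemma enn2real_power: "enn2real (x ^ n) = enn2real x ^ n"
  by (induction n) (auto simp: enn2real_mult)

lemma hadamard_term_nonneg: "0 \<le> m \<Longrightarrow> 0 \<le> hadamard_term C m n"
  unfolding hadamard_term_def by (simp del: real_sqrt_power)

text \<open>From \<open>n\<^sup>n \<le> e\<^sup>n n!\<close> the terms are at most \<open>y\<^sup>n / \<surd>(n!)\<close> for a constant \<open>y\<close>. Writing this as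
  \<open>(x\<^sup>n / \<surd>(n!)) (1 / 2)\<^sup>n\<close> with \<open>x = 2 y\<close>, the arithmetic-geometric mean inequality reduces it to the
  exponential series and a geometric series.\<close>

lemma summable_hadamard_term:
  assumes m: "0 \<le> m"
  shows "summable (hadamard_term C m)"
proof (rule summable_comparison_test')
  define x where "x = 2 * sqrt (exp 1 * C\<^sup>2) * m"
  have x0: "0 \<le> x" using m by (simp add: x_def)
  have "summable (\<lambda>n. (x\<^sup>2) ^ n / fact n)"
    using summable_exp[of "x\<^sup>2"] by (simp add: divide_inverse mult.commute)
  moreover have "summable (\<lambda>n. (1 / 4 :: real) ^ n)"
    by (rule summable_geometric) simp
  ultimately show "summable (\<lambda>n. ((x\<^sup>2) ^ n / fact n + (1 / 4) ^ n))"
    by (rule summable_add)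
  fix n :: nat
  have "real n ^ n / fact n \<le> exp (real n)"
  proof -
    have "real n ^ n /\<^sub>R fact n \<le> (\<Sum>k. real n ^ k /\<^sub>R fact k)"
      using sum_le_suminf[OF summable_exp_generic[of "real n"], of "{n}"] by simp
    then show ?thesis by (simp add: exp_def divide_inverse mult.commute)
  qed
  also have "exp (real n) = exp 1 ^ n" by (simp flip: exp_of_nat_mult)
  finally have nn: "real n ^ n \<le> exp 1 ^ n * fact n" by (simp add: divide_simps)
  have "(real n * C\<^sup>2) ^ n \<le> (exp 1 * C\<^sup>2) ^ n * fact n"
  proof -
    have "real n ^ n * (C\<^sup>2) ^ n \<le> exp 1 ^ n * fact n * (C\<^sup>2) ^ n"
      by (rule mult_right_mono[OF nn]) simp
    then show ?thesis by (simp add: power_mult_distrib mult_ac)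
  qed
  then have "sqrt ((real n * C\<^sup>2) ^ n) \<le> sqrt ((exp 1 * C\<^sup>2) ^ n * fact n)"
    by (rule real_sqrt_le_mono)
  also have "\<dots> = sqrt (exp 1 * C\<^sup>2) ^ n * sqrt (fact n)"
    by (simp only: real_sqrt_mult real_sqrt_power)
  finally have s: "sqrt ((real n * C\<^sup>2) ^ n) \<le> sqrt (exp 1 * C\<^sup>2) ^ n * sqrt (fact n)" .
  have "hadamard_term C m n \<le> (sqrt (exp 1 * C\<^sup>2) ^ n * sqrt (fact n)) * m ^ n / fact n"
    unfolding hadamard_term_def using s m by (intro divide_right_mono mult_right_mono) auto
  also have "\<dots> = (x ^ n / sqrt (fact n)) * (1 / 2) ^ n"
  proof -
    define y :: real where "y = sqrt (fact n)"
    have y: "0 < y" "fact n = y * y" by (auto simp: y_def)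
    show ?thesis unfolding y_def[symmetric] y(2) using y(1)
      by (simp add: x_def power_mult_distrib power_one_over field_simps)
  qed
  also have "\<dots> \<le> (x ^ n / sqrt (fact n))\<^sup>2 + ((1 / 2) ^ n)\<^sup>2"
  proof -
    have "2 * (x ^ n / sqrt (fact n)) * (1 / 2) ^ n \<le> (x ^ n / sqrt (fact n))\<^sup>2 + ((1 / 2) ^ n)\<^sup>2"
      by (rule sum_squares_bound)
    moreover have "0 \<le> (x ^ n / sqrt (fact n)) * (1 / 2) ^ n" using x0 by simp
    ultimately show ?thesis by linarith
  qed
  also have "\<dots> = (x\<^sup>2) ^ n / fact n + (1 / 4) ^ n"
  proof -
    have "((1 / 2 :: real) ^ n)\<^sup>2 = ((1 / 2)\<^sup>2) ^ n" "(x ^ n)\<^sup>2 = (x\<^sup>2) ^ n"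
      by (simp_all only: power_mult[symmetric] mult.commute)
    then show ?thesis by (simp add: power_divide power2_eq_square[of "2::real"])
  qed
  finally show "norm (hadamard_term C m n) \<le> (x\<^sup>2) ^ n / fact n + (1 / 4) ^ n"
    using hadamard_term_nonneg[OF m, of C n] by simp
qed

lemma abs_correlation_det_le:
  assumes "\<And>p q. p \<in> D \<Longrightarrow> q \<in> D \<Longrightarrow> \<bar>K p q\<bar> \<le> C" and z: "\<And>i. i < n \<Longrightarrow> z i \<in> D"
  shows "\<bar>correlation_det K n z\<bar> \<le> sqrt ((real n * C\<^sup>2) ^ n)"
  unfolding correlation_det_def by (rule hadamard_bound) (use assms in auto)

text \<open>Measurability is stated for the correlation determinants, because that is what the definition of
  a correlation function provides.\<close>

locale correlation_kernel = sigma_finite_measure \<mu> for \<mu> :: "'p measure" +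
  fixes K :: "'p \<Rightarrow> 'p \<Rightarrow> real"
  assumes measurable_correlation_det [measurable]:
    "\<And>n. correlation_det K n \<in> borel_measurable (PiM {..<n} (\<lambda>_. \<mu>))"
begin

sublocale product: product_sigma_finite "\<lambda>_::nat. \<mu>"
  by (simp add: product_sigma_finite_def sigma_finite_measure_axioms)

lemma sets_block_box [measurable]:
  assumes "D1 \<in> sets \<mu>" "D2 \<in> sets \<mu>"
  shows "block_box k l D1 D2 \<in> sets (PiM {..<k + l} (\<lambda>_. \<mu>))"
  unfolding block_box_def using assms by (intro sets_PiM_I_finite) auto

lemma emeasure_block_box:
  assumes "D1 \<in> sets \<mu>" "D2 \<in> sets \<mu>"
  shows "emeasure (PiM {..<k + l} (\<lambda>_. \<mu>)) (block_box k l D1 D2) = emeasure \<mu> D1 ^ k * emeasure \<mu> D2 ^ l"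
proof -
  have "emeasure (PiM {..<k + l} (\<lambda>_. \<mu>)) (block_box k l D1 D2)
    = (\<Prod>i<k + l. emeasure \<mu> (if i < k then D1 else D2))"
    unfolding block_box_def using assms by (intro product.emeasure_PiM) auto
  also have "\<dots> = (\<Prod>i=0..<k. emeasure \<mu> (if i < k then D1 else D2))
      * (\<Prod>i=k..<k + l. emeasure \<mu> (if i < k then D1 else D2))"
    using prod.atLeastLessThan_concat[of 0 k "k + l" "\<lambda>i. emeasure \<mu> (if i < k then D1 else D2)"]
    by (simp add: lessThan_atLeast0)
  also have "\<dots> = (\<Prod>i=0..<k. emeasure \<mu> D1) * (\<Prod>i=k..<k + l. emeasure \<mu> D2)"
    by (intro arg_cong2[where f = "(*)"] prod.cong) auto
  finally show ?thesis by simp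
qed

lemma
  assumes D: "D1 \<in> sets \<mu>" "D2 \<in> sets \<mu>" "emeasure \<mu> D1 \<noteq> \<infinity>" "emeasure \<mu> D2 \<noteq> \<infinity>"
    and K: "\<And>p q. p \<in> D1 \<union> D2 \<Longrightarrow> q \<in> D1 \<union> D2 \<Longrightarrow> \<bar>K p q\<bar> \<le> C"
  shows integrable_correlation_det:
      "integrable (PiM {..<k + l} (\<lambda>_. \<mu>)) (\<lambda>z. indicator (block_box k l D1 D2) z
          * correlation_det K (k + l) z)"
    and abs_moment_integral_le: "\<bar>moment_integral \<mu> K (k + l) (block_box k l D1 D2)\<bar>
      \<le> sqrt ((real (k + l) * C\<^sup>2) ^ (k + l)) * (measure \<mu> D1 ^ k * measure \<mu> D2 ^ l)"
proof -
  let ?B = "block_box k l D1 D2" and ?h = "sqrt ((real (k + l) * C\<^sup>2) ^ (k + l))"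
  let ?P = "PiM {..<k + l} (\<lambda>_. \<mu>)"
  have fin: "emeasure ?P ?B < \<infinity>"
    using D by (simp add: emeasure_block_box ennreal_mult_less_top power_less_top_ennreal less_top)
  have bound: "\<bar>correlation_det K (k + l) z\<bar> \<le> ?h" if "z \<in> ?B" for z
  proof (rule abs_correlation_det_le[OF K])
    show "z i \<in> D1 \<union> D2" if "i < k + l" for i
      using \<open>z \<in> ?B\<close> that by (auto simp: block_box_def PiE_def Pi_def split: if_splits)
  qed
  have iB: "integrable ?P (\<lambda>z. ?h * indicator ?B z)"
    using D fin by (intro integrable_mult_right integrable_real_indicator) auto
  have le: "\<bar>indicator ?B z * correlation_det K (k + l) z\<bar> \<le> ?h * indicator ?B z" for z
    using bound[of z] by (auto simp: indicator_def)
  show int: "integrable ?P (\<lambda>z. indicator ?B z * correlation_det K (k + l) z)"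
    by (rule Bochner_Integration.integrable_bound[OF iB]) (use D le in \<open>auto simp del: real_sqrt_power
        simp: abs_mult\<close>)
  have "\<bar>moment_integral \<mu> K (k + l) ?B\<bar> \<le> (\<integral>z. \<bar>indicator ?B z * correlation_det K (k + l) z\<bar> \<partial>?P)"
    unfolding moment_integral_def by (rule integral_abs_bound)
  also have "\<dots> \<le> (\<integral>z. ?h * indicator ?B z \<partial>?P)"
    using int iB le by (intro integral_mono) auto
  also have "\<dots> = ?h * measure ?P ?B"
    using D by simp
  also have "measure ?P ?B = measure \<mu> D1 ^ k * measure \<mu> D2 ^ l"
    unfolding measure_def emeasure_block_box[OF D(1,2)] by (simp add: enn2real_mult enn2real_power)
  finally show "\<bar>moment_integral \<mu> K (k + l) ?B\<bar> \<le> ?h * (measure \<mu> D1 ^ k * measure \<mu> D2 ^ l)" .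
qed

text \<open>On \<open>D1\<^sup>k \<times> D2\<^sup>l\<close> the correlation determinant differs from the product of its two diagonal blocks
  by at most \<open>(k + l)! C\<^bsup>k+l\<^esup> \<delta>\<close>, and by Fubini's theorem the product of the blocks
      integrates to the
  product of the two moment integrals.\<close>

lemma moment_integral_factorization:
  assumes D: "D1 \<in> sets \<mu>" "D2 \<in> sets \<mu>" "emeasure \<mu> D1 \<noteq> \<infinity>" "emeasure \<mu> D2 \<noteq> \<infinity>"
    and K: "\<And>p q. p \<in> D1 \<union> D2 \<Longrightarrow> q \<in> D1 \<union> D2 \<Longrightarrow> \<bar>K p q\<bar> \<le> C" and C: "1 \<le> C"
    and \<delta>: "0 \<le> \<delta>" "\<And>p q. p \<in> D1 \<Longrightarrow> q \<in> D2 \<Longrightarrow> \<bar>K p q\<bar> \<le> \<delta>"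
  shows "\<bar>moment_integral \<mu> K (k + l) (block_box k l D1 D2)
      - moment_integral \<mu> K k ({..<k} \<rightarrow>\<^sub>E D1) * moment_integral \<mu> K l ({..<l} \<rightarrow>\<^sub>E D2)\<bar>
    \<le> fact (k + l) * (C ^ (k + l) * \<delta>) * (measure \<mu> D1 ^ k * measure \<mu> D2 ^ l)"
proof -
  let ?B = "block_box k l D1 D2"
  let ?Pk = "PiM {..<k} (\<lambda>_. \<mu>)" and ?Pl = "PiM {..<l} (\<lambda>_. \<mu>)" and ?P = "PiM {..<k + l} (\<lambda>_. \<mu>)"
  let ?E1 = "{..<k} \<rightarrow>\<^sub>E D1" and ?E2 = "{..<l} \<rightarrow>\<^sub>E D2"
  define e where "e = fact (k + l) * (C ^ (k + l) * \<delta>)"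
  interpret Pk: sigma_finite_measure ?Pk by (rule product.sigma_finite) simp
  interpret Pl: sigma_finite_measure ?Pl by (rule product.sigma_finite) simp
  interpret PP: pair_sigma_finite ?Pk ?Pl ..
  have E1: "?E1 \<in> sets ?Pk" and E2: "?E2 \<in> sets ?Pl"
    using sets_block_box[OF D(1,2), of k 0] sets_block_box[OF D(2,2), of l 0]
    by (simp_all add: block_box_right_empty)
  note [measurable] = E1 E2
  let ?f = "\<lambda>z. indicator ?B z * correlation_det K (k + l) z"
  let ?f1 = "\<lambda>u. indicator ?E1 u * correlation_det K k u"
  let ?f2 = "\<lambda>v. indicator ?E2 v * correlation_det K l v"
  have if0: "integrable ?P ?f" by (rule integrable_correlation_det[OF D K])
  have if1: "integrable ?Pk ?f1"
    using integrable_correlation_det[OF D(1,1,3,3), of C k 0] K by (simp add: block_box_right_empty)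
  have if2: "integrable ?Pl ?f2"
    using integrable_correlation_det[OF D(2,2,4,4), of C l 0] K by (simp add: block_box_right_empty)
  have dist: "?P = distr (?Pk \<Otimes>\<^sub>M ?Pl) ?P (concat_tuple k l)"
    by (rule distr_concat_tuple[symmetric, OF sigma_finite_measure_axioms])
  have meas_f: "?f \<in> borel_measurable ?P" using D by measurable
  have ig: "integrable (?Pk \<Otimes>\<^sub>M ?Pl) (\<lambda>p. ?f (concat_tuple k l p))"
    using if0 by (subst (asm) dist, subst (asm) integrable_distr_eq) (use meas_f in auto)
  have g_eq: "moment_integral \<mu> K (k + l) ?B = (\<integral>p. ?f (concat_tuple k l p) \<partial>(?Pk \<Otimes>\<^sub>M ?Pl))"
    unfolding moment_integral_def by (subst dist, subst integral_distr) (use meas_f in auto)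
  have ih: "integrable (?Pk \<Otimes>\<^sub>M ?Pl) (\<lambda>(u, v). ?f1 u * ?f2 v)"
  proof (rule PP.Fubini_integrable)
    show "(\<lambda>(u, v). ?f1 u * ?f2 v) \<in> borel_measurable (?Pk \<Otimes>\<^sub>M ?Pl)" by measurable
    have "integrable ?Pk (\<lambda>u. norm (?f1 u) * (\<integral>v. norm (?f2 v) \<partial>?Pl))"
      using if1 by (intro integrable_mult_left integrable_norm)
    then show "integrable ?Pk (\<lambda>u. \<integral>v. norm (case (u, v) of (u, v) \<Rightarrow> ?f1 u * ?f2 v) \<partial>?Pl)"
      unfolding prod.case norm_mult by (subst integral_mult_right_zero)
    show "AE u in ?Pk. integrable ?Pl (\<lambda>v. case (u, v) of (u, v) \<Rightarrow> ?f1 u * ?f2 v)"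
      using if2 by simp
  qed
  have h_eq: "(\<integral>p. (case p of (u, v) \<Rightarrow> ?f1 u * ?f2 v) \<partial>(?Pk \<Otimes>\<^sub>M ?Pl))
    = moment_integral \<mu> K k ?E1 * moment_integral \<mu> K l ?E2"
    using PP.integral_fst'[OF ih] by (simp add: moment_integral_def)
  have box: "emeasure (?Pk \<Otimes>\<^sub>M ?Pl) (?E1 \<times> ?E2) = emeasure \<mu> D1 ^ k * emeasure \<mu> D2 ^ l"
    using emeasure_block_box[OF D(1,1), of k 0] emeasure_block_box[OF D(2,2), of l 0]
    by (simp add: Pl.emeasure_pair_measure_Times block_box_right_empty)
  have mbox: "measure (?Pk \<Otimes>\<^sub>M ?Pl) (?E1 \<times> ?E2) = measure \<mu> D1 ^ k * measure \<mu> D2 ^ l"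
    unfolding measure_def box by (simp add: enn2real_mult enn2real_power)
  have ie: "integrable (?Pk \<Otimes>\<^sub>M ?Pl) (\<lambda>p. e * indicator (?E1 \<times> ?E2) p)"
    using D by (intro integrable_mult_right integrable_real_indicator)
      (auto simp: box ennreal_mult_less_top power_less_top_ennreal less_top)
  have pointwise: "\<bar>?f (concat_tuple k l p) - (case p of (u, v) \<Rightarrow> ?f1 u * ?f2 v)\<bar> \<le> e
      * indicator (?E1 \<times> ?E2) p"
    if p: "p \<in> space (?Pk \<Otimes>\<^sub>M ?Pl)" for p
  proof -
    obtain u v where uv: "p = (u, v)" by (cases p)
    have ext: "u \<in> extensional {..<k}" "v \<in> extensional {..<l}"
      using p by (auto simp: uv space_pair_measure space_PiM PiE_iff)
    have "concat_tuple k l (u, v) \<in> ?B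
      \<longleftrightarrow> u \<in> PiE {..<k} (\<lambda>i. if i < k then D1 else D2) \<and> v \<in> PiE {..<l} (\<lambda>j. if j + k < k then D1 else D2)"
      unfolding block_box_def by (rule concat_tuple_in_PiE_iff[OF ext])
    moreover have "PiE {..<k} (\<lambda>i. if i < k then D1 else D2) = ?E1" by (intro PiE_cong) auto
    moreover have "PiE {..<l} (\<lambda>j. if j + k < k then D1 else D2) = ?E2" by (intro PiE_cong) auto
    ultimately have iff: "concat_tuple k l (u, v) \<in> ?B \<longleftrightarrow> u \<in> ?E1 \<and> v \<in> ?E2" by (simp only:)
    show ?thesis
    proof (cases "u \<in> ?E1 \<and> v \<in> ?E2")
      case False
      then have "(indicator ?B (concat_tuple k l (u, v)) :: real) = 0"
        "(indicator (?E1 \<times> ?E2) (u, v) :: real) = 0"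
        "(indicator ?E1 u :: real) = 0 \<or> (indicator ?E2 v :: real) = 0"
        unfolding indicator_eq_0_iff iff by blast+
      then show ?thesis unfolding uv
        by (elim disjE) (simp_all only: prod.case mult_zero_left mult_zero_right diff_self abs_zero
            order.refl)
    next
      case True
      have uD: "u i \<in> D1" if "i < k" for i using True that by auto
      have vD: "v i \<in> D2" if "i < l" for i using True that by auto
      define z where "z = concat_tuple k l (u, v)"
      have z1: "z i = u i" if "i < k" for i using that by (simp add: z_def concat_tuple_def)
      have z2: "z i = v (i - k)" if "k \<le> i" "i < k + l" for i using that
          by (simp add: z_def concat_tuple_def)
      have zD: "z i \<in> D1 \<union> D2" if "i < k + l" for i
        using that uD[of i] vD[of "i - k"] z1[of i] z2[of i] by (cases "i < k") auto
      have c1: "correlation_det K k u = Determinant.det (Matrix.mat k k (\<lambda>(i, j). K (z i) (z j)))"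
        unfolding correlation_det_def by (intro arg_cong[where f = Determinant.det] eq_matI) (auto simp: z1)
      have c2: "correlation_det K l v = Determinant.det
          (Matrix.mat l l (\<lambda>(i, j). K (z (i + k)) (z (j + k))))"
        unfolding correlation_det_def by (intro arg_cong[where f = Determinant.det] eq_matI) (auto simp: z2)
      have "\<bar>correlation_det K (k + l) z - correlation_det K k u * correlation_det K l v\<bar> \<le> e"
        unfolding c1 c2 e_def
        unfolding correlation_det_def
      proof (rule det_block_factorization[OF C _ \<delta>(1)])
        show "\<bar>K (z i) (z j)\<bar> \<le> C" if "i < k + l" "j < k + l" for i j
          using K zD that by blast
        show "\<bar>K (z i) (z j)\<bar> \<le> \<delta>" if "i < k" "k \<le> j" "j < k + l" for i j
          using \<delta>(2) uD[of i] vD[of "j - k"] z1[of i] z2[of j] that by auto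
      qed
      moreover have "(indicator ?B (concat_tuple k l (u, v)) :: real) = 1"
        "(indicator (?E1 \<times> ?E2) (u, v) :: real) = 1"
        "(indicator ?E1 u :: real) = 1" "(indicator ?E2 v :: real) = 1"
        using True unfolding indicator_eq_1_iff iff by blast+
      ultimately show ?thesis
        by (simp only: uv z_def prod.case mult_1 mult_1_right)
    qed
  qed
  have "\<bar>moment_integral \<mu> K (k + l) ?B - moment_integral \<mu> K k ?E1 * moment_integral \<mu> K l ?E2\<bar>
    = \<bar>\<integral>p. ?f (concat_tuple k l p) - (case p of (u, v) \<Rightarrow> ?f1 u * ?f2 v) \<partial>(?Pk \<Otimes>\<^sub>M ?Pl)\<bar>"
    unfolding g_eq h_eq[symmetric] by (subst Bochner_Integration.integral_diff[OF ig ih]) (rule refl)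
  also have "\<dots> \<le> (\<integral>p. \<bar>?f (concat_tuple k l p) - (case p of (u, v) \<Rightarrow> ?f1 u * ?f2 v)\<bar> \<partial>(?Pk \<Otimes>\<^sub>M ?Pl))"
    by (rule integral_abs_bound)
  also have "\<dots> \<le> (\<integral>p. e * indicator (?E1 \<times> ?E2) p \<partial>(?Pk \<Otimes>\<^sub>M ?Pl))"
    using pointwise by (intro integral_mono ie integrable_abs Bochner_Integration.integrable_diff ig ih)
        auto
  also have "\<dots> = e * (measure \<mu> D1 ^ k * measure \<mu> D2 ^ l)"
    using E1 E2 by (simp add: mbox)
  finally show ?thesis unfolding e_def .
qed

end

section \<open>Void probabilities of determinantal processes\<close>

text \<open>The last assumption provides a version of each count that is measurable and correct almost surely,
  because the lines are distinct almost surely only.\<close>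

locale determinantal_process = prob_space M + correlation_kernel \<mu> K
  for M :: "'w measure" and \<mu> :: "'p measure" and K :: "'p \<Rightarrow> 'p \<Rightarrow> real" +
  fixes S :: "'w \<Rightarrow> 'p set"
  assumes determinantal: "determinantal M S \<mu> K"
    and sets_void: "\<And>D. D \<in> sets \<mu> \<Longrightarrow> {\<omega> \<in> space M. S \<omega> \<inter> D = {}} \<in> events"
    and measurable_count: "\<And>D. D \<in> sets \<mu> \<Longrightarrow>
      \<exists>c\<in>borel_measurable M. AE \<omega> in M. emeasure (count_space UNIV) (S \<omega> \<inter> D) = c \<omega>"
begin

lemma nn_integral_factorial_count:
  assumes "1 \<le> n" "B \<in> sets (PiM {..<n} (\<lambda>_. \<mu>))"
    and int: "integrable (PiM {..<n} (\<lambda>_. \<mu>)) (\<lambda>z. indicator B z * correlation_det K n z)"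
  shows "(\<integral>\<^sup>+\<omega>. factorial_count n (S \<omega>) B \<partial>M) = ennreal (moment_integral \<mu> K n B)"
    and "0 \<le> moment_integral \<mu> K n B"
proof -
  let ?P = "PiM {..<n} (\<lambda>_. \<mu>)"
  have cf: "correlation_function M S \<mu> n (correlation_det K n)"
    using determinantal assms(1) by (simp add: determinantal_def correlation_det_def[abs_def])
  then have nonneg: "AE z in ?P. 0 \<le> indicator B z * correlation_det K n z"
    by (auto simp: correlation_function_def elim!: eventually_mono)
  have "(\<integral>\<^sup>+\<omega>. factorial_count n (S \<omega>) B \<partial>M) = (\<integral>\<^sup>+z. ennreal (correlation_det K n z) * indicator B z \<partial>?P)"
    using cf assms(2) by (simp add: correlation_function_def)
  also have "\<dots> = (\<integral>\<^sup>+z. ennreal (indicator B z * correlation_det K n z) \<partial>?P)"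
    by (intro nn_integral_cong) (auto simp: indicator_def)
  also have "\<dots> = ennreal (moment_integral \<mu> K n B)"
    unfolding moment_integral_def by (rule nn_integral_eq_integral[OF int nonneg])
  finally show "(\<integral>\<^sup>+\<omega>. factorial_count n (S \<omega>) B \<partial>M) = ennreal (moment_integral \<mu> K n B)" .
  show "0 \<le> moment_integral \<mu> K n B"
    unfolding moment_integral_def by (rule integral_nonneg_AE[OF nonneg])
qed

text \<open>The first moment of the count is an integral of the bounded density over a set of finite
  measure; hence the count is almost surely finite and has a measurable version with values in
  \<open>nat\<close>.\<close>

lemma count_variable:
  assumes D: "D \<in> sets \<mu>" "emeasure \<mu> D \<noteq> \<infinity>"
    and K: "\<And>p q. p \<in> D \<Longrightarrow> q \<in> D \<Longrightarrow> \<bar>K p q\<bar> \<le> C"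
  obtains N :: "'w \<Rightarrow> nat" where "N \<in> measurable M (count_space UNIV)"
    "AE \<omega> in M. finite (S \<omega> \<inter> D) \<and> card (S \<omega> \<inter> D) = N \<omega>"
proof -
  obtain c where c[measurable]: "c \<in> borel_measurable M"
    and ceq: "AE \<omega> in M. emeasure (count_space UNIV) (S \<omega> \<inter> D) = c \<omega>"
    using measurable_count[OF D(1)] by blast
  have box: "block_box 1 0 D D = {..<1} \<rightarrow>\<^sub>E D" by (rule block_box_right_empty)
  have "(\<integral>\<^sup>+\<omega>. factorial_count 1 (S \<omega>) ({..<1} \<rightarrow>\<^sub>E D) \<partial>M) < \<infinity>"
    using nn_integral_factorial_count(1)[of 1 "{..<1} \<rightarrow>\<^sub>E D"] K
      integrable_correlation_det[OF D(1,1,2,2), of C 1 0] sets_block_box[OF D(1,1), of 1 0]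
    unfolding box by simp
  moreover have "(\<integral>\<^sup>+\<omega>. \<infinity> * indicator {\<omega> \<in> space M. c \<omega> = \<infinity>} \<omega> \<partial>M)
    \<le> (\<integral>\<^sup>+\<omega>. factorial_count 1 (S \<omega>) ({..<1} \<rightarrow>\<^sub>E D) \<partial>M)"
  proof (rule nn_integral_mono_AE)
    show "AE \<omega> in M. \<infinity> * indicator {\<omega> \<in> space M. c \<omega> = \<infinity>} \<omega> \<le> factorial_count 1 (S \<omega>) ({..<1} \<rightarrow>\<^sub>E D)"
      using ceq
    proof eventually_elim
      case (elim \<omega>)
      show ?case
      proof (cases "c \<omega> = \<infinity>")
        case True
        then have "infinite (S \<omega> \<inter> D)" using elim by auto
        from factorial_count_one_infinite[OF this] show ?thesis by simp
      qed (simp add: indicator_def)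
    qed
  qed
  ultimately have "(\<integral>\<^sup>+\<omega>. \<infinity> * indicator {\<omega> \<in> space M. c \<omega> = \<infinity>} \<omega> \<partial>M) < \<infinity>"
    by (rule le_less_trans[rotated])
  then have "emeasure M {\<omega> \<in> space M. c \<omega> = \<infinity>} = 0"
    by (subst (asm) nn_integral_cmult_indicator) (auto simp: ennreal_top_mult split: if_splits)
  then have cfin: "AE \<omega> in M. c \<omega> \<noteq> \<infinity>"
    by (subst AE_iff_measurable[OF _ refl]) auto
  define N where "N \<omega> = nat \<lfloor>enn2real (c \<omega>)\<rfloor>" for \<omega>
  show ?thesis
  proof
    show "N \<in> measurable M (count_space UNIV)" unfolding N_def by measurable
    show "AE \<omega> in M. finite (S \<omega> \<inter> D) \<and> card (S \<omega> \<inter> D) = N \<omega>"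
      using ceq cfin
    proof eventually_elim
      case (elim \<omega>)
      then have fin: "finite (S \<omega> \<inter> D)" by (metis emeasure_count_space_infinite subset_UNIV)
      then have "c \<omega> = of_nat (card (S \<omega> \<inter> D))" using elim by simp
      then show ?case using fin by (simp add: N_def)
    qed
  qed
qed

lemma factorial_moments:
  assumes D: "D1 \<in> sets \<mu>" "D2 \<in> sets \<mu>" "emeasure \<mu> D1 \<noteq> \<infinity>" "emeasure \<mu> D2 \<noteq> \<infinity>"
    and disj: "D1 \<inter> D2 = {}"
    and K: "\<And>p q. p \<in> D1 \<union> D2 \<Longrightarrow> q \<in> D1 \<union> D2 \<Longrightarrow> \<bar>K p q\<bar> \<le> C"
    and N1: "N1 \<in> measurable M (count_space UNIV)"
      "AE \<omega> in M. finite (S \<omega> \<inter> D1) \<and> card (S \<omega> \<inter> D1) = N1 \<omega>"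
    and N2: "N2 \<in> measurable M (count_space UNIV)"
      "AE \<omega> in M. finite (S \<omega> \<inter> D2) \<and> card (S \<omega> \<inter> D2) = N2 \<omega>"
  shows "has_bochner_integral M (\<lambda>\<omega>. real (N1 \<omega> choose k) * real (N2 \<omega> choose l))
      (moment_integral \<mu> K (k + l) (block_box k l D1 D2) / (fact k * fact l))"
proof (cases "k + l = 0")
  case True
  then have kl: "k = 0" "l = 0" by auto
  (* Correlation functions are of order at least 1; the empty tuple is treated by hand. *)
  interpret P0: prob_space "PiM {} (\<lambda>_::nat. \<mu>)" by (rule prob_space_PiM) simp
  have "moment_integral \<mu> K 0 (block_box 0 0 D1 D2) = (LINT z|PiM {} (\<lambda>_::nat. \<mu>). 1)"
    unfolding moment_integral_def lessThan_0 block_box_def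
    by (intro Bochner_Integration.integral_cong) (auto simp: space_PiM correlation_det_def det_dim_zero)
  then have "moment_integral \<mu> K 0 (block_box 0 0 D1 D2) = 1" by (simp add: P0.prob_space)
  then show ?thesis by (simp add: has_bochner_integral_iff kl prob_space)
next
  case False
  let ?B = "block_box k l D1 D2" and ?J = "moment_integral \<mu> K (k + l) (block_box k l D1 D2)"
  let ?X = "\<lambda>\<omega>. real (fact k * (N1 \<omega> choose k) * (fact l * (N2 \<omega> choose l)))"
  note [measurable] = N1(1) N2(1)
  have int: "integrable (PiM {..<k + l} (\<lambda>_. \<mu>)) (\<lambda>z. indicator ?B z * correlation_det K (k + l) z)"
    by (rule integrable_correlation_det[OF D K])
  have 1: "1 \<le> k + l" using False by linarith
  have J0: "0 \<le> ?J" using nn_integral_factorial_count(2)[OF 1 sets_block_box[OF D(1,2)] int] .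
  have "(\<integral>\<^sup>+\<omega>. ennreal (?X \<omega>) \<partial>M) = (\<integral>\<^sup>+\<omega>. factorial_count (k + l) (S \<omega>) ?B \<partial>M)"
  proof (rule nn_integral_cong_AE)
    show "AE \<omega> in M. ennreal (?X \<omega>) = factorial_count (k + l) (S \<omega>) ?B"
      using N1(2) N2(2)
    proof eventually_elim
      case (elim \<omega>)
      then show ?case
        using disj by (simp only: factorial_count_block_box ennreal_of_nat_eq_real_of_nat)
    qed
  qed
  also have "\<dots> = ennreal ?J"
    by (rule nn_integral_factorial_count(1)[OF 1 sets_block_box[OF D(1,2)] int])
  finally have "has_bochner_integral M ?X ?J"
    using J0 by (intro has_bochner_integral_nn_integral) auto
  from has_bochner_integral_divide_zero[OF this, of "fact k * fact l"]
  show ?thesis by (simp add: mult_ac)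
qed

text \<open>For a finite count \<open>N\<close>, the alternating sum of the binomial coefficients \<open>N choose n\<close> is the indicator
  of \<open>N = 0\<close>. Taking expectations termwise gives the Fredholm series; Hadamard's bound justifies the
  interchange.\<close>

lemma void_probability_sums:
  assumes D: "D \<in> sets \<mu>" "emeasure \<mu> D \<noteq> \<infinity>"
    and K: "\<And>p q. p \<in> D \<Longrightarrow> q \<in> D \<Longrightarrow> \<bar>K p q\<bar> \<le> C"
  shows "(\<lambda>n. (- 1) ^ n * (moment_integral \<mu> K n ({..<n} \<rightarrow>\<^sub>E D) / fact n)) sums
      prob {\<omega> \<in> space M. S \<omega> \<inter> D = {}}"
proof -
  obtain N :: "'w \<Rightarrow> nat" where N: "N \<in> measurable M (count_space UNIV)"
      "AE \<omega> in M. finite (S \<omega> \<inter> D) \<and> card (S \<omega> \<inter> D) = N \<omega>"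
    using count_variable[OF D K] by blast
  note [measurable] = N(1)
  have "AE \<omega> in M. finite (S \<omega> \<inter> {}) \<and> card (S \<omega> \<inter> {}) = (\<lambda>_. 0 :: nat) \<omega>" by simp
  from factorial_moments[OF D(1) _ D(2) _ _ _ N _ this, of C _ 0] K
  have mom: "has_bochner_integral M (\<lambda>\<omega>. real (N \<omega> choose n))
      (moment_integral \<mu> K n ({..<n} \<rightarrow>\<^sub>E D) / fact n)" for n
    by (simp add: block_box_right_empty)
  let ?f = "\<lambda>n \<omega>. (- 1) ^ n * real (N \<omega> choose n)"
  have fin: "?f n \<omega> = 0" if "n \<notin> {..N \<omega>}" for n \<omega> using that by (simp add: binomial_eq_0)
  have norm_le: "moment_integral \<mu> K n ({..<n} \<rightarrow>\<^sub>E D) / fact n \<le> hadamard_term C (measure \<mu> D) n" for n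
    using abs_moment_integral_le[OF D(1,1,2,2), of C n 0] K
    by (auto simp: hadamard_term_def block_box_right_empty intro!: divide_right_mono simp del:
        real_sqrt_power)
  have mom0: "0 \<le> moment_integral \<mu> K n ({..<n} \<rightarrow>\<^sub>E D) / fact n" for n
    using has_bochner_integral_integral_eq[OF mom[of n]] by (metis integral_nonneg_AE AE_I2 of_nat_0_le_iff)
  have sums: "(\<lambda>n. integral\<^sup>L M (?f n)) sums (\<integral>\<omega>. (\<Sum>n. ?f n \<omega>) \<partial>M)"
  proof (rule sums_integral)
    show "integrable M (?f n)" for n
      using mom[of n] by (intro integrable_mult_right) (auto simp: has_bochner_integral_iff)
    show "AE \<omega> in M. summable (\<lambda>n. norm (?f n \<omega>))"
    proof (rule AE_I2)
      fix \<omega>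
      show "summable (\<lambda>n. norm (?f n \<omega>))"
        by (rule summable_finite[where N = "{..N \<omega>}"]) (auto simp: binomial_eq_0)
    qed
    show "summable (\<lambda>n. \<integral>\<omega>. norm (?f n \<omega>) \<partial>M)"
    proof (rule summable_comparison_test'[OF summable_hadamard_term[of "measure \<mu> D" C]])
      fix n
      show "norm (\<integral>\<omega>. norm (?f n \<omega>) \<partial>M) \<le> hadamard_term C (measure \<mu> D) n"
        using has_bochner_integral_integral_eq[OF mom[of n]] norm_le[of n] mom0[of n]
        by (simp add: abs_mult power_abs)
    qed simp
  qed
  have "(\<Sum>n. ?f n \<omega>) = indicator {\<omega> \<in> space M. N \<omega> = 0} \<omega>" if "\<omega> \<in> space M" for \<omega>
  proof -
    have "(\<Sum>n. ?f n \<omega>) = (\<Sum>n\<le>N \<omega>. ?f n \<omega>)"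
      by (rule suminf_finite) (auto intro: fin)
    also have "\<dots> = (if N \<omega> = 0 then 1 else 0)"
      using choose_alternating_sum[of "N \<omega>", where 'a = real] by auto
    finally show ?thesis using that by simp
  qed
  then have "(\<integral>\<omega>. (\<Sum>n. ?f n \<omega>) \<partial>M) = (\<integral>\<omega>. indicator {\<omega> \<in> space M. N \<omega> = 0} \<omega> \<partial>M)"
    by (intro Bochner_Integration.integral_cong) auto
  also have "\<dots> = prob {\<omega> \<in> space M. N \<omega> = 0}" by simp
  also have "\<dots> = prob {\<omega> \<in> space M. S \<omega> \<inter> D = {}}"
  proof (rule measure_eq_AE)
    show "AE \<omega> in M. \<omega> \<in> {\<omega> \<in> space M. N \<omega> = 0} \<longleftrightarrow> \<omega> \<in> {\<omega> \<in> space M. S \<omega> \<inter> D = {}}"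
      using N(2) by eventually_elim auto
  qed (use sets_void[OF D(1)] in auto)
  finally have "(\<integral>\<omega>. (\<Sum>n. ?f n \<omega>) \<partial>M) = prob {\<omega> \<in> space M. S \<omega> \<inter> D = {}}" .
  moreover have "integral\<^sup>L M (?f n) = (- 1) ^ n * (moment_integral \<mu> K n ({..<n} \<rightarrow>\<^sub>E D) / fact n)" for n
    using has_bochner_integral_integral_eq[OF mom[of n]] by simp
  ultimately show ?thesis using sums by simp
qed

text \<open>The Vandermonde identity for the counts in the two parts of the union, in expectation.\<close>

lemma moment_integral_union:
  assumes D: "D1 \<in> sets \<mu>" "D2 \<in> sets \<mu>" "emeasure \<mu> D1 \<noteq> \<infinity>" "emeasure \<mu> D2 \<noteq> \<infinity>"
    and disj: "D1 \<inter> D2 = {}"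
    and K: "\<And>p q. p \<in> D1 \<union> D2 \<Longrightarrow> q \<in> D1 \<union> D2 \<Longrightarrow> \<bar>K p q\<bar> \<le> C"
  shows "moment_integral \<mu> K n ({..<n} \<rightarrow>\<^sub>E (D1 \<union> D2)) / fact n
    = (\<Sum>k\<le>n. moment_integral \<mu> K n (block_box k (n - k) D1 D2) / (fact k * fact (n - k)))"
proof -
  obtain N1 :: "'w \<Rightarrow> nat" where N1: "N1 \<in> measurable M (count_space UNIV)"
      "AE \<omega> in M. finite (S \<omega> \<inter> D1) \<and> card (S \<omega> \<inter> D1) = N1 \<omega>"
    using count_variable[OF D(1,3), of C] K by blast
  obtain N2 :: "'w \<Rightarrow> nat" where N2: "N2 \<in> measurable M (count_space UNIV)"
      "AE \<omega> in M. finite (S \<omega> \<inter> D2) \<and> card (S \<omega> \<inter> D2) = N2 \<omega>"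
    using count_variable[OF D(2,4), of C] K by blast
  note [measurable] = N1(1) N2(1)
  have N: "(\<lambda>\<omega>. N1 \<omega> + N2 \<omega>) \<in> measurable M (count_space UNIV)" by measurable
  have Nc: "AE \<omega> in M. finite (S \<omega> \<inter> (D1 \<union> D2)) \<and> card (S \<omega> \<inter> (D1 \<union> D2)) = (\<lambda>\<omega>. N1 \<omega> + N2 \<omega>) \<omega>"
    using N1(2) N2(2)
  proof eventually_elim
    case (elim \<omega>)
    then have "card ((S \<omega> \<inter> D1) \<union> (S \<omega> \<inter> D2)) = N1 \<omega> + N2 \<omega>"
      using disj by (subst card_Un_disjoint) auto
    then show ?case using elim by (simp add: Int_Un_distrib)
  qed
  have Dfin: "emeasure \<mu> (D1 \<union> D2) \<noteq> \<infinity>"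
    using D emeasure_subadditive[of D1 \<mu> D2] by (metis ennreal_add_eq_top infinity_ennreal_def
        neq_top_trans)
  have "AE \<omega> in M. finite (S \<omega> \<inter> {}) \<and> card (S \<omega> \<inter> {}) = (\<lambda>_. 0 :: nat) \<omega>" by simp
  from factorial_moments[OF _ _ Dfin _ _ _ N Nc _ this, of C n 0] K D
  have whole: "has_bochner_integral M (\<lambda>\<omega>. real (N1 \<omega> + N2 \<omega> choose n))
      (moment_integral \<mu> K n ({..<n} \<rightarrow>\<^sub>E (D1 \<union> D2)) / fact n)"
    by (simp add: block_box_right_empty)
  have "has_bochner_integral M (\<lambda>\<omega>. \<Sum>k\<le>n. real (N1 \<omega> choose k) * real (N2 \<omega> choose (n - k)))
    (\<Sum>k\<le>n. moment_integral \<mu> K n (block_box k (n - k) D1 D2) / (fact k * fact (n - k)))"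
  proof (rule has_bochner_integral_sum)
    fix k assume "k \<in> {..n}"
    then show "has_bochner_integral M (\<lambda>\<omega>. real (N1 \<omega> choose k) * real (N2 \<omega> choose (n - k)))
      (moment_integral \<mu> K n (block_box k (n - k) D1 D2) / (fact k * fact (n - k)))"
      using factorial_moments[OF D disj K N1 N2, of k "n - k"] by simp
  qed
  moreover have "(\<lambda>\<omega>. \<Sum>k\<le>n. real (N1 \<omega> choose k) * real (N2 \<omega> choose (n - k)))
    = (\<lambda>\<omega>. real (N1 \<omega> + N2 \<omega> choose n))"
    by (simp add: vandermonde[symmetric])
  ultimately show ?thesis by (simp only: has_bochner_integral_eq[OF whole])
qed

end

text \<open>The \<open>n\<close>-th terms of the Fredholm series of a union and of the Cauchy product of the two separate
  series differ by at most this amount, whatever the coupling between the two parts; they differ by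
  at most \<open>(2 C m)\<^sup>n \<delta>\<close> when the kernel between the parts is at most \<open>\<delta>\<close>. The latter is small for each
  \<open>n\<close>, the former summable, and the minimum of both bounds the decoupling error.\<close>

definition decoupling_majorant :: "real \<Rightarrow> real \<Rightarrow> nat \<Rightarrow> real" where
  "decoupling_majorant C m n =
     hadamard_term C (2 * m) n + (\<Sum>k\<le>n. hadamard_term C m k * hadamard_term C m (n - k))"

definition decoupling_error :: "real \<Rightarrow> real \<Rightarrow> real \<Rightarrow> real" where
  "decoupling_error C m \<delta> = (\<Sum>n. min (decoupling_majorant C m n) ((2 * C * m) ^ n * \<delta>))"

lemma summable_decoupling_majorant:
  assumes "0 \<le> m"
  shows "summable (decoupling_majorant C m)"
proof -
  have "summable (\<lambda>n. norm (hadamard_term C m n))"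
    using summable_hadamard_term[OF assms] assms by (simp add: hadamard_term_nonneg)
  from summable_Cauchy_product[OF this this]
  have "summable (\<lambda>n. \<Sum>k\<le>n. hadamard_term C m k * hadamard_term C m (n - k))" .
  from summable_add[OF summable_hadamard_term[of "2 * m" C] this] assms
  show ?thesis by (simp add: decoupling_majorant_def[abs_def])
qed

lemma decoupling_majorant_nonneg: "0 \<le> m \<Longrightarrow> 0 \<le> decoupling_majorant C m n"
  unfolding decoupling_majorant_def by (intro add_nonneg_nonneg sum_nonneg mult_nonneg_nonneg
      hadamard_term_nonneg) auto

lemma decoupling_error_tendsto_0:
  assumes m: "0 \<le> m" and C: "0 \<le> C" and \<delta>: "(\<delta> \<longlongrightarrow> 0) F" "\<forall>\<^sub>F T in F. 0 \<le> \<delta> T" and F: "F \<noteq> bot"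
  shows "((\<lambda>T. decoupling_error C m (\<delta> T)) \<longlongrightarrow> 0) F"
proof -
  have "((\<lambda>T. \<Sum>n. min (decoupling_majorant C m n) ((2 * C * m) ^ n * \<delta> T)) \<longlongrightarrow> (\<Sum>n::nat. 0)) F"
  proof (rule tannerys_theorem[THEN conjunct2, THEN conjunct2])
    show "((\<lambda>T. min (decoupling_majorant C m n) ((2 * C * m) ^ n * \<delta> T)) \<longlongrightarrow> 0) F" for n
    proof -
      have "((\<lambda>T. min (decoupling_majorant C m n) ((2 * C * m) ^ n * \<delta> T))
        \<longlongrightarrow> min (decoupling_majorant C m n) ((2 * C * m) ^ n * 0)) F"
        by (intro tendsto_intros \<delta>)
      then show ?thesis using decoupling_majorant_nonneg[OF m, of C n] by (simp add: min_absorb2)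
    qed
    show "\<forall>\<^sub>F (n, T) in sequentially \<times>\<^sub>F F.
        norm (min (decoupling_majorant C m n) ((2 * C * m) ^ n * \<delta> T)) \<le> decoupling_majorant C m n"
    proof (subst eventually_prod_filter, intro exI conjI allI impI)
      show "\<forall>\<^sub>F n in sequentially. True" by simp
      show "\<forall>\<^sub>F T in F. 0 \<le> \<delta> T" by (rule \<delta>)
      fix n T assume "0 \<le> \<delta> T"
      then have "0 \<le> (2 * C * m) ^ n * \<delta> T" using m C by simp
      then show "case (n, T) of (n, T) \<Rightarrow>
        norm (min (decoupling_majorant C m n) ((2 * C * m) ^ n * \<delta> T)) \<le> decoupling_majorant C m n"
        using decoupling_majorant_nonneg[OF m, of C n] by (auto simp: min_def)
    qed
    show "summable (decoupling_majorant C m)" by (rule summable_decoupling_majorant[OF m])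
  qed (rule F)
  then show ?thesis by (simp add: decoupling_error_def)
qed

text \<open>The bound depends on the process only through \<open>C\<close>, \<open>m\<close> and \<open>\<delta>\<close>. It is therefore uniform over the
  different processes that arise as the time shift varies.\<close>

lemma (in determinantal_process) void_probability_decoupling:
  assumes D: "D1 \<in> sets \<mu>" "D2 \<in> sets \<mu>" "emeasure \<mu> D1 \<noteq> \<infinity>" "emeasure \<mu> D2 \<noteq> \<infinity>"
    and m: "measure \<mu> D1 \<le> m" "measure \<mu> D2 \<le> m"
    and disj: "D1 \<inter> D2 = {}"
    and K: "\<And>p q. p \<in> D1 \<union> D2 \<Longrightarrow> q \<in> D1 \<union> D2 \<Longrightarrow> \<bar>K p q\<bar> \<le> C" and C: "1 \<le> C"
    and \<delta>: "0 \<le> \<delta>" "\<And>p q. p \<in> D1 \<Longrightarrow> q \<in> D2 \<Longrightarrow> \<bar>K p q\<bar> \<le> \<delta>"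
  shows "\<bar>prob {\<omega> \<in> space M. S \<omega> \<inter> (D1 \<union> D2) = {}}
      - prob {\<omega> \<in> space M. S \<omega> \<inter> D1 = {}} * prob {\<omega> \<in> space M. S \<omega> \<inter> D2 = {}}\<bar>
    \<le> decoupling_error C m \<delta>"
proof -
  define v where "v D n = moment_integral \<mu> K n ({..<n} \<rightarrow>\<^sub>E D) / fact n" for D n
  have m0: "0 \<le> m" using m(1) measure_nonneg order_trans by blast
  have Dfin: "emeasure \<mu> (D1 \<union> D2) \<noteq> \<infinity>"
    using D emeasure_subadditive[of D1 \<mu> D2] by (metis ennreal_add_eq_top infinity_ennreal_def
        neq_top_trans)
  have mono: "hadamard_term C a n \<le> hadamard_term C b n" if "0 \<le> a" "a \<le> b" for a b n
    unfolding hadamard_term_def using that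
    by (intro divide_right_mono mult_left_mono power_mono) (auto simp del: real_sqrt_power)
  have v_le: "\<bar>v E n\<bar> \<le> hadamard_term C b n"
    if E: "E \<in> sets \<mu>" "emeasure \<mu> E \<noteq> \<infinity>" "E \<subseteq> D1 \<union> D2" and b: "measure \<mu> E \<le> b" for E b n
  proof -
    have "\<bar>v E n\<bar> \<le> hadamard_term C (measure \<mu> E) n"
      using abs_moment_integral_le[OF E(1,1,2,2), of C n 0] K E(3)
      by (auto simp: v_def hadamard_term_def block_box_right_empty intro!: divide_right_mono
          simp del: real_sqrt_power)
    also have "\<dots> \<le> hadamard_term C b n" using b by (intro mono) auto
    finally show ?thesis .
  qed
  have v1: "\<bar>v D1 n\<bar> \<le> hadamard_term C m n" and v2: "\<bar>v D2 n\<bar> \<le> hadamard_term C m n" for n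
    using v_le[OF D(1,3), of m] v_le[OF D(2,4), of m] m by auto
  have "measure \<mu> (D1 \<union> D2) \<le> 2 * m"
    using measure_Un_le[of D1 \<mu> D2] D m by auto
  then have v12: "\<bar>v (D1 \<union> D2) n\<bar> \<le> hadamard_term C (2 * m) n" for n
    using D Dfin by (intro v_le) auto
  let ?c = "\<lambda>n. \<Sum>k\<le>n. v D1 k * v D2 (n - k)"
  let ?t = "\<lambda>n. (- 1) ^ n * (v (D1 \<union> D2) n - ?c n)"
  have sum12: "(\<lambda>n. (- 1) ^ n * v (D1 \<union> D2) n) sums prob {\<omega> \<in> space M. S \<omega> \<inter> (D1 \<union> D2) = {}}"
    unfolding v_def using D Dfin K by (intro void_probability_sums) auto
  have sum1: "(\<lambda>n. (- 1) ^ n * v D1 n) sums prob {\<omega> \<in> space M. S \<omega> \<inter> D1 = {}}"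
    and sum2: "(\<lambda>n. (- 1) ^ n * v D2 n) sums prob {\<omega> \<in> space M. S \<omega> \<inter> D2 = {}}"
    unfolding v_def using D K by (intro void_probability_sums; auto)+
  have "summable (\<lambda>n. norm ((- 1) ^ n * v D1 n))" "summable (\<lambda>n. norm ((- 1) ^ n * v D2 n))"
    using v1 v2 by (intro summable_comparison_test'[OF summable_hadamard_term[OF m0, of C], of 0];
        simp add: abs_mult power_abs)+
  from Cauchy_product_sums[OF this]
  have "(\<lambda>n. \<Sum>k\<le>n. ((- 1) ^ k * v D1 k) * ((- 1) ^ (n - k) * v D2 (n - k))) sums
     (prob {\<omega> \<in> space M. S \<omega> \<inter> D1 = {}} * prob {\<omega> \<in> space M. S \<omega> \<inter> D2 = {}})"
    using sum1 sum2 by (simp add: sums_iff)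
  moreover have "(\<Sum>k\<le>n. ((- 1) ^ k * v D1 k) * ((- 1) ^ (n - k) * v D2 (n - k))) = (- 1) ^ n * ?c n" for n
    unfolding sum_distrib_left
  proof (intro sum.cong refl)
    fix k assume "k \<in> {..n}"
    then have "(- 1 :: real) ^ n = (- 1) ^ k * (- 1) ^ (n - k)" by (simp flip: power_add)
    then show "((- 1) ^ k * v D1 k) * ((- 1) ^ (n - k) * v D2 (n - k)) = (- 1) ^ n
        * (v D1 k * v D2 (n - k))"
      by simp
  qed
  ultimately have "(\<lambda>n. (- 1) ^ n * ?c n) sums
     (prob {\<omega> \<in> space M. S \<omega> \<inter> D1 = {}} * prob {\<omega> \<in> space M. S \<omega> \<inter> D2 = {}})" by simp
  from sums_diff[OF sum12 this]
  have diff: "?t sums (prob {\<omega> \<in> space M. S \<omega> \<inter> (D1 \<union> D2) = {}}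
      - prob {\<omega> \<in> space M. S \<omega> \<inter> D1 = {}} * prob {\<omega> \<in> space M. S \<omega> \<inter> D2 = {}})"
    by (simp add: right_diff_distrib)
  have term_le: "\<bar>?t n\<bar> \<le> min (decoupling_majorant C m n) ((2 * C * m) ^ n * \<delta>)" for n
  proof (rule min.boundedI)
    have "\<bar>?t n\<bar> \<le> \<bar>v (D1 \<union> D2) n\<bar> + \<bar>?c n\<bar>" by (simp add: abs_mult power_abs)
    also have "\<bar>?c n\<bar> \<le> (\<Sum>k\<le>n. hadamard_term C m k * hadamard_term C m (n - k))"
    proof (rule order_trans[OF sum_abs sum_mono])
      fix k
      show "\<bar>v D1 k * v D2 (n - k)\<bar> \<le> hadamard_term C m k * hadamard_term C m (n - k)"
        unfolding abs_mult using m0 v1 v2 by (intro mult_mono hadamard_term_nonneg) auto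
    qed
    finally show "\<bar>?t n\<bar> \<le> decoupling_majorant C m n"
      using v12[of n] unfolding decoupling_majorant_def by linarith
    let ?J = "\<lambda>k. moment_integral \<mu> K n (block_box k (n - k) D1 D2)"
    let ?I = "\<lambda>k. moment_integral \<mu> K k ({..<k} \<rightarrow>\<^sub>E D1) * moment_integral \<mu> K (n - k) ({..<n - k} \<rightarrow>\<^sub>E D2)"
    have "v (D1 \<union> D2) n - ?c n = (\<Sum>k\<le>n. (?J k - ?I k) / (fact k * fact (n - k)))"
      using moment_integral_union[OF D disj K, of n]
      by (simp add: v_def sum_subtractf diff_divide_distrib)
    then have "\<bar>?t n\<bar> = \<bar>\<Sum>k\<le>n. (?J k - ?I k) / (fact k * fact (n - k))\<bar>"
      by (simp add: abs_mult power_abs)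
    also have "\<dots> \<le> (\<Sum>k\<le>n. real (n choose k) * (C ^ n * \<delta> * m ^ n))"
    proof (rule order_trans[OF sum_abs sum_mono])
      fix k assume "k \<in> {..n}"
      then have k: "k \<le> n" by simp
      have "\<bar>?J k - ?I k\<bar> \<le> fact n * (C ^ n * \<delta>) * (measure \<mu> D1 ^ k * measure \<mu> D2 ^ (n - k))"
        using moment_integral_factorization[OF D K C \<delta>, of k "n - k"] k by simp
      also have "\<dots> \<le> fact n * (C ^ n * \<delta>) * (m ^ k * m ^ (n - k))"
        using C \<delta>(1) m m0 by (intro mult_left_mono mult_mono power_mono) auto
      also have "m ^ k * m ^ (n - k) = m ^ n" using k by (simp flip: power_add)
      finally have "\<bar>(?J k - ?I k) / (fact k * fact (n - k))\<bar>
          \<le> (fact n * (C ^ n * \<delta>) * m ^ n) / (fact k * fact (n - k))"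
        by (simp add: abs_mult divide_right_mono)
      also have "\<dots> = real (n choose k) * (C ^ n * \<delta> * m ^ n)"
        using binomial_fact[OF k, where 'a = real] by (simp add: mult_ac)
      finally show "\<bar>(?J k - ?I k) / (fact k * fact (n - k))\<bar> \<le> real (n choose k) * (C ^ n * \<delta> * m ^ n)" .
    qed
    also have "\<dots> = real (\<Sum>k\<le>n. n choose k) * (C ^ n * \<delta> * m ^ n)"
      by (simp add: sum_distrib_right)
    also have "\<dots> = (2 * C * m) ^ n * \<delta>"
      by (simp add: choose_row_sum power_mult_distrib)
    finally show "\<bar>?t n\<bar> \<le> (2 * C * m) ^ n * \<delta>" .
  qed
  have "0 \<le> min (decoupling_majorant C m n) ((2 * C * m) ^ n * \<delta>)" for n
    using term_le[of n] abs_ge_zero order_trans by blast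
  then have sm: "summable (\<lambda>n. min (decoupling_majorant C m n) ((2 * C * m) ^ n * \<delta>))"
    by (intro summable_comparison_test'[OF summable_decoupling_majorant[OF m0, of C], of 0]) auto
  have st: "summable (\<lambda>n. \<bar>?t n\<bar>)"
    by (rule summable_comparison_test'[OF sm, of 0]) (use term_le in simp)
  have "\<bar>\<Sum>n. ?t n\<bar> \<le> (\<Sum>n. \<bar>?t n\<bar>)" by (rule summable_rabs[OF st])
  also have "\<dots> \<le> decoupling_error C m \<delta>"
    unfolding decoupling_error_def by (rule suminf_le[OF term_le st sm])
  finally show ?thesis using diff by (simp add: sums_iff)
qed

section \<open>The Borel field of line ensembles\<close>

lemma continuous_on_line:
  assumes f: "f \<in> line_space" and i: "1 \<le> i"
  shows "continuous_on S (\<lambda>t. f (i, t))"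
proof -
  have "continuous_on line_domain f" using f by (simp add: line_space_def)
  then show ?thesis
    by (rule continuous_on_compose2) (use i in \<open>auto simp: line_domain_def intro!: continuous_intros\<close>)
qed

text \<open>A basic neighbourhood of a constant function with respect to a single point prescribes a ball
  for the value at that point.\<close>

lemma borel_measurable_evaluation:
  assumes p: "p \<in> line_domain"
  shows "(\<lambda>f. f p) \<in> borel_measurable line_borel"
proof (rule borel_measurableI)
  fix U :: "real set" assume U: "open U"
  define const where "const c = (\<lambda>q\<in>line_domain. c)" for c :: real
  have const: "const c \<in> line_space" for c
  proof -
    have "continuous_on line_domain (const c)"
      by (rule continuous_on_cong[THEN iffD1, OF refl _ continuous_on_const[of _ c]]) (simp add: const_def)
    then show ?thesis by (simp add: line_space_def const_def)
  qed
  let ?F = "{compact_nbhd (const c) {p} \<epsilon> | c \<epsilon>. 0 < \<epsilon> \<and> ball c \<epsilon> \<subseteq> U}"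
  have "(\<lambda>f. f p) -` U \<inter> space line_borel = \<Union>?F"
  proof (intro Set.equalityI subsetI)
    fix f assume f: "f \<in> (\<lambda>f. f p) -` U \<inter> space line_borel"
    then obtain \<epsilon> where \<epsilon>: "0 < \<epsilon>" "ball (f p) \<epsilon> \<subseteq> U"
      using U by (auto simp: open_contains_ball)
    have "f \<in> compact_nbhd (const (f p)) {p} \<epsilon>"
      using f p \<epsilon> by (simp add: compact_nbhd_def const_def)
    then show "f \<in> \<Union>?F" using \<epsilon> by blast
  next
    fix f assume "f \<in> \<Union>?F"
    then obtain c \<epsilon> where "ball c \<epsilon> \<subseteq> U" "f \<in> compact_nbhd (const c) {p} \<epsilon>" by blast
    then show "f \<in> (\<lambda>f. f p) -` U \<inter> space line_borel"
      using p by (auto simp: compact_nbhd_def const_def dist_commute subset_eq)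
  qed
  moreover have "openin line_topology (\<Union>?F)"
  proof (rule openin_Union)
    fix V assume "V \<in> ?F"
    then obtain c \<epsilon> where V: "V = compact_nbhd (const c) {p} \<epsilon>" "0 < \<epsilon>" by blast
    show "openin line_topology V"
      unfolding line_topology_def V
      by (intro topology_generated_by_Basis CollectI exI[of _ "const c"] exI[of _ "{p}"] exI[of _ \<epsilon>])
        (use const[of c] V(2) p in auto)
  qed
  ultimately show "(\<lambda>f. f p) -` U \<inter> space line_borel \<in> sets line_borel"
    by (simp add: sets_line_borel sigma_sets.Basic)
qed

definition half_spaces :: "(nat \<times> real \<Rightarrow> real) set set" where
  "half_spaces = {{f \<in> line_space. a < f p} | p a. p \<in> line_domain}"

lemma half_spaces_subset: "half_spaces \<subseteq> Pow line_space"
  by (auto simp: half_spaces_def)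

text \<open>A countable family of basic sets: a list entry \<open>(i, p, q, a, b)\<close> confines line \<open>i + 1\<close> to
  the interval \<open>(a, b)\<close> during \<open>[p, q]\<close>. This is a base of the compact-open topology.\<close>

definition tube :: "(nat \<times> rat \<times> rat \<times> rat \<times> rat) list \<Rightarrow> (nat \<times> real \<Rightarrow> real) set" where
  "tube l = {h \<in> line_space. \<forall>(i, p, q, a, b)\<in>set l. \<forall>t\<in>{of_rat p..of_rat q}.
     of_rat a < h (Suc i, t) \<and> h (Suc i, t) < of_rat b}"

lemma tube_append: "tube (l @ l') = tube l \<inter> tube l'"
  unfolding tube_def set_append ball_Un by blast

text \<open>By compactness of \<open>[p, q]\<close> a confined function keeps a positive distance from the boundary, and by
  continuity closed bounds need checking at rational times only. The clamp \<open>max p (min q r)\<close> lets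
  \<open>r\<close> range over all rationals, so that the degenerate interval \<open>p = q\<close> needs no separate treatment.\<close>

lemma confined_iff_rational:
  fixes g :: "real \<Rightarrow> real"
  assumes g: "continuous_on UNIV g" and pq: "p \<le> q"
  shows "(\<forall>t\<in>{p..q}. a < g t \<and> g t < b) \<longleftrightarrow>
    (\<exists>n::nat. \<forall>r::rat. a + 1 / Suc n \<le> g (max p (min q (of_rat r))) \<and>
        g (max p (min q (of_rat r))) \<le> b - 1 / Suc n)"
    (is "?L \<longleftrightarrow> (\<exists>n. \<forall>r. ?R n r)")
proof
  assume L: ?L
  have cg: "continuous_on {p..q} g" using g continuous_on_subset by blast
  obtain u where u: "u \<in> {p..q}" "\<And>t. t \<in> {p..q} \<Longrightarrow> g t \<le> g u"
    using continuous_attains_sup[of "{p..q}" g] cg pq by auto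
  obtain v where v: "v \<in> {p..q}" "\<And>t. t \<in> {p..q} \<Longrightarrow> g v \<le> g t"
    using continuous_attains_inf[of "{p..q}" g] cg pq by auto
  have "0 < min (b - g u) (g v - a)" using L u v by auto
  from reals_Archimedean[OF this] obtain n where n: "1 / real (Suc n) < min (b - g u) (g v - a)"
    unfolding inverse_eq_divide by blast
  have "?R n r" for r
  proof -
    have "max p (min q (real_of_rat r)) \<in> {p..q}" using pq by auto
    from u(2)[OF this] v(2)[OF this] show ?thesis using n by linarith
  qed
  then show "\<exists>n. \<forall>r. ?R n r" by blast
next
  assume "\<exists>n. \<forall>r. ?R n r"
  then obtain n where n: "\<And>r. ?R n r" by blast
  let ?g = "\<lambda>t. g (max p (min q t))"
  have cont: "continuous_on UNIV ?g"
    by (rule continuous_on_compose2[OF g]) (auto intro!: continuous_intros)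
  have "closed (?g -` {a + 1 / Suc n..b - 1 / Suc n})"
    using closed_vimage[OF closed_atLeastAtMost cont] .
  moreover have "\<rat> \<subseteq> ?g -` {a + 1 / Suc n..b - 1 / Suc n}"
    using n by (auto elim!: Rats_cases)
  ultimately have "closure \<rat> \<subseteq> ?g -` {a + 1 / Suc n..b - 1 / Suc n}"
    by (rule closure_minimal[rotated])
  then have all: "?g t \<in> {a + 1 / Suc n..b - 1 / Suc n}" for t
    by (auto simp: Rats_closure_real)
  show ?L
  proof
    fix t assume "t \<in> {p..q}"
    then have t: "max p (min q t) = t" by auto
    have "0 < 1 / real (Suc n)" by simp
    then show "a < g t \<and> g t < b" using all[of t] unfolding t atLeastAtMost_iff by linarith
  qed
qed

lemma tube_in_sigma_sets: "tube l \<in> sigma_sets line_space half_spaces"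
proof -
  define N where "N = sigma line_space half_spaces"
  have sN: "sets N = sigma_sets line_space half_spaces" and spN [simp]: "space N = line_space"
    unfolding N_def using half_spaces_subset by (simp_all add: sets_measure_of space_measure_of)
  have ev [measurable]: "(\<lambda>f. f p) \<in> borel_measurable N" if p: "p \<in> line_domain" for p
  proof (subst borel_measurable_iff_greater, intro allI)
    fix a
    show "{w \<in> space N. a < w p} \<in> sets N"
      unfolding sN spN half_spaces_def by (rule sigma_sets.Basic) (use p in blast)
  qed
  have one: "{h \<in> line_space. \<forall>t\<in>{p..q}. a < h (Suc i, t) \<and> h (Suc i, t) < b} \<in> sets N"
    for i and p q a b :: real
  proof (cases "p \<le> q")
    case False
    then have "{h \<in> line_space. \<forall>t\<in>{p..q}. a < h (Suc i, t) \<and> h (Suc i, t) < b} = space N" by auto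
    then show ?thesis by (simp only: sets.top)
  next
    case True
    have "{h \<in> line_space. \<forall>t\<in>{p..q}. a < h (Suc i, t) \<and> h (Suc i, t) < b}
      = {h \<in> space N. \<exists>n::nat. \<forall>r::rat. a + 1 / Suc n \<le> h (Suc i, max p (min q (of_rat r))) \<and>
        h (Suc i, max p (min q (of_rat r))) \<le> b - 1 / Suc n}"
      unfolding spN
      by (intro Collect_cong conj_cong refl confined_iff_rational[OF continuous_on_line True]) auto
    also have "\<dots> \<in> sets N"
    proof -
      have [measurable]: "(\<lambda>h. h (Suc i, max p (min q (real_of_rat r)))) \<in> borel_measurable N" for r
        by (rule ev) (simp add: line_domain_def)
      show ?thesis by measurable
    qed
    finally show ?thesis .
  qed
  have "tube l \<in> sets N"
  proof (induction l)
    case Nil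
    have "tube [] = space N" by (simp add: tube_def)
    then show ?case by (simp only: sets.top)
  next
    case (Cons x l)
    obtain i p q a b where x: "x = (i, p, q, a, b)" by (cases x)
    have "tube (x # l) = {h \<in> line_space. \<forall>t\<in>{of_rat p..of_rat q}.
        of_rat a < h (Suc i, t) \<and> h (Suc i, t) < of_rat b} \<inter> tube l"
      by (auto simp: tube_def x)
    then show ?case using one Cons by auto
  qed
  then show ?thesis by (simp add: sN)
qed

text \<open>By compactness \<open>f\<close> stays within \<open>\<epsilon> - \<delta>\<close> of \<open>f0\<close> on \<open>K\<close> for some \<open>\<delta> > 0\<close>, and finitely many cells
  cover \<open>K\<close> on each of which \<open>f\<close> is confined to a rational interval of length less than \<open>\<delta>\<close>. A function
  confined to the same intervals is within \<open>\<delta>\<close> of \<open>f\<close> on \<open>K\<close>.\<close>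

lemma tube_inside_compact_nbhd:
  assumes f: "f \<in> compact_nbhd f0 K \<epsilon>" and f0: "f0 \<in> line_space" and K: "compact K" "K \<subseteq> line_domain"
  shows "\<exists>l. f \<in> tube l \<and> tube l \<subseteq> compact_nbhd f0 K \<epsilon>"
proof -
  have fl: "f \<in> line_space" and fK: "\<And>p. p \<in> K \<Longrightarrow> dist (f p) (f0 p) < \<epsilon>"
    using f by (auto simp: compact_nbhd_def)
  have cf: "continuous_on K f" "continuous_on K f0"
    using fl f0 K(2) by (auto simp: line_space_def intro: continuous_on_subset)
  obtain \<delta> where \<delta>: "0 < \<delta>" "\<And>p. p \<in> K \<Longrightarrow> dist (f p) (f0 p) + \<delta> \<le> \<epsilon>"
  proof (cases "K = {}")
    case True
    show ?thesis by (rule that[of 1]) (use True in auto)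
  next
    case False
    have "continuous_on K (\<lambda>p. dist (f p) (f0 p))" by (intro continuous_intros cf)
    then obtain p where p: "p \<in> K" "\<And>q. q \<in> K \<Longrightarrow> dist (f q) (f0 q) \<le> dist (f p) (f0 p)"
      using continuous_attains_sup[OF K(1) False] by blast
    show ?thesis by (rule that[of "\<epsilon> - dist (f p) (f0 p)"]) (use p fK[OF p(1)] in auto)
  qed
  define good where "good x = (case x of (i, p, q, a, b) \<Rightarrow>
    (\<forall>t\<in>{of_rat p..of_rat q}. of_rat a < f (Suc i, t) \<and> f (Suc i, t) < of_rat b) \<and>
    real_of_rat b - of_rat a < \<delta>)" for x :: "nat \<times> rat \<times> rat \<times> rat \<times> rat"
  define cell where "cell x = (case x of (i, p, q, a, b) \<Rightarrow> {Suc i} \<times> {real_of_rat p<..<of_rat q})"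
    for x :: "nat \<times> rat \<times> rat \<times> rat \<times> rat"
  have cover: "\<exists>x. good x \<and> z \<in> cell x" if z: "z \<in> K" for z
  proof -
    obtain i t where it: "z = (Suc i, t)"
    proof -
      obtain j t where "z = (j, t)" by (cases z)
      moreover have "1 \<le> j" using z K(2) calculation by (auto simp: line_domain_def)
      ultimately show ?thesis using that[of "j - 1" t] by simp
    qed
    have "isCont (\<lambda>s. f (Suc i, s)) t"
      using continuous_on_line[OF fl, of "Suc i" UNIV] by (simp add: continuous_on_eq_continuous_at)
    then obtain d where d: "0 < d" "\<And>s. dist s t < d \<Longrightarrow> dist (f (Suc i, s)) (f (Suc i, t)) < \<delta> / 4"
      using \<delta>(1) unfolding continuous_at_eps_delta by (metis divide_pos_pos zero_less_numeral)
    obtain p where p: "t - d < of_rat p" "real_of_rat p < t" using of_rat_dense[of "t - d" t] d by auto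
    obtain q where q: "t < of_rat q" "real_of_rat q < t + d" using of_rat_dense[of t "t + d"] d by auto
    obtain a where a: "f (Suc i, t) - \<delta> / 2 < of_rat a" "real_of_rat a < f (Suc i, t) - \<delta> / 4"
      using of_rat_dense[of "f (Suc i, t) - \<delta> / 2" "f (Suc i, t) - \<delta> / 4"] \<delta>(1) by auto
    obtain b where b: "f (Suc i, t) + \<delta> / 4 < of_rat b" "real_of_rat b < f (Suc i, t) + \<delta> / 2"
      using of_rat_dense[of "f (Suc i, t) + \<delta> / 4" "f (Suc i, t) + \<delta> / 2"] \<delta>(1) by auto
    have "of_rat a < f (Suc i, s) \<and> f (Suc i, s) < of_rat b" if "s \<in> {of_rat p..of_rat q}" for s
    proof -
      have "dist s t < d" using that p q by (auto simp: dist_real_def)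
      from d(2)[OF this] have "\<bar>f (Suc i, s) - f (Suc i, t)\<bar> < \<delta> / 4" by (simp only: dist_real_def)
      then show ?thesis using a b by linarith
    qed
    moreover have "real_of_rat b - of_rat a < \<delta>" using a b by simp
    ultimately have "good (i, p, q, a, b)" by (simp add: good_def)
    moreover have "z \<in> cell (i, p, q, a, b)" using p q by (simp add: cell_def it)
    ultimately show ?thesis by blast
  qed
  have "K \<subseteq> \<Union>(cell ` {x. good x})" using cover by blast
  moreover have "open (cell x)" for x
    unfolding cell_def
    by (cases x) (simp add: open_Times Topological_Spaces.open_discrete[of "{Suc _}"])
  ultimately obtain X where X: "X \<subseteq> {x. good x}" "finite X" "K \<subseteq> \<Union>(cell ` X)"
    using compactE_image[OF K(1), of "{x. good x}" cell] by metis
  obtain l where l: "set l = X" using finite_list[OF X(2)] by blast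
  have "f \<in> tube l"
    using fl X(1) by (auto simp: tube_def l good_def)
  moreover have "tube l \<subseteq> compact_nbhd f0 K \<epsilon>"
  proof
    fix h assume h: "h \<in> tube l"
    have "dist (h z) (f0 z) < \<epsilon>" if z: "z \<in> K" for z
    proof -
      obtain x where x: "x \<in> X" "z \<in> cell x" using X(3) z by blast
      obtain i p q a b where xe: "x = (i, p, q, a, b)" by (cases x)
      obtain t where t: "z = (Suc i, t)" "t \<in> {of_rat p..of_rat q}"
        using x(2) by (auto simp: cell_def xe)
      have "of_rat a < h z" "h z < of_rat b"
        using h x(1) t by (auto simp: tube_def l xe)
      moreover have "of_rat a < f z" "f z < of_rat b" "real_of_rat b - of_rat a < \<delta>"
        using X(1) x(1) t by (auto simp: good_def xe)
      ultimately have "dist (h z) (f z) < \<delta>" by (simp add: dist_real_def abs_less_iff)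
      then show ?thesis using \<delta>(2)[OF z] dist_triangle[of "h z" "f0 z" "f z"] by linarith
    qed
    then show "h \<in> compact_nbhd f0 K \<epsilon>" using h by (auto simp: compact_nbhd_def tube_def)
  qed
  ultimately show ?thesis by blast
qed

lemma open_contains_tube:
  assumes "openin line_topology U" "f \<in> U"
  shows "\<exists>l. f \<in> tube l \<and> tube l \<subseteq> U"
proof -
  let ?N = "{compact_nbhd f K \<epsilon> | f K \<epsilon>. f \<in> line_space \<and> compact K \<and> K \<subseteq> line_domain \<and> 0 < \<epsilon>}"
  have "generate_topology_on ?N U"
    using assms(1) by (simp add: line_topology_def openin_topology_generated_by_iff)
  then show ?thesis using assms(2)
  proof (induction arbitrary: f)
    case Empty
    then show ?case by simp
  next
    case (Int a b)
    then obtain l l' where "f \<in> tube l" "tube l \<subseteq> a" "f \<in> tube l'" "tube l' \<subseteq> b" by blast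
    then have "f \<in> tube (l @ l') \<and> tube (l @ l') \<subseteq> a \<inter> b" unfolding tube_append by blast
    then show ?case by blast
  next
    case (UN k)
    then show ?case by blast
  next
    case (Basis s)
    then show ?case using tube_inside_compact_nbhd by blast
  qed
qed

text \<open>An open set is the union of the countably many tubes inside it, and tubes are determined by
  countably many evaluations. So the Borel field of uniform convergence on compact sets is generated
  by the evaluations.\<close>

lemma sets_line_borel_half_spaces: "sets line_borel = sigma_sets line_space half_spaces"
proof (rule Set.equalityI)
  show "sigma_sets line_space half_spaces \<subseteq> sets line_borel"
  proof (rule sets.sigma_sets_subset[of _ line_borel, simplified])
    show "half_spaces \<subseteq> sets line_borel"
    proof
      fix X assume "X \<in> half_spaces"
      then obtain p a where "p \<in> line_domain" "X = {f \<in> line_space. a < f p}"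
          by (auto simp: half_spaces_def)
      then show "X \<in> sets line_borel"
        using borel_measurable_evaluation[of p] borel_measurable_iff_greater[of "\<lambda>f. f p" line_borel]
            by auto
    qed
  qed
  have "U \<in> sigma_sets line_space half_spaces" if U: "openin line_topology U" for U
  proof -
    have "U = (\<Union>l\<in>{l. tube l \<subseteq> U}. tube l)"
      using open_contains_tube[OF U] by blast
    moreover have "(\<Union>l\<in>{l. tube l \<subseteq> U}. tube l) \<in> sigma_sets line_space half_spaces"
      by (rule sigma_sets_UNION) (auto intro: tube_in_sigma_sets countable_image countableI_type)
    ultimately show ?thesis by simp
  qed
  then show "sets line_borel \<subseteq> sigma_sets line_space half_spaces"
    unfolding sets_line_borel by (intro sigma_sets_mono) auto
qed

lemma measurable_horizontal_shift: "horizontal_shift s \<in> measurable line_borel line_borel"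
proof (rule measurable_sigma_sets[OF sets_line_borel_half_spaces half_spaces_subset])
  show "horizontal_shift s \<in> space line_borel \<rightarrow> line_space"
    by (simp add: horizontal_shift_in_line_space)
  fix X assume "X \<in> half_spaces"
  then obtain i t a where p: "1 \<le> i" and X: "X = {f \<in> line_space. a < f (i, t)}"
    by (auto simp: half_spaces_def line_domain_def)
  have "horizontal_shift s -` X \<inter> space line_borel = {f \<in> line_space. a < f (i, t + s)}"
    using horizontal_shift_in_line_space by (auto simp: X horizontal_shift_def)
  then show "horizontal_shift s -` X \<inter> space line_borel \<in> sets line_borel"
    unfolding sets_line_borel_half_spaces
    using p by (auto simp: half_spaces_def line_domain_def intro!: sigma_sets.Basic)
qed

text \<open>Windows are the sets whose void probabilities are considered: bounded, and carried by finitely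
  many times.\<close>

definition window :: "(real \<times> real) set \<Rightarrow> bool" where
  "window D \<longleftrightarrow> finite (fst ` D) \<and> bounded (snd ` D) \<and> (\<forall>t. {x. (t, x) \<in> D} \<in> sets borel)"

definition void_event :: "(real \<times> real) set \<Rightarrow> (nat \<times> real \<Rightarrow> real) set" where
  "void_event D = {f \<in> line_space. \<forall>i\<ge>1. \<forall>t. (t, f (i, t)) \<notin> D}"

text \<open>The Airy lines lie in this set almost surely, and it is invariant under shifts.\<close>

definition ordered_lines :: "(nat \<times> real \<Rightarrow> real) set" where
  "ordered_lines = {f \<in> line_space. \<forall>t. \<forall>i\<ge>1. f (i, t) > f (i + 1, t)}"

lemma ordered_lines_less:
  assumes f: "f \<in> ordered_lines" and i: "1 \<le> i"
  shows "f (i + Suc k, t) < f (i, t)"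
proof (induction k)
  case 0
  then show ?case using f i by (simp add: ordered_lines_def)
next
  case (Suc k)
  have "f (i + Suc k + 1, t) < f (i + Suc k, t)" using f i by (simp add: ordered_lines_def)
  then show ?case using Suc by simp
qed

lemma ordered_lines_less_iff:
  assumes f: "f \<in> ordered_lines" and ij: "1 \<le> i" "1 \<le> j"
  shows "f (j, t) < f (i, t) \<longleftrightarrow> i < j"
proof -
  have less: "f (b, t) < f (a, t)" if "1 \<le> a" "a < b" for a b
    using ordered_lines_less[OF f that(1), of "b - a - 1" t] that by simp
  show ?thesis using less[of i j] less[of j i] ij by (cases i j rule: linorder_cases) auto
qed

lemma window_strip: "window ({t} \<times> {a<..b})"
proof -
  have "{x. (s, x) \<in> {t} \<times> {a<..b}} = (if s = t then {a<..b} else {})" for s by auto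
  then show ?thesis
    by (cases "{a<..b} = {}") (auto simp: window_def fst_image_times snd_image_times)
qed

lemma window_Un: "window D1 \<Longrightarrow> window D2 \<Longrightarrow> window (D1 \<union> D2)"
  by (auto simp: window_def image_Un Collect_disj_eq)

lemma void_event_Int: "void_event D1 \<inter> void_event D2 = void_event (D1 \<union> D2)"
  by (auto simp: void_event_def)

text \<open>The first line is above \<open>a\<close> iff some line passes through \<open>{t} \<times> {a<..a + n}\<close> for some \<open>n\<close>. In the
  induction step, a line that passes through \<open>{t} \<times> {a<..r}\<close> while line \<open>i\<close> is above \<open>r\<close> has an index
  larger than \<open>i\<close>, hence lies on or below line \<open>i + 1\<close>.\<close>

lemma half_space_from_void_events:
  assumes i: "1 \<le> i"
  shows "\<exists>A'\<in>sigma_sets line_space (void_event ` Collect window).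
    \<forall>f\<in>ordered_lines. a < f (i, t) \<longleftrightarrow> f \<in> A'"
  using i
proof (induction i arbitrary: a rule: dec_induct)
  case base
  let ?V = "\<lambda>n::nat. line_space - void_event ({t} \<times> {a<..a + real n})"
  have "(\<Union>n. ?V n) \<in> sigma_sets line_space (void_event ` Collect window)"
    by (intro sigma_sets.Union sigma_sets.Compl sigma_sets.Basic) (auto intro: window_strip)
  moreover have "a < f (1, t) \<longleftrightarrow> f \<in> (\<Union>n. ?V n)" if f: "f \<in> ordered_lines" for f
  proof
    assume "a < f (1, t)"
    moreover obtain n :: nat where "f (1, t) - a \<le> real n" using real_arch_simple by blast
    ultimately have "f \<in> ?V n" using f by (auto simp: void_event_def ordered_lines_def intro!: exI[of _ 1])
    then show "f \<in> (\<Union>n. ?V n)" by blast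
  next
    assume "f \<in> (\<Union>n. ?V n)"
    then obtain j where j: "1 \<le> j" "a < f (j, t)" by (auto simp: void_event_def)
    have "f (j, t) \<le> f (1, t)" using ordered_lines_less_iff[OF f j(1), of 1 t] j(1) by simp
    then show "a < f (1, t)" using j by simp
  qed
  ultimately show ?case by blast
next
  case (step i)
  let ?G = "sigma_sets line_space (void_event ` Collect window)"
  obtain A where A: "\<And>b. A b \<in> ?G" "\<And>b f. f \<in> ordered_lines \<Longrightarrow> b < f (i, t) \<longleftrightarrow> f \<in> A b"
    using step.IH by metis
  let ?V = "\<lambda>r::rat. if a < of_rat r then A (of_rat r) \<inter> (line_space
      - void_event ({t} \<times> {a<..of_rat r})) else {}"
  have sub: "void_event ` Collect window \<subseteq> Pow line_space" by (auto simp: void_event_def)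
  interpret G: sigma_algebra line_space ?G by (rule sigma_algebra_sigma_sets[OF sub])
  have V: "?V r \<in> ?G" for r
  proof (cases "a < of_rat r")
    case True
    have "line_space - void_event ({t} \<times> {a<..of_rat r}) \<in> ?G"
      by (intro sigma_sets.Compl sigma_sets.Basic) (auto intro: window_strip)
    then show ?thesis using True A(1) by (simp add: G.Int)
  qed (simp add: sigma_sets.Empty)
  have "(\<Union>r. ?V r) \<in> ?G" by (rule G.countable_UN[OF image_subsetI]) (rule V)
  moreover have "a < f (Suc i, t) \<longleftrightarrow> f \<in> (\<Union>r. ?V r)" if f: "f \<in> ordered_lines" for f
  proof
    assume a: "a < f (Suc i, t)"
    have "f (Suc i, t) < f (i, t)" using ordered_lines_less_iff[OF f, of i "Suc i" t] step by simp
    then obtain r where r: "f (Suc i, t) < of_rat r" "of_rat r < f (i, t)" using of_rat_dense by blast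
    then have "f \<in> ?V r"
      using a f A(2)[OF f, of "of_rat r"] by (auto simp: void_event_def ordered_lines_def intro!:
          exI[of _ "Suc i"])
    then show "f \<in> (\<Union>r. ?V r)" by blast
  next
    assume "f \<in> (\<Union>r. ?V r)"
    then obtain r where r: "a < of_rat r" "f \<in> A (of_rat r)" "f \<notin> void_event ({t} \<times> {a<..of_rat r})"
        "f \<in> line_space"
      by (auto split: if_splits)
    then obtain j where j: "1 \<le> j" "a < f (j, t)" "f (j, t) \<le> of_rat r" by (auto simp: void_event_def)
    have "of_rat r < f (i, t)" using r(2) A(2)[OF f] by simp
    then have "f (j, t) < f (i, t)" using j(3) by linarith
    then have "i < j" using ordered_lines_less_iff[OF f, of i j t] j step by simp
    then have "f (j, t) \<le> f (Suc i, t)" using ordered_lines_less_iff[OF f j(1), of "Suc i" t] by force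
    then show "a < f (Suc i, t)" using j by simp
  qed
  ultimately show ?case by blast
qed

text \<open>The sets that agree on ordered families with a member of a fixed \<open>\<sigma>\<close>-field form a \<open>\<sigma>\<close>-field.\<close>

lemma borel_from_void_events:
  assumes "A \<in> sets line_borel"
  shows "\<exists>A'\<in>sigma_sets line_space (void_event ` Collect window).
    \<forall>f\<in>ordered_lines. f \<in> A \<longleftrightarrow> f \<in> A'"
  using assms unfolding sets_line_borel_half_spaces
proof (induction rule: sigma_sets.induct)
  case (Basic X)
  then obtain i t a where i: "1 \<le> i" and X: "X = {f \<in> line_space. a < f (i, t)}"
    by (auto simp: half_spaces_def line_domain_def)
  show ?case using half_space_from_void_events[OF i, of a t] by (auto simp: X ordered_lines_def)
next
  case Empty
  show ?case by (intro bexI[of _ "{}"] sigma_sets.Empty) auto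
next
  case (Compl X)
  then obtain X' where "X' \<in> sigma_sets line_space (void_event ` Collect window)"
    "\<forall>f\<in>ordered_lines. f \<in> X \<longleftrightarrow> f \<in> X'" by blast
  then show ?case
    by (intro bexI[of _ "line_space - X'"] sigma_sets.Compl) (auto simp: ordered_lines_def)
next
  case (Union X)
  then have "\<forall>n. \<exists>A'\<in>sigma_sets line_space (void_event ` Collect window).
    \<forall>f\<in>ordered_lines. f \<in> X n \<longleftrightarrow> f \<in> A'" by blast
  then obtain X' where "\<And>n. X' n \<in> sigma_sets line_space (void_event ` Collect window)"
    "\<And>n f. f \<in> ordered_lines \<Longrightarrow> f \<in> X n \<longleftrightarrow> f \<in> X' n" by metis
  then show ?case by (intro bexI[of _ "\<Union>n. X' n"] sigma_sets.Union) auto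
qed

section \<open>The Airy line ensemble seen through finitely many times\<close>

lemma distr_PiM_componentwise:
  assumes \<mu>: "sigma_finite_measure \<mu>" and \<nu>: "sigma_finite_measure \<nu>"
    and \<phi>: "\<phi> \<in> measurable \<mu> \<nu>" and distr: "distr \<mu> \<nu> \<phi> = \<nu>"
  shows "distr (PiM {..<n} (\<lambda>_. \<mu>)) (PiM {..<n} (\<lambda>_. \<nu>)) (\<lambda>z. \<lambda>i\<in>{..<n::nat}. \<phi> (z i)) = PiM {..<n} (\<lambda>_. \<nu>)"
proof -
  interpret \<mu>: product_sigma_finite "\<lambda>_::nat. \<mu>" by (simp add: product_sigma_finite_def \<mu>)
  interpret \<nu>: product_sigma_finite "\<lambda>_::nat. \<nu>" by (simp add: product_sigma_finite_def \<nu>)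
  let ?\<Phi> = "\<lambda>z. \<lambda>i\<in>{..<n}. \<phi> (z i)"
  have meas: "?\<Phi> \<in> measurable (PiM {..<n} (\<lambda>_. \<mu>)) (PiM {..<n} (\<lambda>_. \<nu>))"
    by (intro measurable_restrict measurable_compose[where N = \<mu>, OF _ \<phi>] measurable_component_singleton)
  show ?thesis
  proof (rule \<nu>.PiM_eqI)
    fix A assume A: "\<And>i. i \<in> {..<n} \<Longrightarrow> A i \<in> sets \<nu>"
    have pre: "?\<Phi> -` PiE {..<n} A \<inter> space (PiM {..<n} (\<lambda>_. \<mu>)) = PiE {..<n} (\<lambda>i. \<phi> -` A i \<inter> space \<mu>)"
      by (auto simp: space_PiM PiE_iff)
    have "emeasure (distr (PiM {..<n} (\<lambda>_. \<mu>)) (PiM {..<n} (\<lambda>_. \<nu>)) ?\<Phi>) (PiE {..<n} A)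
      = emeasure (PiM {..<n} (\<lambda>_. \<mu>)) (PiE {..<n} (\<lambda>i. \<phi> -` A i \<inter> space \<mu>))"
      using A by (subst emeasure_distr[OF meas]) (auto simp: pre)
    also have "\<dots> = (\<Prod>i<n. emeasure \<mu> (\<phi> -` A i \<inter> space \<mu>))"
      using A \<phi> by (intro \<mu>.emeasure_PiM) (auto intro: measurable_sets)
    also have "\<dots> = (\<Prod>i<n. emeasure \<nu> (A i))"
    proof (rule prod.cong[OF refl])
      fix i assume "i \<in> {..<n}"
      then have "emeasure (distr \<mu> \<nu> \<phi>) (A i) = emeasure \<mu> (\<phi> -` A i \<inter> space \<mu>)"
        by (rule emeasure_distr[OF \<phi> A])
      then show "emeasure \<mu> (\<phi> -` A i \<inter> space \<mu>) = emeasure \<nu> (A i)" by (simp add: distr)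
    qed
    finally show "emeasure (distr (PiM {..<n} (\<lambda>_. \<mu>)) (PiM {..<n} (\<lambda>_. \<nu>)) ?\<Phi>) (PiE {..<n} A)
      = (\<Prod>i\<in>{..<n}. emeasure \<nu> (A i))" .
  qed auto
qed

text \<open>Moment integrals depend on the measure space only up to isomorphisms that preserve the kernel.
  This gives the stationarity of the void probabilities.\<close>

lemma moment_integral_transport:
  assumes \<mu>: "sigma_finite_measure \<mu>" and \<nu>: "correlation_kernel \<nu> K"
    and \<phi>: "\<phi> \<in> measurable \<mu> \<nu>" "distr \<mu> \<nu> \<phi> = \<nu>"
    and K: "\<And>p q. K (\<phi> p) (\<phi> q) = K p q" and D: "D \<in> sets \<nu>"
  shows "moment_integral \<nu> K n ({..<n} \<rightarrow>\<^sub>E D) = moment_integral \<mu> K n ({..<n} \<rightarrow>\<^sub>E (\<phi> -` D \<inter> space \<mu>))"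
proof -
  interpret \<nu>: correlation_kernel \<nu> K by fact
  let ?\<Phi> = "\<lambda>z. \<lambda>i\<in>{..<n}. \<phi> (z i)"
  let ?M = "PiM {..<n} (\<lambda>_. \<mu>)" and ?N = "PiM {..<n} (\<lambda>_. \<nu>)"
  have meas: "?\<Phi> \<in> measurable ?M ?N"
    by (intro measurable_restrict measurable_compose[where N = \<mu>, OF _ \<phi>(1)] measurable_component_singleton)
  have "{..<n} \<rightarrow>\<^sub>E D \<in> sets ?N" using D by (intro sets_PiM_I_finite) auto
  then have fm: "(\<lambda>z. indicator ({..<n} \<rightarrow>\<^sub>E D) z * correlation_det K n z) \<in> borel_measurable ?N"
    by measurable
  have "moment_integral \<nu> K n ({..<n} \<rightarrow>\<^sub>E D)
    = (LINT z|distr ?M ?N ?\<Phi>. indicator ({..<n} \<rightarrow>\<^sub>E D) z * correlation_det K n z)"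
    unfolding moment_integral_def
    by (subst distr_PiM_componentwise[OF \<mu> \<nu>.sigma_finite_measure_axioms \<phi>]) (rule refl)
  also have "\<dots> = (LINT z|?M. indicator ({..<n} \<rightarrow>\<^sub>E D) (?\<Phi> z) * correlation_det K n (?\<Phi> z))"
    by (rule integral_distr[OF meas fm])
  also have "\<dots> = moment_integral \<mu> K n ({..<n} \<rightarrow>\<^sub>E (\<phi> -` D \<inter> space \<mu>))"
    unfolding moment_integral_def
  proof (rule Bochner_Integration.integral_cong[OF refl])
    fix z assume z: "z \<in> space ?M"
    have "correlation_det K n (?\<Phi> z) = correlation_det K n z"
      unfolding correlation_det_def
      by (intro arg_cong[where f = Determinant.det] eq_matI) (auto simp: K)
    moreover have "?\<Phi> z \<in> {..<n} \<rightarrow>\<^sub>E D \<longleftrightarrow> z \<in> {..<n} \<rightarrow>\<^sub>E (\<phi> -` D \<inter> space \<mu>)"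
      using z by (auto simp: space_PiM PiE_iff)
    ultimately show "indicator ({..<n} \<rightarrow>\<^sub>E D) (?\<Phi> z) * correlation_det K n (?\<Phi> z)
      = indicator ({..<n} \<rightarrow>\<^sub>E (\<phi> -` D \<inter> space \<mu>)) z * correlation_det K n z"
      unfolding indicator_def by simp
  qed
  finally show ?thesis .
qed


abbreviation slices :: "real set \<Rightarrow> (real \<times> real) measure" where
  "slices I \<equiv> count_space I \<Otimes>\<^sub>M lborel"

lemma sigma_finite_slices: "finite I \<Longrightarrow> sigma_finite_measure (slices I)"
proof -
  assume I: "finite I"
  interpret A: sigma_finite_measure "count_space I" by (rule sigma_finite_measure_count_space_finite[OF I])
  interpret pair_sigma_finite "count_space I" "lborel :: real measure" ..
  show ?thesis by unfold_locales
qed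

definition time_translate :: "real \<Rightarrow> (real \<times> real) set \<Rightarrow> (real \<times> real) set" where
  "time_translate c D = (\<lambda>(t, x). (t + c, x)) ` D"

lemma time_translate_iff: "(t, x) \<in> time_translate c D \<longleftrightarrow> (t - c, x) \<in> D"
  by (force simp: time_translate_def)

lemma fst_time_translate: "fst ` time_translate c D = (\<lambda>t. t + c) ` fst ` D"
  and snd_time_translate: "snd ` time_translate c D = snd ` D"
  by (auto simp: time_translate_def image_image case_prod_unfold)

lemma window_time_translate:
  assumes "window D" shows "window (time_translate c D)"
  unfolding window_def fst_time_translate snd_time_translate time_translate_iff
  using assms unfolding window_def by blast

lemma vimage_shift_void_event:
  "horizontal_shift (- c) -` void_event D \<inter> line_space = void_event (time_translate (- c) D)"
proof (rule Set.set_eqI)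
  fix f :: "nat \<times> real \<Rightarrow> real"
  have "(\<forall>i\<ge>1. \<forall>t. (t, f (i, t - c)) \<notin> D) \<longleftrightarrow> (\<forall>i\<ge>1. \<forall>t. (t + c, f (i, t)) \<notin> D)"
  proof (intro iffI allI impI)
    fix i :: nat and t :: real
    assume *: "\<forall>i\<ge>1. \<forall>t. (t, f (i, t - c)) \<notin> D" "1 \<le> i"
    from *(1)[rule_format, OF *(2), of "t + c"] show "(t + c, f (i, t)) \<notin> D" by simp
  next
    fix i :: nat and t :: real
    assume *: "\<forall>i\<ge>1. \<forall>t. (t + c, f (i, t)) \<notin> D" "1 \<le> i"
    from *(1)[rule_format, OF *(2), of "t - c"] show "(t, f (i, t - c)) \<notin> D" by simp
  qed
  then show "f \<in> horizontal_shift (- c) -` void_event D \<inter> line_space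
      \<longleftrightarrow> f \<in> void_event (time_translate (- c) D)"
    using horizontal_shift_in_line_space[of f "- c"]
    by (auto simp: void_event_def time_translate_iff horizontal_shift_def)
qed

lemma window_in_slices:
  assumes D: "window D" and I: "finite I" "fst ` D \<subseteq> I"
  shows "D \<in> sets (slices I)"
proof -
  have "D = (\<Union>t\<in>I. {t} \<times> {x. (t, x) \<in> D})" using I(2) by force
  also have "\<dots> \<in> sets (slices I)"
    using D I(1) by (intro sets.finite_UN pair_measureI) (auto simp: window_def)
  finally show ?thesis .
qed

lemma emeasure_window_le:
  fixes m :: real
  assumes D: "window D" and I: "finite I" "fst ` D \<subseteq> I" and m: "snd ` D \<subseteq> {- m..m}" "0 \<le> m"
  shows "emeasure (slices I) D \<le> ennreal (real (card I) * (2 * m))"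
proof -
  have "D \<subseteq> I \<times> {- m..m}" using I(2) m(1) by force
  then have "emeasure (slices I) D \<le> emeasure (slices I) (I \<times> {- m..m})"
    by (intro emeasure_mono) auto
  also have "\<dots> = emeasure (count_space I) I * emeasure lborel {- m..m}"
    by (rule lborel.emeasure_pair_measure_Times) auto
  also have "\<dots> = ennreal (real (card I) * (2 * m))"
    using I(1) m(2) by (simp add: ennreal_mult ennreal_of_nat_eq_real_of_nat)
  finally show ?thesis .
qed

lemma measure_window_le:
  fixes m :: real
  assumes "window D" "finite I" "fst ` D \<subseteq> I" "snd ` D \<subseteq> {- m..m}" "0 \<le> m"
  shows "measure (slices I) D \<le> real (card I) * (2 * m)"
  unfolding measure_def
  by (rule enn2real_leI[OF _ emeasure_window_le[OF assms]]) (use assms(5) in simp)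

lemma window_bounded:
  assumes "window D" obtains m where "0 \<le> m" "snd ` D \<subseteq> {- m..m}"
proof -
  obtain b where "\<And>x. x \<in> snd ` D \<Longrightarrow> norm x \<le> b"
    using assms by (auto simp: window_def bounded_iff)
  then have "snd ` D \<subseteq> {- max 0 b..max 0 b}" by (force simp: abs_le_iff)
  then show ?thesis by (intro that[of "max 0 b"]) auto
qed

text \<open>For finitely many times the differences of distinct times are bounded away from \<open>0\<close>. The sum over
  all pairs serves as a bound for the maximum; its diagonal terms vanish, as division by \<open>0\<close>
  yields \<open>0\<close>.\<close>

lemma ext_Airy_kernel_bounded:
  assumes J: "finite J" and m: "0 \<le> m"
  obtains C where "9 \<le> C"
    "\<And>s t x y. s \<in> J \<Longrightarrow> t \<in> J \<Longrightarrow> - m \<le> x \<Longrightarrow> - m \<le> y \<Longrightarrow> \<bar>ext_Airy_kernel (s, x) (t, y)\<bar> \<le> C"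
proof
  define C where "C = 9 + 9 * (m + 2)\<^sup>2 + (\<Sum>(s, t)\<in>J \<times> J. 9 / \<bar>s - t\<bar>)"
  have S0: "0 \<le> (\<Sum>(s, t)\<in>J \<times> J. 9 / \<bar>s - t\<bar>)" by (intro sum_nonneg) auto
  then show "9 \<le> C" unfolding C_def by simp
  fix s t x y assume st: "s \<in> J" "t \<in> J" and xy: "- m \<le> x" "- m \<le> y"
  show "\<bar>ext_Airy_kernel (s, x) (t, y)\<bar> \<le> C"
  proof (cases "s = t")
    case True
    then show ?thesis
      using ext_Airy_kernel_same_time_bound[OF m xy, of t] S0 unfolding C_def True by linarith
  next
    case False
    have "9 / \<bar>s - t\<bar> \<le> (\<Sum>(s, t)\<in>J \<times> J. 9 / \<bar>s - t\<bar>)"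
      using member_le_sum[of "(s, t)" "J \<times> J" "\<lambda>(s, t). 9 / \<bar>s - t\<bar>"] st J by auto
    moreover have "0 \<le> 9 * (m + 2)\<^sup>2" by simp
    ultimately show ?thesis
      using ext_Airy_kernel_different_times_bound[OF False, of x y] unfolding C_def by linarith
  qed
qed

definition configuration :: "('w \<Rightarrow> nat \<times> real \<Rightarrow> real) \<Rightarrow> real set \<Rightarrow> 'w \<Rightarrow> (real \<times> real) set" where
  "configuration L I \<omega> = {(t, L \<omega> (i, t)) | i t. 1 \<le> i \<and> t \<in> I}"

lemma configuration_eq: "configuration L I \<omega> = (\<Union>t\<in>I. range (\<lambda>i. (t, L \<omega> (Suc i, t))))"
proof (intro Set.equalityI subsetI)
  fix p assume "p \<in> configuration L I \<omega>"
  then obtain i t where p: "p = (t, L \<omega> (i, t))" "1 \<le> i" "t \<in> I" by (auto simp: configuration_def)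
  then have "p = (t, L \<omega> (Suc (i - 1), t))" by simp
  with p(3) show "p \<in> (\<Union>t\<in>I. range (\<lambda>i. (t, L \<omega> (Suc i, t))))" by blast
qed (auto simp: configuration_def)

lemma correlation_kernel_of_determinantal:
  assumes "sigma_finite_measure \<mu>" "determinantal M S \<mu> K"
  shows "correlation_kernel \<mu> K"
proof -
  interpret sigma_finite_measure \<mu> by fact
  show ?thesis
  proof
    fix n
    show "correlation_det K n \<in> borel_measurable (PiM {..<n} (\<lambda>_. \<mu>))"
    proof (cases n)
      case 0
      then have "correlation_det K n = (\<lambda>_. 1)" by (simp add: correlation_det_def[abs_def] det_dim_zero)
      then show ?thesis by simp
    next
      case (Suc k)
      then have "1 \<le> n" by simp
      with assms(2) show ?thesis
        by (auto simp: determinantal_def correlation_function_def correlation_det_def[abs_def])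
    qed
  qed
qed

text \<open>This expresses counts through evaluations, and thereby shows that they are measurable.\<close>

lemma emeasure_count_space_injective_sequence:
  assumes "inj x"
  shows "emeasure (count_space UNIV) (range x \<inter> D) = (\<Sum>i::nat. indicator D (x i))"
proof -
  have "range x \<inter> D = (\<Union>i. {x i} \<inter> D)" by auto
  also have "emeasure (count_space UNIV) \<dots> = (\<Sum>i. emeasure (count_space UNIV) ({x i} \<inter> D))"
    using assms by (intro suminf_emeasure[symmetric]) (auto simp: disjoint_family_on_def inj_def)
  also have "\<dots> = (\<Sum>i. indicator D (x i))"
    by (intro suminf_cong) (auto simp: indicator_def)
  finally show ?thesis .
qed

text \<open>The strict ordering makes the points of one time slice distinct, so that counting the points of the
  configuration in \<open>D\<close> is the same as counting the indices of the lines that pass through \<open>D\<close>.\<close>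

lemma airy_determinantal_process:
  assumes A: "airy_line_ensemble M L" and I: "finite I" "I \<noteq> {}"
  shows "determinantal_process M (slices I) ext_Airy_kernel (configuration L I)"
proof -
  have M: "prob_space M" and L: "L \<in> measurable M line_borel"
    and ord: "AE \<omega> in M. \<forall>t. \<forall>i\<ge>1. L \<omega> (i, t) > L \<omega> (i + 1, t)"
    and det: "determinantal M (configuration L I) (slices I) ext_Airy_kernel"
    using A I by (auto simp: airy_line_ensemble_def line_ensemble_def configuration_def[abs_def])
  interpret M: prob_space M by fact
  interpret correlation_kernel "slices I" ext_Airy_kernel
    by (rule correlation_kernel_of_determinantal[OF sigma_finite_slices[OF I(1)] det])
  have ev: "(\<lambda>\<omega>. (t, L \<omega> (Suc i, t))) \<in> measurable M (slices I)" if "t \<in> I" for i t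
  proof (rule measurable_Pair)
    show "(\<lambda>\<omega>. t) \<in> measurable M (count_space I)" using that by simp
    have "(\<lambda>\<omega>. L \<omega> (Suc i, t)) \<in> borel_measurable M"
      by (rule measurable_compose[OF L borel_measurable_evaluation]) (simp add: line_domain_def)
    then show "(\<lambda>\<omega>. L \<omega> (Suc i, t)) \<in> measurable M lborel" by simp
  qed
  show ?thesis
  proof
    show "determinantal M (configuration L I) (slices I) ext_Airy_kernel" by (rule det)
    fix D assume D: "D \<in> sets (slices I)"
    have "{\<omega> \<in> space M. configuration L I \<omega> \<inter> D = {}}
      = space M - (\<Union>t\<in>I. \<Union>i. (\<lambda>\<omega>. (t, L \<omega> (Suc i, t))) -` D \<inter> space M)"
      unfolding configuration_eq by blast
    also have "\<dots> \<in> sets M"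
      using I(1) measurable_sets[OF ev D] by (intro sets.Diff sets.finite_UN sets.countable_UN) auto
    finally show "{\<omega> \<in> space M. configuration L I \<omega> \<inter> D = {}} \<in> sets M" .
    let ?c = "\<lambda>\<omega>. \<Sum>t\<in>I. \<Sum>i. indicator D (t, L \<omega> (Suc i, t)) :: ennreal"
    show "\<exists>c\<in>borel_measurable M. AE \<omega> in M. emeasure (count_space UNIV) (configuration L I \<omega> \<inter> D) = c \<omega>"
    proof (rule bexI[of _ ?c])
      have "(\<lambda>\<omega>. indicator D (t, L \<omega> (Suc i, t)) :: ennreal) \<in> borel_measurable M" if "t \<in> I" for t i
        by (rule measurable_compose[OF ev[OF that] borel_measurable_indicator[OF D]])
      then show "?c \<in> borel_measurable M" by (intro borel_measurable_sum borel_measurable_suminf_order) auto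
      show "AE \<omega> in M. emeasure (count_space UNIV) (configuration L I \<omega> \<inter> D) = ?c \<omega>"
        using ord AE_space
      proof eventually_elim
        case (elim \<omega>)
        have o: "L \<omega> \<in> ordered_lines"
          using elim measurable_space[OF L] by (simp add: ordered_lines_def)
        let ?x = "\<lambda>t i. (t, L \<omega> (Suc i, t))"
        have inj: "inj (?x t)" for t
        proof (rule injI)
          fix i j assume "?x t i = ?x t j"
          then show "i = j"
            using ordered_lines_less_iff[OF o, of "Suc i" "Suc j" t] ordered_lines_less_iff[OF o, of
                "Suc j" "Suc i" t]
            by simp
        qed
        have "configuration L I \<omega> \<inter> D = (\<Union>t\<in>I. range (?x t) \<inter> D)"
          unfolding configuration_eq by blast
        also have "emeasure (count_space UNIV) \<dots> = (\<Sum>t\<in>I. emeasure (count_space UNIV) (range (?x t) \<inter> D))"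
          using I(1) by (intro sum_emeasure[symmetric]) (auto simp: disjoint_family_on_def)
        also have "\<dots> = ?c \<omega>"
          by (simp add: emeasure_count_space_injective_sequence[OF inj])
        finally show ?case .
      qed
    qed
  qed
qed

lemma void_event_configuration:
  assumes "fst ` D \<subseteq> I" "L \<omega> \<in> line_space"
  shows "L \<omega> \<in> void_event D \<longleftrightarrow> configuration L I \<omega> \<inter> D = {}"
  using assms by (force simp: void_event_def configuration_def)

lemma void_event_measurable: assumes D: "window D" shows "void_event D \<in> sets line_borel"
proof -
  have "void_event D = space line_borel -
      (\<Union>t\<in>fst ` D. \<Union>i. (\<lambda>f. f (Suc i, t)) -` {x. (t, x) \<in> D} \<inter> space line_borel)"
  proof (intro Set.equalityI subsetI)
    fix f assume f: "f \<in> space line_borel -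
      (\<Union>t\<in>fst ` D. \<Union>i. (\<lambda>f. f (Suc i, t)) -` {x. (t, x) \<in> D} \<inter> space line_borel)"
    have "(t, f (i, t)) \<notin> D" if "1 \<le> i" for i t
    proof
      assume "(t, f (i, t)) \<in> D"
      moreover have "i = Suc (i - 1)" using that by simp
      ultimately have "t \<in> fst ` D" "(t, f (Suc (i - 1), t)) \<in> D" by force+
      then show False using f by auto
    qed
    then show "f \<in> void_event D" using f by (simp add: void_event_def)
  qed (auto simp: void_event_def)
  also have "\<dots> \<in> sets line_borel"
  proof (rule sets.Diff[OF sets.top], rule sets.finite_UN)
    show "finite (fst ` D)" using D by (simp add: window_def)
    fix t
    have "(\<lambda>f. f (Suc i, t)) -` {x. (t, x) \<in> D} \<inter> space line_borel \<in> sets line_borel" for i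
      by (rule measurable_sets[OF borel_measurable_evaluation])
        (use D in \<open>auto simp: window_def line_domain_def\<close>)
    then show "(\<Union>i. (\<lambda>f. f (Suc i, t)) -` {x. (t, x) \<in> D} \<inter> space line_borel) \<in> sets line_borel"
      by (intro sets.countable_UN) auto
  qed
  finally show ?thesis .
qed

lemma void_event_as_configuration_event:
  assumes "line_ensemble M L" "fst ` D \<subseteq> I"
  shows "{\<omega> \<in> space M. L \<omega> \<in> void_event D} = {\<omega> \<in> space M. configuration L I \<omega> \<inter> D = {}}"
  using assms measurable_space[of L M line_borel]
  by (auto simp: line_ensemble_def void_event_configuration)

lemma distr_slices_translate:
  assumes I: "finite I"
  shows "distr (slices I) (slices ((\<lambda>t. t + c) ` I)) (\<lambda>(t, x). (t + c, x)) = slices ((\<lambda>t. t + c) ` I)"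
    (is "distr ?M ?N ?\<phi> = ?N")
proof -
  have meas: "?\<phi> \<in> measurable ?M ?N"
    unfolding case_prod_unfold
  proof (rule measurable_Pair)
    show "(\<lambda>p. fst p + c) \<in> measurable ?M (count_space ((\<lambda>t. t + c) ` I))"
      by (rule measurable_compose[OF measurable_fst]) auto
    show "(\<lambda>p. snd p) \<in> measurable ?M lborel" by simp
  qed
  have "count_space ((\<lambda>t. t + c) ` I) \<Otimes>\<^sub>M (lborel :: real measure) = distr ?M ?N ?\<phi>"
  proof (rule pair_measure_eqI)
    show "sigma_finite_measure (count_space ((\<lambda>t. t + c) ` I))"
      using I by (intro sigma_finite_measure_count_space_finite) auto
    show "sigma_finite_measure (lborel :: real measure)" by (rule lborel.sigma_finite_measure_axioms)
    fix A and B :: "real set"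
    assume A: "A \<in> sets (count_space ((\<lambda>t. t + c) ` I))" and B: "B \<in> sets lborel"
    let ?A = "{t \<in> I. t + c \<in> A}"
    have img: "(\<lambda>t. t + c) ` ?A = A" using A by auto
    have "card ?A = card A"
      using card_image[of "\<lambda>t. t + c" ?A] unfolding img by (simp add: inj_on_def)
    moreover have "finite A" using A I finite_subset by auto
    ultimately have eA: "emeasure (count_space I) ?A = emeasure (count_space ((\<lambda>t. t + c) ` I)) A"
      using A I by (simp add: emeasure_count_space)
    have "emeasure (distr ?M ?N ?\<phi>) (A \<times> B) = emeasure ?M (?\<phi> -` (A \<times> B) \<inter> space ?M)"
      using A B by (intro emeasure_distr[OF meas]) auto
    also have "?\<phi> -` (A \<times> B) \<inter> space ?M = ?A \<times> B"
      by (auto simp: space_pair_measure)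
    also have "emeasure ?M (?A \<times> B) = emeasure (count_space I) ?A * emeasure lborel B"
      using B by (intro lborel.emeasure_pair_measure_Times) auto
    finally show "emeasure (count_space ((\<lambda>t. t + c) ` I)) A * emeasure lborel B =
        emeasure (distr ?M ?N ?\<phi>) (A \<times> B)"
      by (simp add: eA)
  qed simp
  then show ?thesis by simp
qed

lemma window_finite_emeasure:
  assumes "window D" "finite I" "fst ` D \<subseteq> I"
  shows "emeasure (slices I) D \<noteq> \<infinity>"
proof -
  obtain m where "0 \<le> m" "snd ` D \<subseteq> {- m..m}" using window_bounded[OF assms(1)] .
  from emeasure_window_le[OF assms this(2,1)] show ?thesis by (auto simp: top_unique)
qed

text \<open>Both void probabilities are Fredholm series of determinantal processes at different sets of times,
  and the series agree term by term because the kernel depends on the time difference only.\<close>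

lemma void_event_stationary:
  assumes A: "airy_line_ensemble M L" and D: "window D"
  shows "measure M {\<omega> \<in> space M. L \<omega> \<in> void_event (time_translate c D)}
    = measure M {\<omega> \<in> space M. L \<omega> \<in> void_event D}"
proof -
  (* The time 0 is added because the correlation functions refer to a nonempty set of times. *)
  define I where "I = insert 0 (fst ` D)"
  define I' where "I' = (\<lambda>t. t + c) ` I"
  let ?D' = "time_translate c D" and ?\<phi> = "\<lambda>(t, x :: real). (t + c, x)"
  have I: "finite I" "I \<noteq> {}" "fst ` D \<subseteq> I" using D by (auto simp: I_def window_def)
  have I': "finite I'" "I' \<noteq> {}" "fst ` ?D' \<subseteq> I'" using I by (auto simp: I'_def fst_time_translate)
  have D': "window ?D'" by (rule window_time_translate[OF D])
  interpret P: determinantal_process M "slices I" ext_Airy_kernel "configuration L I"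
    by (rule airy_determinantal_process[OF A I(1,2)])
  interpret P': determinantal_process M "slices I'" ext_Airy_kernel "configuration L I'"
    by (rule airy_determinantal_process[OF A I'(1,2)])
  have LE: "line_ensemble M L" using A by (simp add: airy_line_ensemble_def)
  obtain m where m: "0 \<le> m" "snd ` D \<subseteq> {- m..m}" using window_bounded[OF D] .
  obtain C where C: "\<And>s t x y. s \<in> I \<Longrightarrow> t \<in> I \<Longrightarrow> - m \<le> x \<Longrightarrow> - m \<le> y \<Longrightarrow> \<bar>ext_Airy_kernel (s, x) (t, y)\<bar> \<le> C"
    using ext_Airy_kernel_bounded[OF I(1) m(1)] by metis
  have K: "\<bar>ext_Airy_kernel p q\<bar> \<le> C" if "p \<in> D" "q \<in> D" for p q
  proof -
    obtain s x t y where pq: "p = (s, x)" "q = (t, y)" by (cases p, cases q)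
    have "s \<in> I" "t \<in> I" using I(3) that by (force simp: pq)+
    moreover have "- m \<le> x" "- m \<le> y" using m(2) that by (force simp: pq)+
    ultimately show ?thesis unfolding pq by (rule C)
  qed
  have K': "\<bar>ext_Airy_kernel p q\<bar> \<le> C" if pq: "p \<in> ?D'" "q \<in> ?D'" for p q
  proof -
    obtain s x t y where "p = (s + c, x)" "q = (t + c, y)" "(s, x) \<in> D" "(t, y) \<in> D"
      using pq by (auto simp: time_translate_def)
    then show ?thesis using K[of "(s, x)" "(t, y)"] by (simp add: ext_Airy_kernel_shift)
  qed
  have phi: "?\<phi> \<in> measurable (slices I) (slices I')"
    unfolding case_prod_unfold
  proof (rule measurable_Pair)
    show "(\<lambda>p. fst p + c) \<in> measurable (slices I) (count_space I')"
      by (rule measurable_compose[OF measurable_fst]) (auto simp: I'_def)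
    show "(\<lambda>p. snd p) \<in> measurable (slices I) lborel" by simp
  qed
  have vimage: "?\<phi> -` ?D' \<inter> space (slices I) = D"
    using I(3) by (auto simp: time_translate_iff space_pair_measure)
  have mom: "moment_integral (slices I') ext_Airy_kernel n ({..<n} \<rightarrow>\<^sub>E ?D')
    = moment_integral (slices I) ext_Airy_kernel n ({..<n} \<rightarrow>\<^sub>E D)" for n
  proof -
    have "ext_Airy_kernel (?\<phi> p) (?\<phi> q) = ext_Airy_kernel p q" for p q
      using ext_Airy_kernel_shift[of "fst p" c "snd p" "fst q" "snd q"] by (simp add: case_prod_unfold)
    then have "moment_integral (slices I') ext_Airy_kernel n ({..<n} \<rightarrow>\<^sub>E ?D')
      = moment_integral (slices I) ext_Airy_kernel n ({..<n} \<rightarrow>\<^sub>E (?\<phi> -` ?D' \<inter> space (slices I)))"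
      by (rule moment_integral_transport[where \<phi> = ?\<phi>, OF P.sigma_finite_measure_axioms
          P'.correlation_kernel_axioms phi distr_slices_translate[OF I(1), of c, folded I'_def] _
          window_in_slices[OF D' I'(1,3)]])
    then show ?thesis unfolding vimage .
  qed
  have "(\<lambda>n. (- 1) ^ n * (moment_integral (slices I) ext_Airy_kernel n ({..<n} \<rightarrow>\<^sub>E D) / fact n)) sums
      measure M {\<omega> \<in> space M. configuration L I \<omega> \<inter> D = {}}"
    by (rule P.void_probability_sums[OF window_in_slices[OF D I(1,3)] window_finite_emeasure[OF D
        I(1,3)] K])
  moreover have "(\<lambda>n. (- 1) ^ n * (moment_integral (slices I') ext_Airy_kernel n ({..<n} \<rightarrow>\<^sub>E ?D') / fact
      n)) sums
      measure M {\<omega> \<in> space M. configuration L I' \<omega> \<inter> ?D' = {}}"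
    by (rule P'.void_probability_sums[OF window_in_slices[OF D' I'(1,3)] window_finite_emeasure[OF D'
        I'(1,3)] K'])
  ultimately show ?thesis
    unfolding mom void_event_as_configuration_event[OF LE I(3)] void_event_as_configuration_event[OF LE
        I'(3)]
    by (simp add: sums_iff)
qed

text \<open>For large \<open>T\<close> the times \<open>t - T\<close> of the first window are far from those of the second. The bound \<open>C\<close>
  on the kernel is the same for all such \<open>T\<close>: within each window it is a bound for the unshifted
  times, and between the windows the kernel is at most \<open>9\<close> as soon as the times are at least 1
  apart.\<close>

lemma void_events_mixing:
  assumes A: "airy_line_ensemble M L" and D1: "window D1" and D2: "window D2"
  shows "((\<lambda>T. measure M {\<omega> \<in> space M. L \<omega> \<in> void_event (time_translate (- T) D1 \<union> D2)}) \<longlongrightarrow>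
    measure M {\<omega> \<in> space M. L \<omega> \<in> void_event D1} * measure M {\<omega> \<in> space M. L \<omega> \<in> void_event D2}) at_top"
proof -
  define V where "V D = measure M {\<omega> \<in> space M. L \<omega> \<in> void_event D}" for D
  define I1 where "I1 = fst ` D1"
  (* As before, the time 0 makes sure that the set of times is not empty. *)
  define I2 where "I2 = insert 0 (fst ` D2)"
  have LE: "line_ensemble M L" using A by (simp add: airy_line_ensemble_def)
  have fin: "finite I1" "finite I2" using D1 D2 by (auto simp: I1_def I2_def window_def)
  obtain m1 where m1: "0 \<le> m1" "snd ` D1 \<subseteq> {- m1..m1}" using window_bounded[OF D1] .
  obtain m2 where m2: "0 \<le> m2" "snd ` D2 \<subseteq> {- m2..m2}" using window_bounded[OF D2] .
  define m where "m = max m1 m2"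
  have m: "0 \<le> m" "snd ` D1 \<subseteq> {- m..m}" "snd ` D2 \<subseteq> {- m..m}"
    using m1 m2 by (force simp: m_def)+
  obtain C where C9: "9 \<le> C"
    and C: "\<And>s t x y. s \<in> I1 \<union> I2 \<Longrightarrow> t \<in> I1 \<union> I2 \<Longrightarrow> - m \<le> x \<Longrightarrow> - m \<le> y \<Longrightarrow> \<bar>ext_Airy_kernel (s, x) (t, y)\<bar> \<le> C"
    using ext_Airy_kernel_bounded[of "I1 \<union> I2" m] fin m(1) by (metis finite_Un)
  define R where "R = (\<Sum>t\<in>I1 \<union> I2. \<bar>t\<bar>)"
  have R: "\<bar>t\<bar> \<le> R" if "t \<in> I1 \<union> I2" for t
    unfolding R_def using that fin by (intro member_le_sum) auto
  define m' where "m' = real (card I1 + card I2) * (2 * m)"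
  have m'0: "0 \<le> m'" using m(1) by (simp add: m'_def)
  define \<delta> where "\<delta> T = 9 / (T - 2 * R)" for T
  have key: "\<bar>V (time_translate (- T) D1 \<union> D2) - V D1 * V D2\<bar> \<le> decoupling_error C m' (\<delta> T)"
    if T: "2 * R + 1 \<le> T" for T
  proof -
    define I where "I = (\<lambda>t. t - T) ` I1 \<union> I2"
    let ?D1 = "time_translate (- T) D1"
    have fst1: "fst ` ?D1 = (\<lambda>t. t - T) ` I1" by (simp add: fst_time_translate I1_def)
    have I: "finite I" "I \<noteq> {}" "fst ` ?D1 \<subseteq> I" "fst ` D2 \<subseteq> I" "fst ` (?D1 \<union> D2) \<subseteq> I"
      using fin by (auto simp: I_def I2_def fst1 image_Un)
    have card: "real (card I) * (2 * m) \<le> m'"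
    proof -
      have "card I \<le> card ((\<lambda>t. t - T) ` I1) + card I2" unfolding I_def by (rule card_Un_le)
      also have "card ((\<lambda>t. t - T) ` I1) \<le> card I1" by (rule card_image_le[OF fin(1)])
      finally have "real (card I) \<le> real (card I1 + card I2)" by simp
      then show ?thesis unfolding m'_def using m(1) by (intro mult_right_mono) auto
    qed
    interpret P: determinantal_process M "slices I" ext_Airy_kernel "configuration L I"
      by (rule airy_determinantal_process[OF A I(1,2)])
    have W1: "window ?D1" by (rule window_time_translate[OF D1])
    have sep: "T - 2 * R \<le> \<bar>s - T - t\<bar>" "1 \<le> \<bar>s - T - t\<bar>" if "s \<in> I1" "t \<in> I2" for s t
      using R[of s] R[of t] that T by auto
    have p1: "\<exists>s x. p = (s - T, x) \<and> s \<in> I1 \<and> - m \<le> x" if "p \<in> ?D1" for p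
      using that m(2) by (force simp: time_translate_def I1_def)
    have p2: "\<exists>t y. p = (t, y) \<and> t \<in> I2 \<and> - m \<le> y" if "p \<in> D2" for p
    proof -
      obtain t y where p: "p = (t, y)" by (cases p)
      then have "t \<in> I2" "- m \<le> y" using that m(3) by (force simp: I2_def)+
      then show ?thesis using p by blast
    qed
    have K12: "\<bar>ext_Airy_kernel p q\<bar> \<le> \<delta> T \<and> \<bar>ext_Airy_kernel q p\<bar> \<le> \<delta> T" if "p \<in> ?D1" "q \<in> D2" for p q
    proof -
      obtain s x where p: "p = (s - T, x)" "s \<in> I1" using p1[OF \<open>p \<in> ?D1\<close>] by blast
      obtain t y where q: "q = (t, y)" "t \<in> I2" using p2[OF \<open>q \<in> D2\<close>] by blast
      note sep' = sep[OF p(2) q(2)]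
      have ne: "s - T \<noteq> t" using sep'(2) by auto
      have "9 / \<bar>s - T - t\<bar> \<le> \<delta> T"
        unfolding \<delta>_def using sep' T by (intro divide_left_mono) auto
      then show ?thesis
        using ext_Airy_kernel_different_times_bound[OF ne, of x y]
          ext_Airy_kernel_different_times_bound[OF ne[symmetric], of y x]
        unfolding p q by (simp add: abs_minus_commute)
    qed
    have \<delta>9: "\<delta> T \<le> 9" "0 \<le> \<delta> T" using T by (auto simp: \<delta>_def divide_simps)
    have K: "\<bar>ext_Airy_kernel p q\<bar> \<le> C" if pq: "p \<in> ?D1 \<union> D2" "q \<in> ?D1 \<union> D2" for p q
    proof -
      consider "p \<in> ?D1" "q \<in> ?D1" | "p \<in> D2" "q \<in> D2" | "p \<in> ?D1" "q \<in> D2" | "p \<in> D2" "q \<in> ?D1"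
        using pq by blast
      then show ?thesis
      proof cases
        case 1
        obtain s x where p: "p = (s - T, x)" "s \<in> I1" "- m \<le> x" using p1[OF 1(1)] by blast
        obtain t y where q: "q = (t - T, y)" "t \<in> I1" "- m \<le> y" using p1[OF 1(2)] by blast
        show ?thesis using C[of s t x y] p q ext_Airy_kernel_shift[of s "- T" x t y] by simp
      next
        case 2
        then show ?thesis using p2[of p] p2[of q] C by blast
      next
        case 3
        then show ?thesis using K12[OF 3] \<delta>9 C9 by linarith
      next
        case 4
        then show ?thesis using K12[OF 4(2,1)] \<delta>9 C9 by linarith
      qed
    qed
    have disj: "?D1 \<inter> D2 = {}"
    proof (rule ccontr)
      assume "?D1 \<inter> D2 \<noteq> {}"
      then obtain p where "p \<in> ?D1" "p \<in> D2" by blast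
      then obtain s x t y where "p = (s - T, x)" "s \<in> I1" "p = (t, y)" "t \<in> I2"
        using p1[of p] p2[of p] by blast
      then show False using sep(2)[of s t] by auto
    qed
    have small: "measure (slices I) ?D1 \<le> m'" "measure (slices I) D2 \<le> m'"
      using measure_window_le[OF W1 I(1,3), of m] measure_window_le[OF D2 I(1,4), of m] m card
      by (simp_all add: snd_time_translate)
    have "\<bar>measure M {\<omega> \<in> space M. configuration L I \<omega> \<inter> (?D1 \<union> D2) = {}}
      - measure M {\<omega> \<in> space M. configuration L I \<omega> \<inter> ?D1 = {}}
          * measure M {\<omega> \<in> space M. configuration L I \<omega> \<inter> D2 = {}}\<bar>
      \<le> decoupling_error C m' (\<delta> T)"
    proof (rule P.void_probability_decoupling[where C = C and \<delta> = "\<delta> T"])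
      show "?D1 \<in> sets (slices I)" "D2 \<in> sets (slices I)"
        by (rule window_in_slices[OF W1 I(1,3)], rule window_in_slices[OF D2 I(1,4)])
      show "emeasure (slices I) ?D1 \<noteq> \<infinity>" "emeasure (slices I) D2 \<noteq> \<infinity>"
        by (rule window_finite_emeasure[OF W1 I(1,3)], rule window_finite_emeasure[OF D2 I(1,4)])
      show "1 \<le> C" using C9 by simp
    qed (fact small disj K \<delta>9(2) | use K12 in blast)+
    then have "\<bar>V (?D1 \<union> D2) - V ?D1 * V D2\<bar> \<le> decoupling_error C m' (\<delta> T)"
      unfolding V_def void_event_as_configuration_event[OF LE I(3)]
        void_event_as_configuration_event[OF LE I(4)] void_event_as_configuration_event[OF LE I(5)] .
    moreover have "V ?D1 = V D1" unfolding V_def by (rule void_event_stationary[OF A D1])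
    ultimately show ?thesis by simp
  qed
  have "((\<lambda>T. decoupling_error C m' (\<delta> T)) \<longlongrightarrow> 0) at_top"
  proof (rule decoupling_error_tendsto_0[OF m'0])
    show "0 \<le> C" using C9 by simp
    show "(\<delta> \<longlongrightarrow> 0) at_top" unfolding \<delta>_def by real_asymp
    show "\<forall>\<^sub>F T in at_top. 0 \<le> \<delta> T" unfolding \<delta>_def by real_asymp
  qed simp
  moreover have "\<forall>\<^sub>F T in at_top. norm (V (time_translate (- T) D1 \<union> D2) - V D1 * V D2)
      \<le> decoupling_error C m' (\<delta> T)"
    using eventually_ge_at_top[of "2 * R + 1"] by eventually_elim (simp only: real_norm_def key)
  ultimately have "((\<lambda>T. V (time_translate (- T) D1 \<union> D2) - V D1 * V D2) \<longlongrightarrow> 0) at_top"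
    by (rule Lim_null_comparison[rotated])
  then have "((\<lambda>T. V (time_translate (- T) D1 \<union> D2)) \<longlongrightarrow> V D1 * V D2) at_top"
    by (rule LIM_zero_cancel)
  then show ?thesis by (simp add: V_def)
qed

section \<open>Mixing\<close>

text \<open>Tannery's theorem for countable disjoint unions.\<close>

lemma tendsto_measure_UN:
  fixes X :: "nat \<Rightarrow> 'b \<Rightarrow> 'a set"
  assumes P: "prob_space P"
    and X: "\<And>n T. X n T \<in> sets P" "\<And>T. disjoint_family (\<lambda>n. X n T)"
    and bound: "\<And>n T. measure P (X n T) \<le> b n" "summable b"
    and lim: "\<And>n. ((\<lambda>T. measure P (X n T)) \<longlongrightarrow> l n) F" and F: "F \<noteq> bot"
  shows "((\<lambda>T. measure P (\<Union>n. X n T)) \<longlongrightarrow> (\<Sum>n. l n)) F"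
proof -
  interpret prob_space P by fact
  have "((\<lambda>T. \<Sum>n. measure P (X n T)) \<longlongrightarrow> (\<Sum>n. l n)) F"
    by (rule tannerys_theorem[THEN conjunct2, THEN conjunct2, OF lim _ bound(2) F])
      (use bound(1) in \<open>simp add: case_prod_unfold\<close>)
  moreover have "(\<Sum>n. measure P (X n T)) = measure P (\<Union>n. X n T)" for T
    using finite_measure_UNION[of "\<lambda>n. X n T"] X by (simp add: sums_iff image_subset_iff)
  ultimately show ?thesis by simp
qed

text \<open>Mixing needs to be verified only on a generating family that is closed under intersection. With one
  argument fixed, the sets that satisfy the limit form a \<open>\<lambda>\<close>-system: for countable disjoint unions the
  limit and the sum may be exchanged because \<open>\<tau>\<close> preserves the measure, so that the terms are bounded,
  uniformly in \<open>T\<close>, by the summable measures of the pieces. Applying this to each argument in turn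
  gives the claim.\<close>

lemma mixing_from_generator:
  fixes \<tau> :: "'b \<Rightarrow> 'a \<Rightarrow> 'a"
  assumes P: "prob_space P" and G: "Int_stable G" "G \<subseteq> sets P"
    and \<tau>: "\<And>T. \<tau> T \<in> measurable P P"
    and preserving: "\<And>T A. A \<in> G \<Longrightarrow> measure P (\<tau> T -` A \<inter> space P) = measure P A"
    and mixing: "\<And>A B. A \<in> G \<Longrightarrow> B \<in> G \<Longrightarrow>
      ((\<lambda>T. measure P ((\<tau> T -` A \<inter> space P) \<inter> B)) \<longlongrightarrow> measure P A * measure P B) F"
    and F: "F \<noteq> bot"
    and A: "A \<in> sigma_sets (space P) G" and B: "B \<in> sigma_sets (space P) G"
  shows "((\<lambda>T. measure P ((\<tau> T -` A \<inter> space P) \<inter> B)) \<longlongrightarrow> measure P A * measure P B) F"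
proof -
  interpret prob_space P by fact
  let ?\<Sigma> = "sigma_sets (space P) G"
  let ?pre = "\<lambda>T A. \<tau> T -` A \<inter> space P"
  have Gs: "G \<subseteq> Pow (space P)" using G(2) sets.space_closed by blast
  have sub: "A \<in> sets P" if "A \<in> ?\<Sigma>" for A
    using that sets.sigma_sets_subset[OF G(2)] by blast
  have pre: "?pre T A \<in> sets P" if "A \<in> sets P" for T A
    using measurable_sets[OF \<tau> that] .
  have \<tau>sp: "\<tau> T x \<in> space P" if "x \<in> space P" for T x
    using measurable_space[OF \<tau> that] .
  have pres: "measure P (?pre T A) = measure P A" if "A \<in> ?\<Sigma>" for T A
    using G(1) Gs that
  proof (induction rule: sigma_sets_induct_disjoint)
    case (basic A)
    then show ?case by (rule preserving)
  next
    case empty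
    then show ?case by simp
  next
    case (compl A)
    have "?pre T (space P - A) = space P - ?pre T A" using \<tau>sp by auto
    then show ?case using compl sub pre by (simp add: prob_compl)
  next
    case (union X)
    have eq: "?pre T (\<Union>n. X n) = (\<Union>n. ?pre T (X n))" by auto
    have X: "X n \<in> sets P" for n using union(2) sub by auto
    have "(\<lambda>n. measure P (?pre T (X n))) sums measure P (\<Union>n. ?pre T (X n))"
      using union(1) X pre by (intro finite_measure_UNION) (auto simp: disjoint_family_on_def)
    moreover have "(\<lambda>n. measure P (X n)) sums measure P (\<Union>n. X n)"
      using union(1) X by (intro finite_measure_UNION) auto
    ultimately show ?case using union(3) unfolding eq by (simp add: sums_iff)
  qed
  have step: "((\<lambda>T. measure P (?pre T A \<inter> B)) \<longlongrightarrow> measure P A * measure P B) F"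
    if B: "B \<in> G" and A: "A \<in> ?\<Sigma>" for A B
    using G(1) Gs A
  proof (induction rule: sigma_sets_induct_disjoint)
    case (basic A)
    then show ?case using B by (rule mixing)
  next
    case empty
    then show ?case by simp
  next
    case (compl A)
    have Bs: "B \<in> sets P" "B \<subseteq> space P" using B G(2) Gs by auto
    have eq: "measure P (?pre T (space P - A) \<inter> B) = measure P B - measure P (?pre T A \<inter> B)" for T
    proof -
      have "?pre T (space P - A) \<inter> B = B - (?pre T A \<inter> B)" using \<tau>sp Bs by auto
      then show ?thesis using Bs pre[OF sub[OF compl(1)]] by (simp add: finite_measure_Diff)
    qed
    have "((\<lambda>T. measure P B - measure P (?pre T A \<inter> B)) \<longlongrightarrow> measure P B - measure P A * measure P B) F"
      by (intro tendsto_intros compl)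
    moreover have "measure P B - measure P A * measure P B = measure P (space P - A) * measure P B"
      using sub[OF compl(1)] by (simp add: prob_compl algebra_simps)
    ultimately show ?case by (simp only: eq)
  next
    case (union X)
    have Bs: "B \<in> sets P" using B G(2) by auto
    have X: "X n \<in> ?\<Sigma>" "X n \<in> sets P" for n using union(2) sub by auto
    have sumsX: "(\<lambda>n. measure P (X n)) sums measure P (\<Union>n. X n)"
      using union(1) X by (intro finite_measure_UNION) auto
    have "((\<lambda>T. measure P (\<Union>n. ?pre T (X n) \<inter> B)) \<longlongrightarrow> (\<Sum>n. measure P (X n) * measure P B)) F"
    proof (rule tendsto_measure_UN[OF P _ _ _ _ _ F])
      show "?pre T (X n) \<inter> B \<in> sets P" for n T using pre[OF X(2)] Bs by auto
      show "disjoint_family (\<lambda>n. ?pre T (X n) \<inter> B)" for T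
        using union(1) by (auto simp: disjoint_family_on_def)
      show "measure P (?pre T (X n) \<inter> B) \<le> measure P (X n)" for n T
        using pres[OF X(1)] pre[OF X(2)] by (metis finite_measure_mono Int_lower1)
      show "summable (\<lambda>n. measure P (X n))" using sumsX by (simp add: sums_iff)
    qed (use union(3) in blast)
    moreover have "(\<Union>n. ?pre T (X n) \<inter> B) = ?pre T (\<Union>n. X n) \<inter> B" for T by auto
    moreover have "(\<Sum>n. measure P (X n) * measure P B) = measure P (\<Union>n. X n) * measure P B"
      using sums_mult2[OF sumsX] by (simp add: sums_iff)
    ultimately show ?case by simp
  qed
  show ?thesis
    using G(1) Gs B
  proof (induction rule: sigma_sets_induct_disjoint)
    case (basic B)
    then show ?case using A by (rule step)
  next
    case empty
    then show ?case by simp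
  next
    case (compl B)
    have Bs: "B \<in> sets P" by (rule sub[OF compl(1)])
    have As: "?pre T A \<in> sets P" for T by (rule pre[OF sub[OF A]])
    have eq: "measure P (?pre T A \<inter> (space P - B)) = measure P A - measure P (?pre T A \<inter> B)" for T
    proof -
      have "?pre T A \<inter> (space P - B) = ?pre T A - (?pre T A \<inter> B)" by auto
      then have "measure P (?pre T A \<inter> (space P - B)) = measure P (?pre T A) - measure P (?pre T A \<inter> B)"
        using finite_measure_Diff[OF As sets.Int[OF As Bs] Int_lower1] by simp
      then show ?thesis by (simp only: pres[OF A])
    qed
    have "((\<lambda>T. measure P A - measure P (?pre T A \<inter> B)) \<longlongrightarrow> measure P A - measure P A * measure P B) F"
      by (intro tendsto_intros compl)
    moreover have "measure P A - measure P A * measure P B = measure P A * measure P (space P - B)"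
      using Bs by (simp add: prob_compl algebra_simps)
    ultimately show ?case by (simp only: eq)
  next
    case (union X)
    have X: "X n \<in> sets P" for n using union(2) sub by auto
    have As: "?pre T A \<in> sets P" for T by (rule pre[OF sub[OF A]])
    have sumsX: "(\<lambda>n. measure P (X n)) sums measure P (\<Union>n. X n)"
      using union(1) X by (intro finite_measure_UNION) auto
    have "((\<lambda>T. measure P (\<Union>n. ?pre T A \<inter> X n)) \<longlongrightarrow> (\<Sum>n. measure P A * measure P (X n))) F"
    proof (rule tendsto_measure_UN[OF P _ _ _ _ _ F])
      show "?pre T A \<inter> X n \<in> sets P" for n T using As X by auto
      show "disjoint_family (\<lambda>n. ?pre T A \<inter> X n)" for T
        using union(1) by (auto simp: disjoint_family_on_def)
      show "measure P (?pre T A \<inter> X n) \<le> measure P (X n)" for n T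
        using X by (intro finite_measure_mono) auto
      show "summable (\<lambda>n. measure P (X n))" using sumsX by (simp add: sums_iff)
    qed (use union(3) in blast)
    moreover have "(\<Union>n. ?pre T A \<inter> X n) = ?pre T A \<inter> (\<Union>n. X n)" for T by auto
    moreover have "(\<Sum>n. measure P A * measure P (X n)) = measure P A * measure P (\<Union>n. X n)"
      using sums_mult[OF sumsX] by (simp add: sums_iff)
    ultimately show ?case by simp
  qed
qed

lemma horizontal_shift_horizontal_shift [simp]:
  "horizontal_shift s (horizontal_shift (- s) f) = f" "horizontal_shift (- s) (horizontal_shift s f) = f"
  by (auto simp: horizontal_shift_def)

lemma image_horizontal_shift:
  assumes "A \<subseteq> line_space"
  shows "horizontal_shift s ` A = horizontal_shift (- s) -` A \<inter> line_space"
proof (intro Set.equalityI subsetI)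
  fix f assume "f \<in> horizontal_shift s ` A"
  then show "f \<in> horizontal_shift (- s) -` A \<inter> line_space"
    using assms horizontal_shift_in_line_space by auto
next
  fix f assume f: "f \<in> horizontal_shift (- s) -` A \<inter> line_space"
  show "f \<in> horizontal_shift s ` A"
    by (rule image_eqI[of _ _ "horizontal_shift (- s) f"]) (use f in auto)
qed

lemma horizontal_shift_ordered_lines: "f \<in> ordered_lines \<Longrightarrow> horizontal_shift s f \<in> ordered_lines"
  using horizontal_shift_in_line_space[of f s] by (auto simp: ordered_lines_def horizontal_shift_def)

text \<open>On ordered families, \<open>A\<close> and \<open>B\<close> agree with sets from the \<open>\<sigma>\<close>-field generated by void events, and so
  do the shifts of \<open>A\<close>, because a shift of an ordered family is ordered. As the lines are ordered almost
  surely, the probabilities do not change.\<close>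

theorem proposition1p13:
  fixes M :: "'w measure" and L :: "'w \<Rightarrow> nat \<times> real \<Rightarrow> real"
    and A B :: "(nat \<times> real \<Rightarrow> real) set"
  assumes "airy_line_ensemble M L"
    and "A \<in> sets line_borel" and "B \<in> sets line_borel"
  shows "((\<lambda>T. measure (distr M line_borel L) (horizontal_shift T ` A \<inter> B)) \<longlongrightarrow>
           measure (distr M line_borel L) A * measure (distr M line_borel L) B) at_top"
proof -
  define P where "P = distr M line_borel L"
  let ?G = "void_event ` Collect window"
  have M: "prob_space M" and L: "L \<in> measurable M line_borel"
    and ord: "AE \<omega> in M. \<forall>t. \<forall>i\<ge>1. L \<omega> (i, t) > L \<omega> (i + 1, t)"
    using assms(1) by (auto simp: airy_line_ensemble_def line_ensemble_def)
  interpret M: prob_space M by fact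
  have P: "prob_space P" unfolding P_def by (rule M.prob_space_distr[OF L])
  have sets_P [simp]: "sets P = sets line_borel" and space_P [simp]: "space P = line_space"
    by (simp_all add: P_def)
  have G: "?G \<subseteq> sets line_borel" using void_event_measurable by auto
  have P_eq: "measure P X = measure M {\<omega> \<in> space M. L \<omega> \<in> X}" if "X \<in> sets line_borel" for X
    unfolding P_def using that L by (simp add: measure_distr vimage_def Int_def conj_commute)
  have ord': "AE \<omega> in M. L \<omega> \<in> ordered_lines"
    using ord AE_space
    by eventually_elim (use measurable_space[OF L] in \<open>auto simp: ordered_lines_def\<close>)
  have agree: "measure P X = measure P Y"
    if "X \<in> sets line_borel" "Y \<in> sets line_borel" "\<And>f. f \<in> ordered_lines \<Longrightarrow> f \<in> X \<longleftrightarrow> f \<in> Y" for X Y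
    unfolding P_eq[OF that(1)] P_eq[OF that(2)]
  proof (rule measure_eq_AE)
    show "AE \<omega> in M. \<omega> \<in> {\<omega> \<in> space M. L \<omega> \<in> X} \<longleftrightarrow> \<omega> \<in> {\<omega> \<in> space M. L \<omega> \<in> Y}"
      using ord' by eventually_elim (use that(3) in auto)
    show "{\<omega> \<in> space M. L \<omega> \<in> X} \<in> sets M" "{\<omega> \<in> space M. L \<omega> \<in> Y} \<in> sets M"
      using measurable_sets[OF L that(1)] measurable_sets[OF L that(2)]
      by (simp_all add: vimage_def Int_def conj_commute)
  qed
  have shift: "horizontal_shift (- T) -` X \<inter> line_space \<in> sets line_borel" if "X \<in> sets line_borel" for X T
    using measurable_sets[OF measurable_horizontal_shift that, of "- T"] by simp
  obtain A' where A': "A' \<in> sigma_sets line_space ?G" "\<And>f. f \<in> ordered_lines \<Longrightarrow> f \<in> A \<longleftrightarrow> f \<in> A'"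
    using borel_from_void_events[OF assms(2)] by blast
  obtain B' where B': "B' \<in> sigma_sets line_space ?G" "\<And>f. f \<in> ordered_lines \<Longrightarrow> f \<in> B \<longleftrightarrow> f \<in> B'"
    using borel_from_void_events[OF assms(3)] by blast
  have sub: "sigma_sets line_space ?G \<subseteq> sets line_borel"
    using sets.sigma_sets_subset[of ?G line_borel] G by simp
  have mix: "((\<lambda>T. measure P ((horizontal_shift (- T) -` A' \<inter> space P) \<inter> B')) \<longlongrightarrow> measure P A'
      * measure P B') at_top"
  proof (rule mixing_from_generator[OF P, where G = ?G])
    show "Int_stable ?G"
      by (auto simp: Int_stable_def void_event_Int intro: window_Un)
    show "?G \<subseteq> sets P" using G by simp
    show "horizontal_shift (- T) \<in> measurable P P" for T
      using measurable_horizontal_shift by (simp add: P_def)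
    show "measure P (horizontal_shift (- T) -` X \<inter> space P) = measure P X" if X: "X \<in> ?G" for T X
    proof -
      obtain D where D: "window D" "X = void_event D" using X by auto
      show ?thesis
        using void_event_stationary[OF assms(1) D(1), of "- T"] D
        by (simp add: vimage_shift_void_event P_eq void_event_measurable window_time_translate)
    qed
    show "((\<lambda>T. measure P ((horizontal_shift (- T) -` X \<inter> space P) \<inter> Y)) \<longlongrightarrow> measure P X * measure P Y)
        at_top"
      if XY: "X \<in> ?G" "Y \<in> ?G" for X Y
    proof -
      obtain D E where D: "window D" "X = void_event D" and E: "window E" "Y = void_event E" using XY
          by auto
      show ?thesis
        using void_events_mixing[OF assms(1) D(1) E(1)] D E
        by (simp add: vimage_shift_void_event void_event_Int P_eq void_event_measurable window_Un
            window_time_translate)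
    qed
  qed (use A'(1) B'(1) in simp_all)
  have "measure P (horizontal_shift T ` A \<inter> B) =
      measure P ((horizontal_shift (- T) -` A' \<inter> space P) \<inter> B')" for T
  proof (rule agree)
    have "A \<subseteq> line_space" using sets.sets_into_space[OF assms(2)] by simp
    note img = image_horizontal_shift[OF this, of T]
    show "horizontal_shift T ` A \<inter> B \<in> sets line_borel"
      unfolding img using shift[OF assms(2)] assms(3) by (rule sets.Int)
    show "(horizontal_shift (- T) -` A' \<inter> space P) \<inter> B' \<in> sets line_borel"
      using shift[of A' T] A'(1) B'(1) sub by auto
    show "f \<in> horizontal_shift T ` A \<inter> B \<longleftrightarrow> f \<in> (horizontal_shift (- T) -` A' \<inter> space P) \<inter> B'"
      if f: "f \<in> ordered_lines" for f
      unfolding img using A'(2)[OF horizontal_shift_ordered_lines[OF f, of "- T"]] B'(2)[OF f] by simp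
  qed
  moreover have "measure P A = measure P A'" "measure P B = measure P B'"
    using A' B' assms(2,3) sub by (auto intro!: agree)
  ultimately show ?thesis using mix unfolding P_def by simp
qed

end
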